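(* Assume Condition 1, let $n\to\infty$, $K=K_n\to\infty$, and let $\tau=\tau_n>0$ be possibly random with $\tau_n\to0$ and $\tau_n\sqrt n\to\infty$ in probability. Then there is a finite $B$ with $|\varphi|_{\mathcal E}<B$ such that $P(|b_{n,\tau_n}|_{\mathcal E}<B)\to1$, and $|b_{n,\tau_n}-\varphi|_{\mathcal E}\to0$ in probability.
   Context: Let $(\varepsilon_t)_{t\in\mathbb{Z}}$ be i.i.d. real random variables with $\mathbb{E}\varepsilon_t=0$, $\mathbb{E}\varepsilon_t^2=\sigma^2\in(0,\infty)$, $\mathbb{E}\varepsilon_t^4<\infty$. Fix $\lambda>1/2$ and positive constants $\lambda_k$, $k\ge1$, with $c_1k^\lambda\le\lambda_k\le c_2k^\lambda$ for some constants $0<c_1\le c_2<\infty$. For a real sequence $b=(b_k)_{k\ge1}$ put $|b|_{\mathcal E}^2=\sum_{k\ge1}\lambda_k^2b_k^2$, $\mathcal E=\{b:|b|_{\mathcal E}<\infty\}$, and $\mathcal E_K=\{b\in\mathcal E: b_k=0\text{ for }k>K\}$. Condition 1: $\varphi=(\varphi_k)_{k\ge1}\in\mathcal E$; $1-\sum_{k\ge1}\varphi_kz^k\neq0$ for all complex $z$ with $|z|\le1$; and $(Y_t)_{t\in\mathbb{Z}}$ is the causal solution (each $Y_t$ measurable w.r.t. $\sigma(\varepsilon_s:s\le t)$, with $\sup_t\mathbb{E}Y_t^2<\infty$) of $Y_t=\sum_{k\ge1}\varphi_kY_{t-k}+\varepsilon_t$, $t\in\mathbb{Z}$. For $a\in\mathcal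 E$, $X_t(a)=\sum_{k\ge1}a_kY_{t-k}$. The sample is $Y_{-(K-1)},\dots,Y_n$. Penalized estimator ($\tau>0$): $b_{n,\tau}=\arg\min_{b\in\mathcal E_K}\{\frac1n\sum_{t=1}^n(Y_t-X_t(b))^2+\tau|b|_{\mathcal E}^2\}$. *)

theory Defs
  imports "HOL-Probability.Probability"
begin

text \<open>Sequences b = (b_k)_{k>=1} are represented as functions nat => real;
  the value at index 0 is ignored by the norm and forced to 0 in E_K.\<close>

definition Enorm :: "(nat \<Rightarrow> real) \<Rightarrow> (nat \<Rightarrow> real) \<Rightarrow> real" where
  "Enorm lam b = sqrt (\<Sum>k. (lam (Suc k) * b (Suc k))^2)"

definition inE :: "(nat \<Rightarrow> real) \<Rightarrow> (nat \<Rightarrow> real) \<Rightarrow> bool" where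
  "inE lam b \<longleftrightarrow> summable (\<lambda>k. (lam (Suc k) * b (Suc k))^2)"

definition EK :: "(nat \<Rightarrow> real) \<Rightarrow> nat \<Rightarrow> (nat \<Rightarrow> real) set" where
  "EK lam K = {b. inE lam b \<and> (\<forall>k. (k = 0 \<or> K < k) \<longrightarrow> b k = 0)}"

text \<open>X_t(b) = sum_{k>=1} b_k Y_{t-k}, for b in E_K (finite sum).\<close>
definition Xt :: "(int \<Rightarrow> 'a \<Rightarrow> real) \<Rightarrow> nat \<Rightarrow> (nat \<Rightarrow> real) \<Rightarrow> int \<Rightarrow> 'a \<Rightarrow> real" where
  "Xt Y K b t \<omega> = (\<Sum>k=1..K. b k * Y (t - int k) \<omega>)"

definition pen_obj :: "(nat \<Rightarrow> real) \<Rightarrow> (int \<Rightarrow> 'a \<Rightarrow> real) \<Rightarrow> nat \<Rightarrow> nat \<Rightarrow> real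
    \<Rightarrow> 'a \<Rightarrow> (nat \<Rightarrow> real) \<Rightarrow> real" where
  "pen_obj lam Y K n tau \<omega> b =
     (1 / real n) * (\<Sum>t=1..n. (Y (int t) \<omega> - Xt Y K b (int t) \<omega>)^2) + tau * (Enorm lam b)^2"

text \<open>Penalized estimator b_{n,tau}: the (unique, since tau > 0) minimiser over E_K.\<close>
definition pen_est :: "(nat \<Rightarrow> real) \<Rightarrow> (int \<Rightarrow> 'a \<Rightarrow> real) \<Rightarrow> nat \<Rightarrow> nat \<Rightarrow> real
    \<Rightarrow> 'a \<Rightarrow> (nat \<Rightarrow> real)" where
  "pen_est lam Y K n tau \<omega> =
     (THE b. b \<in> EK lam K \<and> (\<forall>b' \<in> EK lam K. pen_obj lam Y K n tau \<omega> b \<le> pen_obj lam Y K n tau \<omega> b'))"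

definition past_sigma :: "'a measure \<Rightarrow> (int \<Rightarrow> 'a \<Rightarrow> real) \<Rightarrow> int \<Rightarrow> 'a measure" where
  "past_sigma M eps t = sigma (space M) (\<Union>s\<in>{..t}. {eps s -` A \<inter> space M | A. A \<in> sets borel})"

end

theory Submission
  imports Defs "HOL-Complex_Analysis.Complex_Analysis" "HOL-Real_Asymp.Real_Asymp"
begin

text \<open>
  Since \<open>lamexp > 1/2\<close>, the coefficients \<open>phi\<close> are absolutely summable, and Wiener's lemma inverts the
  filter \<open>1 - phi\<close> within the absolutely summable series. Hence \<open>Y\<close> is a linear process with
  absolutely summable coefficients, and each sample autocovariance differs from its population value
  by \<open>O(n powr - (1/2))\<close> in mean square, uniformly in the two lags. As the squares of \<open>1 / lam k\<close> are
  summable, the empirical and the population loss at \<open>b\<close> differ by at most \<open>(1 + |b|^2) D\<close> with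
  \<open>D = O_P(n powr - (1/2)) = o_P(tau)\<close>, where \<open>|b|\<close> is the weighted norm.

  Comparing the estimator with a near minimiser \<open>\<beta>\<close> of the population loss over \<open>EK\<close> makes the
  truncation bias harmless however slowly \<open>K\<close> grows: one gets \<open>|b|^2 \<le> |\<beta>|^2 + o_P(1)\<close>, and
  the population loss of \<open>b\<close> tends to its minimum, so that \<open>b\<close> tends to \<open>phi\<close> in \<open>l2\<close>. An inverse
  inequality on \<open>EK\<close> gives \<open>\<beta> \<longlongrightarrow> phi\<close> in the weighted norm. Convergence in \<open>l2\<close> and
  \<open>limsup |b| \<le> |phi|\<close> force convergence in the weighted norm.
\<close>

text \<open>The random factor D is a Hilbert-Schmidt norm: the autocovariance errors rescaled by
  \<open>1 / lam\<close> in both lags. Its second moment is bounded uniformly in K, so K may grow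
  arbitrarily fast; and as D is o_P(tau), the term D |b|^2 is absorbed by the penalty, without any a
  priori bound on b. The obstacle is slow growth of K. The truncation of phi has an excess loss
  governed by K alone, which need not be o(tau), so it is no good as a competitor. Against a near
  minimiser over \<open>EK\<close> the two excess losses cancel up to a slack \<eta>, and only
  \<eta> has to be o(tau). The price is that the near minimiser must itself tend to phi in the
  weighted norm; passing from l2 to that norm costs K^(2 lamexp), which dictates how small \<eta> is
  chosen. Wiener's lemma enters because zeros are excluded on the closed unit disc only, beyond
  which the series of 1 - phi may have no extension, so geometric decay of the inverse coefficients
  cannot be expected.\<close>

section \<open>Absolutely summable power series and Wiener's lemma\<close>

text \<open>One bound on all partial sums carries both absolute summability and a bound on the l1
  norm, and it passes through products and coefficientwise series.\<close>

definition l1_le :: "'a::real_normed_field fps \<Rightarrow> real \<Rightarrow> bool" where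
  "l1_le F c \<longleftrightarrow> (\<forall>N. (\<Sum>k<N. norm (fps_nth F k)) \<le> c)"

lemma l1_leD: "l1_le F c \<Longrightarrow> (\<Sum>k<N. norm (fps_nth F k)) \<le> c"
  by (simp add: l1_le_def)

lemma l1_le_nonneg: "l1_le F c \<Longrightarrow> 0 \<le> c"
  using l1_leD[of F c 0] by simp

lemma l1_le_nth: "l1_le F c \<Longrightarrow> norm (fps_nth F k) \<le> c"
proof -
  assume "l1_le F c"
  then have "(\<Sum>k<Suc k. norm (fps_nth F k)) \<le> c" by (rule l1_leD)
  moreover have "norm (fps_nth F k) \<le> (\<Sum>k<Suc k. norm (fps_nth F k))"
    by (rule member_le_sum) auto
  ultimately show ?thesis by linarith
qed

lemma l1_le_suminf: "summable (\<lambda>k. norm (fps_nth F k)) \<Longrightarrow> l1_le F (\<Sum>k. norm (fps_nth F k))"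
  unfolding l1_le_def by (auto intro: sum_le_suminf)

text \<open>The left side runs over the triangle i + j < N, the right side over the square that
  contains it.\<close>

lemma sum_convolution_le:
  fixes a b :: "nat \<Rightarrow> real"
  assumes "\<And>i. 0 \<le> a i" "\<And>i. 0 \<le> b i"
  shows "(\<Sum>m<N. \<Sum>i\<le>m. a i * b (m - i)) \<le> (\<Sum>i<N. a i) * (\<Sum>i<N. b i)"
proof -
  have "(\<Sum>m<N. \<Sum>i\<le>m. a i * b (m - i)) = (\<Sum>(i,j)\<in>{(i,j). i + j < N}. a i * b j)"
    by (simp add: sum.nat_diff_reindex sum.triangle_reindex)
  also have "\<dots> \<le> (\<Sum>(i,j)\<in>{..<N}\<times>{..<N}. a i * b j)"
    by (rule sum_mono2) (auto simp: assms)
  also have "\<dots> = (\<Sum>i<N. a i) * (\<Sum>i<N. b i)"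
    by (simp add: sum_product sum.cartesian_product)
  finally show ?thesis .
qed

lemma l1_le_mult:
  assumes F: "l1_le F a" and G: "l1_le G b"
  shows "l1_le (F * G) (a * b)"
  unfolding l1_le_def
proof
  fix N
  have "(\<Sum>m<N. norm (fps_nth (F * G) m)) \<le> (\<Sum>m<N. \<Sum>i\<le>m. norm (fps_nth F i) * norm (fps_nth G (m - i)))"
    unfolding fps_mult_nth atLeast0AtMost
    by (intro sum_mono order_trans[OF norm_sum]) (simp add: norm_mult)
  also have "\<dots> \<le> (\<Sum>i<N. norm (fps_nth F i)) * (\<Sum>i<N. norm (fps_nth G i))"
    by (rule sum_convolution_le) auto
  also have "\<dots> \<le> a * b"
    using F G by (intro mult_mono l1_leD) (auto simp: sum_nonneg l1_le_nonneg)
  finally show "(\<Sum>m<N. norm (fps_nth (F * G) m)) \<le> a * b" .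
qed

lemma sum_up_add: "(\<Sum>k<m + n. f k) = (\<Sum>k<m. f k) + (\<Sum>k<n. f (k + m))" for f :: "nat \<Rightarrow> 'a::comm_monoid_add"
  by (induction n) (simp_all add: add.assoc add.commute[of m])

lemma l1_le_one: "l1_le 1 1"
  unfolding l1_le_def
proof
  fix N
  have "(\<Sum>k<N. norm (fps_nth (1::'a fps) k)) = (\<Sum>k<N. if k = 0 then 1 else 0)"
    by (rule sum.cong) auto
  then show "(\<Sum>k<N. norm (fps_nth (1::'a fps) k)) \<le> 1" by simp
qed

lemma l1_le_power: "l1_le F a \<Longrightarrow> l1_le (F ^ n) (a ^ n)"
  by (induction n) (auto simp: l1_le_one intro: l1_le_mult)

text \<open>Cauchy's inequality is applied to the n-th power itself, so the factor \<rho> / (\<rho>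
  - 1) is paid once. Multiplying n copies of the bound for exponent 1 would raise that factor to the
  power n and spoil the geometric series built on this lemma.\<close>

lemma l1_le_inverse_poly_power:
  fixes p :: "complex poly"
  assumes \<rho>: "1 < \<rho>" and \<delta>: "0 < \<delta>" and p: "\<And>z. cmod z \<le> \<rho> \<Longrightarrow> \<delta> \<le> cmod (poly p z)"
  shows "l1_le (inverse (fps_of_poly p) ^ n) (1 / \<delta> ^ n * (\<rho> / (\<rho> - 1)))"
proof -
  define f where "f = (\<lambda>z. inverse (poly p z) ^ n)"
  have nz: "poly p z \<noteq> 0" if "cmod z \<le> \<rho>" for z using p[OF that] \<delta> by auto
  have "poly p has_fps_expansion fps_of_poly p"
    by (simp add: has_fps_expansion_def)
  moreover have "fps_nth (fps_of_poly p) 0 \<noteq> 0" using nz[of 0] \<rho> by (simp add: poly_0_coeff_0)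
  ultimately have ex: "f has_fps_expansion inverse (fps_of_poly p) ^ n"
    unfolding f_def by (intro has_fps_expansion_power has_fps_expansion_inverse)
  have bnd: "norm ((deriv ^^ k) f 0) \<le> fact k * (1 / \<delta> ^ n) / \<rho> ^ k" for k
  proof (rule Cauchy_inequality)
    show "f holomorphic_on ball 0 \<rho>" unfolding f_def using nz by (intro holomorphic_intros) auto
    show "continuous_on (cball 0 \<rho>) f" unfolding f_def using nz by (intro continuous_intros) auto
    show "0 < \<rho>" using \<rho> by simp
    fix z assume "cmod (0 - z) = \<rho>"
    then have "\<delta> \<le> cmod (poly p z)" using p[of z] by simp
    then have "inverse (cmod (poly p z)) ^ n \<le> inverse \<delta> ^ n"
      using \<delta> by (intro power_mono le_imp_inverse_le) auto
    then show "norm (f z) \<le> 1 / \<delta> ^ n" unfolding f_def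
      by (simp add: norm_power norm_inverse power_inverse inverse_eq_divide power_divide norm_divide)
  qed
  have coef: "norm (fps_nth (inverse (fps_of_poly p) ^ n) k) \<le> 1 / \<delta> ^ n * (1 / \<rho>) ^ k" for k
    using bnd[of k] \<rho> \<delta> unfolding fps_nth_fps_expansion[OF ex]
    by (simp add: norm_divide divide_simps mult_ac)
  show ?thesis unfolding l1_le_def
  proof
    fix N
    have "(\<Sum>k<N. norm (fps_nth (inverse (fps_of_poly p) ^ n) k)) \<le> (\<Sum>k<N. 1 / \<delta> ^ n * (1 / \<rho>) ^ k)"
      by (intro sum_mono coef)
    also have "\<dots> = 1 / \<delta> ^ n * (\<Sum>k<N. (1 / \<rho>) ^ k)" by (simp add: sum_distrib_left)
    also have "(\<Sum>k<N. (1 / \<rho>) ^ k) \<le> (\<Sum>k. (1 / \<rho>) ^ k)"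
      using \<rho> by (intro sum_le_suminf summable_geometric) auto
    also have "(\<Sum>k. (1 / \<rho>) ^ k) = \<rho> / (\<rho> - 1)"
      using \<rho> by (subst suminf_geometric) (auto simp: field_simps)
    finally show "(\<Sum>k<N. norm (fps_nth (inverse (fps_of_poly p) ^ n) k)) \<le> 1 / \<delta> ^ n * (\<rho> / (\<rho> - 1))"
      using \<delta> by (auto simp: mult_left_mono divide_right_mono)
  qed
qed

text \<open>Newman's argument: \<open>1 / Q\<close> is expanded in powers of \<open>p - Q\<close> for a polynomial \<open>p\<close> close to
  \<open>Q\<close>, and Cauchy's inequality on a larger disc controls the powers of \<open>1 / p\<close>.\<close>

lemma l1_le_inverse_if_close_to_poly:
  fixes Q :: "complex fps" and p :: "complex poly"
  assumes T: "l1_le (fps_of_poly p - Q) \<theta>" and \<theta>: "\<theta> < \<delta>"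
    and \<rho>: "1 < \<rho>" and \<delta>: "0 < \<delta>" and p: "\<And>z. cmod z \<le> \<rho> \<Longrightarrow> \<delta> \<le> cmod (poly p z)"
  shows "\<exists>R c. l1_le R c \<and> Q * R = 1"
proof -
  define P where "P = fps_of_poly p"
  define C where "C = 1 / \<delta> * (\<rho> / (\<rho> - 1))"
  \<comment> \<open>Terms of the Neumann series of 1 / Q around 1 / P. Since Q = P - (P - Q),
    multiplying \<open>q n\<close> by Q leaves a difference that telescopes along
    \<open>w\<close>.\<close>
  define q where "q = (\<lambda>n. (P - Q) ^ n * inverse P ^ Suc n)"
  define w where "w = (\<lambda>n. (P - Q) ^ n * inverse P ^ n)"
  have \<theta>0: "0 \<le> \<theta>" using T by (rule l1_le_nonneg)
  have C0: "0 \<le> C" using \<rho> \<delta> by (simp add: C_def)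
  define r where "r = \<theta> / \<delta>"
  have r: "0 \<le> r" "r < 1" using \<theta>0 \<theta> \<delta> by (auto simp: r_def)
  have "poly p 0 \<noteq> 0" using p[of 0] \<rho> \<delta> by auto
  then have "fps_nth P 0 \<noteq> 0" by (simp add: P_def poly_0_coeff_0)
  then have PR: "P * inverse P = 1" by (rule inverse_mult_eq_1')
  have inv: "l1_le (inverse P ^ n) (1 / \<delta> ^ n * (\<rho> / (\<rho> - 1)))" for n
    unfolding P_def by (rule l1_le_inverse_poly_power[OF \<rho> \<delta> p])
  have q: "l1_le (q n) (r ^ n * C)" for n
  proof -
    have "l1_le (q n) (\<theta> ^ n * (1 / \<delta> ^ Suc n * (\<rho> / (\<rho> - 1))))"
      unfolding q_def using l1_le_power[OF T[folded P_def]] by (intro l1_le_mult inv)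
    also have "\<theta> ^ n * (1 / \<delta> ^ Suc n * (\<rho> / (\<rho> - 1))) = r ^ n * C"
      by (simp add: r_def C_def power_divide)
    finally show ?thesis .
  qed
  have sq: "summable (\<lambda>n. r ^ n * C)" using r by (intro summable_mult2 summable_geometric) simp
  have sn: "summable (\<lambda>n. norm (fps_nth (q n) k))" for k
    by (rule summable_comparison_test[OF _ sq]) (auto intro: l1_le_nth[OF q])
  have s: "summable (\<lambda>n. fps_nth (q n) k)" for k
    by (rule summable_norm_cancel[OF sn])
  define R where "R = Abs_fps (\<lambda>k. \<Sum>n. fps_nth (q n) k)"
  have "l1_le R (\<Sum>n. r ^ n * C)" unfolding l1_le_def
  proof
    fix N
    have "(\<Sum>k<N. norm (fps_nth R k)) \<le> (\<Sum>k<N. \<Sum>n. norm (fps_nth (q n) k))"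
      unfolding R_def fps_nth_Abs_fps by (intro sum_mono summable_norm sn)
    also have "\<dots> = (\<Sum>n. \<Sum>k<N. norm (fps_nth (q n) k))"
      by (rule suminf_sum[symmetric]) (rule sn)
    also have "\<dots> \<le> (\<Sum>n. r ^ n * C)"
      by (intro suminf_le summable_sum sn sq l1_leD q)
    finally show "(\<Sum>k<N. norm (fps_nth R k)) \<le> (\<Sum>n. r ^ n * C)" .
  qed
  moreover have "Q * R = 1"
  proof (rule fps_ext)
    fix m
    have qw: "Q * q n = w n - w (Suc n)" for n
    proof -
      have "Q * q n = P * q n - (P - Q) * q n" by (simp only: left_diff_distrib) simp
      also have "P * q n = w n * (P * inverse P)" unfolding q_def w_def power_Suc by (simp only: mult_ac)
      also have "(P - Q) * q n = w (Suc n)" unfolding q_def w_def power_Suc by (simp only: mult_ac)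
      finally show ?thesis using PR by simp
    qed
    have wn: "norm (fps_nth (w n) m) \<le> r ^ n * (C * \<delta>)" for n
    proof -
      have "l1_le (w n) (\<theta> ^ n * (1 / \<delta> ^ n * (\<rho> / (\<rho> - 1))))"
        unfolding w_def using l1_le_power[OF T[folded P_def]] by (intro l1_le_mult inv)
      also have "\<theta> ^ n * (1 / \<delta> ^ n * (\<rho> / (\<rho> - 1))) = r ^ n * (C * \<delta>)"
        using \<delta> by (simp add: r_def C_def power_divide)
      finally show ?thesis by (rule l1_le_nth)
    qed
    have "(\<lambda>n. r ^ n * (C * \<delta>)) \<longlonglongrightarrow> 0 * (C * \<delta>)"
      using r by (intro tendsto_mult_right LIMSEQ_realpow_zero)
    then have "(\<lambda>n. r ^ n * (C * \<delta>)) \<longlonglongrightarrow> 0" by simp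
    with always_eventually[OF allI[OF wn]] have w0: "(\<lambda>n. fps_nth (w n) m) \<longlonglongrightarrow> 0"
      by (rule Lim_null_comparison)
    have "(\<lambda>n. fps_nth (w n) m - fps_nth (w (Suc n)) m) sums (fps_nth (w 0) m - 0)"
      by (rule telescope_sums'[OF w0])
    then have *: "(\<lambda>n. fps_nth (Q * q n) m) sums fps_nth 1 m"
      unfolding qw by (simp add: w_def)
    have "(\<lambda>n. \<Sum>i=0..m. fps_nth Q i * fps_nth (q n) (m - i)) sums
          (\<Sum>i=0..m. fps_nth Q i * (\<Sum>n. fps_nth (q n) (m - i)))"
      by (intro sums_sum sums_mult summable_sums s)
    then have "(\<lambda>n. fps_nth (Q * q n) m) sums fps_nth (Q * R) m"
      by (simp add: fps_mult_nth R_def)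
    with * show "fps_nth (Q * R) m = fps_nth 1 m" by (rule sums_unique2[rotated])
  qed
  ultimately show ?thesis by blast
qed

text \<open>Q may have no extension past the closed disc, but its partial sum p does. With \<delta>
  the minimum of |Q| on the disc, an l1 tail of \<delta> / 4 keeps |p| \<ge> 3 \<delta> / 4 there,
  and uniform continuity keeps |p| \<ge> \<delta> / 2 on a slightly larger disc. The gap between
  \<delta> / 4 and \<delta> / 2 makes the Neumann series converge.\<close>

lemma l1_le_inverse_complex:
  fixes Q :: "complex fps"
  assumes Q: "summable (\<lambda>k. norm (fps_nth Q k))"
    and nz: "\<And>z. cmod z \<le> 1 \<Longrightarrow> (\<Sum>k. fps_nth Q k * z ^ k) \<noteq> 0"
  shows "\<exists>R c. l1_le R c \<and> Q * R = 1"
proof -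
  define g where "g = (\<lambda>z. \<Sum>k. fps_nth Q k * z ^ k)"
  have le: "norm (fps_nth Q k * z ^ k) \<le> norm (fps_nth Q k)" if "z \<in> cball 0 1" for k z
    using that by (simp add: norm_mult norm_power mult_left_le power_le_one)
  have "uniform_limit (cball 0 1) (\<lambda>n z. \<Sum>k<n. fps_nth Q k * z ^ k) g sequentially"
    unfolding g_def by (rule Weierstrass_m_test[OF le Q])
  then have "continuous_on (cball 0 1) g"
    by (rule uniform_limit_theorem[rotated]) (auto intro!: always_eventually continuous_intros)
  then have "continuous_on (cball 0 1) (\<lambda>z. norm (g z))" by (intro continuous_intros)
  then obtain z0 where z0: "z0 \<in> cball 0 1" "\<And>z. z \<in> cball 0 1 \<Longrightarrow> norm (g z0) \<le> norm (g z)"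
    using continuous_attains_inf[of "cball (0::complex) 1" "\<lambda>z. norm (g z)"] by auto
  define \<delta> where "\<delta> = norm (g z0)"
  have \<delta>: "0 < \<delta>" using nz[of z0] z0(1) by (simp add: \<delta>_def g_def)
  obtain N where N: "\<And>m. m \<ge> N \<Longrightarrow> norm (\<Sum>k. norm (fps_nth Q (k + m))) < \<delta> / 4"
    using suminf_exist_split[of "\<delta>/4" "\<lambda>k. norm (fps_nth Q k)"] \<delta> Q by auto
  define p where "p = (\<Sum>k<N. monom (fps_nth Q k) k)"
  have cp: "coeff p k = (if k < N then fps_nth Q k else 0)" for k
    by (simp add: p_def coeff_sum)
  have pz: "poly p z = (\<Sum>k<N. fps_nth Q k * z ^ k)" for z
    by (simp add: p_def poly_sum poly_monom)
  have sN: "summable (\<lambda>k. norm (fps_nth Q (k + N)))" using Q by (rule summable_ignore_initial_segment)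
  have T: "l1_le (fps_of_poly p - Q) (\<delta> / 4)" unfolding l1_le_def
  proof
    fix M
    have "(\<Sum>k<M. norm (fps_nth (fps_of_poly p - Q) k)) \<le> (\<Sum>k<M+N. norm (fps_nth (fps_of_poly p - Q) k))"
      by (rule sum_mono2) auto
    also have "\<dots> = (\<Sum>k<N. norm (fps_nth (fps_of_poly p - Q) k)) + (\<Sum>k<M. norm (fps_nth (fps_of_poly p - Q) (k + N)))"
      by (subst add.commute) (simp add: sum_up_add)
    also have "\<dots> = (\<Sum>k<M. norm (fps_nth Q (k + N)))" by (simp add: cp)
    also have "\<dots> \<le> (\<Sum>k. norm (fps_nth Q (k + N)))" by (rule sum_le_suminf[OF sN]) auto
    also have "\<dots> \<le> \<delta> / 4" using N[of N] by simp
    finally show "(\<Sum>k<M. norm (fps_nth (fps_of_poly p - Q) k)) \<le> \<delta> / 4" .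
  qed
  have p1: "3 / 4 * \<delta> \<le> cmod (poly p z)" if z: "cmod z \<le> 1" for z
  proof -
    have sm: "summable (\<lambda>k. fps_nth Q k * z ^ k)"
      by (rule summable_norm_cancel, rule summable_comparison_test'[OF Q, of 0]) (use le[of z] z in auto)
    have "g z - poly p z = (\<Sum>k. fps_nth Q (k + N) * z ^ (k + N))"
      unfolding g_def pz using suminf_minus_initial_segment[OF sm, of N] by simp
    also have "norm \<dots> \<le> (\<Sum>k. norm (fps_nth Q (k + N)))"
      by (rule norm_suminf_le[OF _ sN]) (use le[of z] z in auto)
    also have "\<dots> \<le> \<delta> / 4" using N[of N] by simp
    finally have "norm (g z - poly p z) \<le> \<delta> / 4" .
    moreover have "\<delta> \<le> norm (g z)" using z0(2)[of z] z by (simp add: \<delta>_def)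
    ultimately show ?thesis using norm_triangle_sub[of "g z" "poly p z"] by linarith
  qed
  have "uniformly_continuous_on (cball (0::complex) 2) (poly p)"
    by (intro compact_uniformly_continuous continuous_on_poly continuous_on_id compact_cball)
  then obtain h where h: "0 < h" "\<And>z w. z \<in> cball 0 2 \<Longrightarrow> w \<in> cball 0 2 \<Longrightarrow> dist w z < h \<Longrightarrow> dist (poly p w) (poly p z) < \<delta> / 4"
    unfolding uniformly_continuous_on_def using \<delta> by (auto dest!: spec[of _ "\<delta> / 4"])
  \<comment> \<open>A radius of at most 2 stays where p is known to be uniformly continuous; \<rho>
    - 1 < h puts every z outside the unit disc within h of its radial projection onto the
    circle.\<close>
  define \<rho> where "\<rho> = 1 + min (h / 2) 1"
  have \<rho>: "1 < \<rho>" "\<rho> \<le> 2" "\<rho> < 1 + h" using h(1) by (auto simp: \<rho>_def)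
  have p2: "\<delta> / 2 \<le> cmod (poly p z)" if z: "cmod z \<le> \<rho>" for z
  proof (cases "cmod z \<le> 1")
    case True then show ?thesis using p1[OF True] \<delta> by simp
  next
    case False
    define w where "w = z /\<^sub>R cmod z"
    have "z \<noteq> 0" using False by (metis norm_zero zero_le_one)
    then have w1: "cmod w = 1" by (simp add: w_def)
    have "z - w = (1 - inverse (cmod z)) *\<^sub>R z" by (simp add: w_def scaleR_diff_left)
    then have "cmod (z - w) = \<bar>1 - inverse (cmod z)\<bar> * cmod z" by simp
    also have "\<dots> = (1 - inverse (cmod z)) * cmod z"
      using False by (simp add: inverse_le_1_iff)
    also have "\<dots> = cmod z - 1" using \<open>z \<noteq> 0\<close> by (simp add: left_diff_distrib)
    finally have "dist w z < h" using z \<rho> by (simp add: dist_norm norm_minus_commute)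
    then have "dist (poly p w) (poly p z) < \<delta> / 4" using w1 z \<rho> by (intro h(2)) auto
    then have "norm (poly p w - poly p z) < \<delta> / 4" by (simp add: dist_norm)
    then show ?thesis using p1[of w] w1 norm_triangle_sub[of "poly p w" "poly p z"] by simp
  qed
  show ?thesis
    by (rule l1_le_inverse_if_close_to_poly[OF T _ \<rho>(1) _ p2]) (use \<delta> in auto)
qed

lemma l1_le_inverse_real:
  fixes Q :: "real fps"
  assumes Q: "summable (\<lambda>k. norm (fps_nth Q k))"
    and nz: "\<And>z::complex. cmod z \<le> 1 \<Longrightarrow> (\<Sum>k. complex_of_real (fps_nth Q k) * z ^ k) \<noteq> 0"
  shows "\<exists>R c. l1_le R c \<and> Q * R = 1"
proof -
  define Q' where "Q' = Abs_fps (\<lambda>k. complex_of_real (fps_nth Q k))"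
  obtain R' c where R': "l1_le R' c" "Q' * R' = 1"
    using l1_le_inverse_complex[of Q'] Q nz by (auto simp: Q'_def)
  define R where "R = Abs_fps (\<lambda>k. Re (fps_nth R' k))"
  have "l1_le R c" unfolding l1_le_def
  proof
    fix N
    have "(\<Sum>k<N. norm (fps_nth R k)) \<le> (\<Sum>k<N. norm (fps_nth R' k))"
      by (intro sum_mono) (simp add: R_def abs_Re_le_cmod)
    also have "\<dots> \<le> c" by (rule l1_leD[OF R'(1)])
    finally show "(\<Sum>k<N. norm (fps_nth R k)) \<le> c" .
  qed
  moreover have "Q * R = 1"
  proof (rule fps_ext)
    fix m
    have "fps_nth (Q * R) m = Re (fps_nth (Q' * R') m)"
      by (simp add: fps_mult_nth R_def Q'_def)
    then show "fps_nth (Q * R) m = fps_nth 1 m" by (simp add: R'(2))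
  qed
  ultimately show ?thesis by blast
qed

section \<open>Second moments of weighted and orthogonal sums\<close>

text \<open>Cauchy-Schwarz with the weight split evenly between the two factors. In expectation the
  right side involves only second moments of the single x i, no correlations, and costs the l1 norm
  of w.\<close>

lemma weighted_sum_square_le:
  fixes w x :: "'i \<Rightarrow> real"
  assumes "finite I"
  shows "(\<Sum>i\<in>I. w i * x i)\<^sup>2 \<le> (\<Sum>i\<in>I. \<bar>w i\<bar>) * (\<Sum>i\<in>I. \<bar>w i\<bar> * (x i)\<^sup>2)"
proof -
  have "(\<Sum>i\<in>I. w i * x i)\<^sup>2 = (\<Sum>i\<in>I. sqrt \<bar>w i\<bar> * (sgn (w i) * sqrt \<bar>w i\<bar> * x i))\<^sup>2"
  proof (intro arg_cong[where f = "\<lambda>z. z\<^sup>2"] sum.cong refl)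
    fix i
    have "sqrt \<bar>w i\<bar> * (sgn (w i) * sqrt \<bar>w i\<bar> * x i) = sgn (w i) * (sqrt \<bar>w i\<bar> * sqrt \<bar>w i\<bar>) * x i"
      by (simp only: mult_ac)
    then show "w i * x i = sqrt \<bar>w i\<bar> * (sgn (w i) * sqrt \<bar>w i\<bar> * x i)" by (simp only: real_sqrt_mult_self abs_abs sgn_mult_abs)
  qed
  also have "\<dots> \<le> (\<Sum>i\<in>I. (sqrt \<bar>w i\<bar>)\<^sup>2) * (\<Sum>i\<in>I. (sgn (w i) * sqrt \<bar>w i\<bar> * x i)\<^sup>2)"
    by (rule Cauchy_Schwarz_ineq_sum)
  also have "(\<Sum>i\<in>I. (sgn (w i) * sqrt \<bar>w i\<bar> * x i)\<^sup>2) = (\<Sum>i\<in>I. \<bar>w i\<bar> * (x i)\<^sup>2)"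
    by (intro sum.cong) (auto simp: power_mult_distrib sgn_if)
  finally show ?thesis by simp
qed

context prob_space
begin

lemma integrable_power_le:
  fixes X :: "'a \<Rightarrow> real"
  assumes [measurable]: "X \<in> borel_measurable M" and X: "integrable M (\<lambda>x. X x ^ 4)" and k: "k \<le> 4"
  shows "integrable M (\<lambda>x. X x ^ k)"
proof (rule Bochner_Integration.integrable_bound)
  show "integrable M (\<lambda>x. 1 + X x ^ 4)" using X by simp
  have "norm (r ^ k) \<le> norm (1 + r ^ 4)" for r :: real
  proof -
    have "\<bar>r\<bar> ^ k \<le> 1 + \<bar>r\<bar> ^ 4"
    proof (cases "\<bar>r\<bar> \<le> 1")
      case True
      then have "\<bar>r\<bar> ^ k \<le> 1" by (intro power_le_one) auto
      then show ?thesis using zero_le_power[of "\<bar>r\<bar>" 4] by linarith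
    next
      case False
      then have "\<bar>r\<bar> ^ k \<le> \<bar>r\<bar> ^ 4" using k by (intro power_increasing) auto
      then show ?thesis by simp
    qed
    then show ?thesis by (simp add: power_abs power_even_abs)
  qed
  then show "AE x in M. norm (X x ^ k) \<le> norm (1 + X x ^ 4)" by simp
qed simp

lemma expectation_weighted_sum_square_le:
  fixes x :: "'i \<Rightarrow> 'a \<Rightarrow> real"
  assumes "finite I"
    and [measurable]: "\<And>i. i \<in> I \<Longrightarrow> x i \<in> borel_measurable M"
    and i: "\<And>i. i \<in> I \<Longrightarrow> integrable M (\<lambda>\<omega>. (x i \<omega>)\<^sup>2)"
    and C: "\<And>i. i \<in> I \<Longrightarrow> expectation (\<lambda>\<omega>. (x i \<omega>)\<^sup>2) \<le> C"
  shows "integrable M (\<lambda>\<omega>. (\<Sum>i\<in>I. w i * x i \<omega>)\<^sup>2)"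
    and "expectation (\<lambda>\<omega>. (\<Sum>i\<in>I. w i * x i \<omega>)\<^sup>2) \<le> (\<Sum>i\<in>I. \<bar>w i\<bar>)\<^sup>2 * C"
proof -
  let ?R = "\<lambda>\<omega>. (\<Sum>i\<in>I. \<bar>w i\<bar>) * (\<Sum>i\<in>I. \<bar>w i\<bar> * (x i \<omega>)\<^sup>2)"
  have iR: "integrable M ?R" using i by (intro Bochner_Integration.integrable_mult_right Bochner_Integration.integrable_sum) auto
  have le: "(\<Sum>i\<in>I. w i * x i \<omega>)\<^sup>2 \<le> ?R \<omega>" for \<omega> by (rule weighted_sum_square_le[OF assms(1)])
  show int: "integrable M (\<lambda>\<omega>. (\<Sum>i\<in>I. w i * x i \<omega>)\<^sup>2)"
  proof (rule Bochner_Integration.integrable_bound[OF iR])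
    show "AE \<omega> in M. norm ((\<Sum>i\<in>I. w i * x i \<omega>)\<^sup>2) \<le> norm (?R \<omega>)"
    proof (rule AE_I2)
      fix \<omega>
      have "norm ((\<Sum>i\<in>I. w i * x i \<omega>)\<^sup>2) = (\<Sum>i\<in>I. w i * x i \<omega>)\<^sup>2" by simp
      also have "\<dots> \<le> ?R \<omega>" by (rule le)
      also have "\<dots> \<le> norm (?R \<omega>)" unfolding real_norm_def by (rule abs_ge_self)
      finally show "norm ((\<Sum>i\<in>I. w i * x i \<omega>)\<^sup>2) \<le> norm (?R \<omega>)" .
    qed
  qed measurable
  have "expectation (\<lambda>\<omega>. (\<Sum>i\<in>I. w i * x i \<omega>)\<^sup>2) \<le> expectation ?R"
    by (rule integral_mono[OF int iR le])
  also have "\<dots> = (\<Sum>i\<in>I. \<bar>w i\<bar>) * (\<Sum>i\<in>I. \<bar>w i\<bar> * expectation (\<lambda>\<omega>. (x i \<omega>)\<^sup>2))"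
    using i by (simp add: Bochner_Integration.integral_sum)
  also have "\<dots> \<le> (\<Sum>i\<in>I. \<bar>w i\<bar>) * (\<Sum>i\<in>I. \<bar>w i\<bar> * C)"
    using C by (intro mult_left_mono sum_mono) (auto intro: sum_nonneg)
  also have "\<dots> = (\<Sum>i\<in>I. \<bar>w i\<bar>)\<^sup>2 * C" by (simp add: sum_distrib_right[symmetric] power2_eq_square)
  finally show "expectation (\<lambda>\<omega>. (\<Sum>i\<in>I. w i * x i \<omega>)\<^sup>2) \<le> (\<Sum>i\<in>I. \<bar>w i\<bar>)\<^sup>2 * C" .
qed

text \<open>Fatou's lemma: almost sure convergence already transfers a uniform bound on second
  moments to the limit.\<close>

lemma expectation_square_le_limit:
  fixes S :: "nat \<Rightarrow> 'a \<Rightarrow> real"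
  assumes [measurable]: "\<And>N. S N \<in> borel_measurable M" "T \<in> borel_measurable M"
    and int: "\<And>N. integrable M (\<lambda>\<omega>. (S N \<omega>)\<^sup>2)"
    and C: "\<And>N. expectation (\<lambda>\<omega>. (S N \<omega>)\<^sup>2) \<le> C"
    and lim: "AE \<omega> in M. (\<lambda>N. S N \<omega>) \<longlonglongrightarrow> T \<omega>"
  shows "integrable M (\<lambda>\<omega>. (T \<omega>)\<^sup>2)" "expectation (\<lambda>\<omega>. (T \<omega>)\<^sup>2) \<le> C"
proof -
  have C0: "0 \<le> C" using order_trans[OF _ C[of 0]] by simp
  have "(\<integral>\<^sup>+\<omega>. ennreal ((T \<omega>)\<^sup>2) \<partial>M) = (\<integral>\<^sup>+\<omega>. liminf (\<lambda>N. ennreal ((S N \<omega>)\<^sup>2)) \<partial>M)"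
  proof (rule nn_integral_cong_AE)
    show "AE \<omega> in M. ennreal ((T \<omega>)\<^sup>2) = liminf (\<lambda>N. ennreal ((S N \<omega>)\<^sup>2))"
      using lim
    proof eventually_elim
      case (elim \<omega>)
      then have "(\<lambda>N. ennreal ((S N \<omega>)\<^sup>2)) \<longlonglongrightarrow> ennreal ((T \<omega>)\<^sup>2)"
        by (intro tendsto_ennrealI tendsto_power)
      then show ?case by (rule lim_imp_Liminf[OF trivial_limit_sequentially, symmetric])
    qed
  qed
  also have "\<dots> \<le> liminf (\<lambda>N. \<integral>\<^sup>+\<omega>. ennreal ((S N \<omega>)\<^sup>2) \<partial>M)"
    by (rule nn_integral_liminf) simp
  also have "\<dots> \<le> liminf (\<lambda>N::nat. ennreal C)"
  proof (rule Liminf_mono, rule always_eventually, rule allI)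
    fix N
    have "(\<integral>\<^sup>+\<omega>. ennreal ((S N \<omega>)\<^sup>2) \<partial>M) = ennreal (expectation (\<lambda>\<omega>. (S N \<omega>)\<^sup>2))"
      by (rule nn_integral_eq_integral[OF int]) simp
    then show "(\<integral>\<^sup>+\<omega>. ennreal ((S N \<omega>)\<^sup>2) \<partial>M) \<le> ennreal C" using C[of N] by (simp add: ennreal_leI)
  qed
  also have "\<dots> = ennreal C" by (simp add: Liminf_const)
  finally have le: "(\<integral>\<^sup>+\<omega>. ennreal ((T \<omega>)\<^sup>2) \<partial>M) \<le> ennreal C" .
  show int: "integrable M (\<lambda>\<omega>. (T \<omega>)\<^sup>2)"
    by (rule integrableI_nonneg) (use le in \<open>auto intro: le_less_trans\<close>)
  have "ennreal (expectation (\<lambda>\<omega>. (T \<omega>)\<^sup>2)) \<le> ennreal C"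
    using le by (subst nn_integral_eq_integral[OF int, symmetric]) auto
  then show "expectation (\<lambda>\<omega>. (T \<omega>)\<^sup>2) \<le> C" using C0 by simp
qed

lemma expectation_prod_powers:
  fixes e :: "'i \<Rightarrow> 'a \<Rightarrow> real"
  assumes ind: "indep_vars (\<lambda>_. borel) e UNIV"
    and int4: "\<And>t. integrable M (\<lambda>\<omega>. e t \<omega> ^ 4)"
    and I: "finite I" and m: "\<And>i. i \<in> I \<Longrightarrow> m i \<le> 4"
  shows "expectation (\<lambda>\<omega>. \<Prod>i\<in>I. e i \<omega> ^ m i) = (\<Prod>i\<in>I. expectation (\<lambda>\<omega>. e i \<omega> ^ m i))"
    and "integrable M (\<lambda>\<omega>. \<Prod>i\<in>I. e i \<omega> ^ m i)"
proof -
  have rv: "random_variable borel (e i)" for i using ind by (auto simp: indep_vars_def)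
  have "indep_vars (\<lambda>_. borel) (\<lambda>i \<omega>. e i \<omega> ^ m i) UNIV"
    by (rule indep_vars_compose2[OF ind]) simp
  then have iv: "indep_vars (\<lambda>_. borel) (\<lambda>i \<omega>. e i \<omega> ^ m i) I" by (rule indep_vars_subset) simp
  have int: "integrable M (\<lambda>\<omega>. e i \<omega> ^ m i)" if "i \<in> I" for i
    by (rule integrable_power_le[OF rv int4 m[OF that]])
  show "expectation (\<lambda>\<omega>. \<Prod>i\<in>I. e i \<omega> ^ m i) = (\<Prod>i\<in>I. expectation (\<lambda>\<omega>. e i \<omega> ^ m i))"
    by (rule indep_vars_lebesgue_integral[OF I iv int])
  show "integrable M (\<lambda>\<omega>. \<Prod>i\<in>I. e i \<omega> ^ m i)"
    by (rule indep_vars_integrable[OF I iv int])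
qed

lemma
  fixes e :: "'i \<Rightarrow> 'a \<Rightarrow> real"
  assumes ind: "indep_vars (\<lambda>_. borel) e UNIV"
    and int4: "\<And>t. integrable M (\<lambda>\<omega>. e t \<omega> ^ 4)"
  shows integrable_prod_four: "integrable M (\<lambda>\<omega>. e a \<omega> * e b \<omega> * e c \<omega> * e d \<omega>)"
    and expectation_prod_four: "expectation (e a) = 0 \<Longrightarrow> a \<notin> {b, c, d} \<Longrightarrow>
      expectation (\<lambda>\<omega>. e a \<omega> * e b \<omega> * e c \<omega> * e d \<omega>) = 0"
proof -
  \<comment> \<open>\<open>m\<close> counts multiplicities: a product over a, b, c, d with possible
    coincidences becomes a product of powers over distinct indices, to which independence
    applies.\<close>
  define m :: "'i \<Rightarrow> nat" where "m = (\<lambda>i. of_bool (i = a) + of_bool (i = b) + of_bool (i = c) + of_bool (i = d))"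
  have m4: "m i \<le> 4" for i by (simp add: m_def of_bool_def)
  have pw: "(\<Prod>i\<in>{a,b,c,d}. e i \<omega> ^ of_bool (i = k)) = e k \<omega>" if "k \<in> {a,b,c,d}" for k \<omega>
  proof -
    have "(\<Prod>i\<in>{a,b,c,d}. e i \<omega> ^ of_bool (i = k)) = (\<Prod>i\<in>{a,b,c,d}. if i = k then e i \<omega> else 1)"
      by (rule prod.cong) auto
    also have "\<dots> = e k \<omega>" using that by (simp only: prod.delta finite.intros if_True)
    finally show ?thesis .
  qed
  have eq: "e a \<omega> * e b \<omega> * e c \<omega> * e d \<omega> = (\<Prod>i\<in>{a,b,c,d}. e i \<omega> ^ m i)" for \<omega>
    unfolding m_def power_add prod.distrib by (simp only: pw insert_iff simp_thms)
  show "integrable M (\<lambda>\<omega>. e a \<omega> * e b \<omega> * e c \<omega> * e d \<omega>)"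
    unfolding eq by (rule expectation_prod_powers(2)[OF ind int4]) (rule finite.intros m4)+
  assume *: "expectation (e a) = 0" "a \<notin> {b, c, d}"
  have "(\<Prod>i\<in>{a,b,c,d}. expectation (\<lambda>\<omega>. e i \<omega> ^ m i)) = 0"
  proof (rule prod_zero)
    show "\<exists>i\<in>{a,b,c,d}. expectation (\<lambda>\<omega>. e i \<omega> ^ m i) = 0"
    proof
      have "m a = 1" using *(2) by (simp add: m_def)
      then show "expectation (\<lambda>\<omega>. e a \<omega> ^ m a) = 0" using *(1) by simp
    qed simp
  qed simp
  moreover have "expectation (\<lambda>\<omega>. \<Prod>i\<in>{a,b,c,d}. e i \<omega> ^ m i) = (\<Prod>i\<in>{a,b,c,d}. expectation (\<lambda>\<omega>. e i \<omega> ^ m i))"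
    by (rule expectation_prod_powers(1)[OF ind int4]) (rule finite.intros m4)+
  ultimately show "expectation (\<lambda>\<omega>. e a \<omega> * e b \<omega> * e c \<omega> * e d \<omega>) = 0"
    unfolding eq by (simp only:)
qed

end

lemma (in prob_space) expectation_orthogonal_sum_square_le:
  fixes V :: "'i \<Rightarrow> 'a \<Rightarrow> real"
  assumes "finite I"
    and int: "\<And>i j. i \<in> I \<Longrightarrow> j \<in> I \<Longrightarrow> integrable M (\<lambda>\<omega>. V i \<omega> * V j \<omega>)"
    and orth: "\<And>i j. i \<in> I \<Longrightarrow> j \<in> I \<Longrightarrow> i \<noteq> j \<Longrightarrow> expectation (\<lambda>\<omega>. V i \<omega> * V j \<omega>) = 0"
    and C: "\<And>i. i \<in> I \<Longrightarrow> expectation (\<lambda>\<omega>. V i \<omega> * V i \<omega>) \<le> C"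
  shows "integrable M (\<lambda>\<omega>. (\<Sum>i\<in>I. V i \<omega>)\<^sup>2)"
    and "expectation (\<lambda>\<omega>. (\<Sum>i\<in>I. V i \<omega>)\<^sup>2) \<le> real (card I) * C"
proof -
  have eq: "(\<Sum>i\<in>I. V i \<omega>)\<^sup>2 = (\<Sum>i\<in>I. \<Sum>j\<in>I. V i \<omega> * V j \<omega>)" for \<omega>
    by (simp add: power2_eq_square sum_product)
  show "integrable M (\<lambda>\<omega>. (\<Sum>i\<in>I. V i \<omega>)\<^sup>2)"
    unfolding eq by (intro Bochner_Integration.integrable_sum int)
  have "expectation (\<lambda>\<omega>. (\<Sum>i\<in>I. V i \<omega>)\<^sup>2) = (\<Sum>i\<in>I. \<Sum>j\<in>I. expectation (\<lambda>\<omega>. V i \<omega> * V j \<omega>))"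
    unfolding eq by (simp add: Bochner_Integration.integral_sum int)
  also have "\<dots> = (\<Sum>i\<in>I. \<Sum>j\<in>I. if i = j then expectation (\<lambda>\<omega>. V i \<omega> * V i \<omega>) else 0)"
    by (intro sum.cong) (auto simp: orth)
  also have "\<dots> = (\<Sum>i\<in>I. expectation (\<lambda>\<omega>. V i \<omega> * V i \<omega>))"
    using assms(1) by simp
  also have "\<dots> \<le> real (card I) * C" by (rule sum_bounded_above) (rule C)
  finally show "expectation (\<lambda>\<omega>. (\<Sum>i\<in>I. V i \<omega>)\<^sup>2) \<le> real (card I) * C" .
qed

section \<open>Sample autocovariances of a linear process\<close>

locale white_noise = prob_space +
  fixes e :: "int \<Rightarrow> 'a \<Rightarrow> real" and s2 \<mu>4 :: real
  assumes indep: "indep_vars (\<lambda>_. borel) e UNIV"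
    and int4: "\<And>t. integrable M (\<lambda>\<omega>. e t \<omega> ^ 4)"
    and mean: "\<And>t. expectation (e t) = 0"
    and var: "\<And>t. expectation (\<lambda>\<omega>. (e t \<omega>)\<^sup>2) = s2"
    and fourth: "\<And>t. expectation (\<lambda>\<omega>. e t \<omega> ^ 4) \<le> \<mu>4"
begin

lemma e_measurable [measurable]: "e t \<in> borel_measurable M"
  using indep by (auto simp: indep_vars_def)

lemma integrable_e_power: "k \<le> 4 \<Longrightarrow> integrable M (\<lambda>\<omega>. e t \<omega> ^ k)"
  by (rule integrable_power_le[OF e_measurable int4])

lemma integrable_e_mult: "integrable M (\<lambda>\<omega>. e a \<omega> * e b \<omega>)"
proof (rule Bochner_Integration.integrable_bound)
  show "integrable M (\<lambda>\<omega>. (e a \<omega>)\<^sup>2 + (e b \<omega>)\<^sup>2)"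
    using integrable_e_power[of 2] by simp
  have "\<bar>x * y\<bar> \<le> \<bar>x\<^sup>2 + y\<^sup>2\<bar>" for x y :: real
  proof -
    have "0 \<le> \<bar>x\<bar> * \<bar>y\<bar>" by simp
    moreover have "2 * (\<bar>x\<bar> * \<bar>y\<bar>) \<le> x\<^sup>2 + y\<^sup>2" using sum_squares_bound[of "\<bar>x\<bar>" "\<bar>y\<bar>"] by simp
    ultimately have "\<bar>x\<bar> * \<bar>y\<bar> \<le> x\<^sup>2 + y\<^sup>2" by linarith
    then show ?thesis by (simp add: abs_mult)
  qed
  then show "AE \<omega> in M. norm (e a \<omega> * e b \<omega>) \<le> norm ((e a \<omega>)\<^sup>2 + (e b \<omega>)\<^sup>2)" by simp
qed measurable

lemma expectation_e_mult: "expectation (\<lambda>\<omega>. e a \<omega> * e b \<omega>) = s2 * of_bool (a = b)"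
proof (cases "a = b")
  case True then show ?thesis using var[of b] by (simp add: power2_eq_square)
next
  case False
  have "expectation (\<lambda>\<omega>. \<Prod>i\<in>{a, b}. e i \<omega> ^ 1) = (\<Prod>i\<in>{a, b}. expectation (\<lambda>\<omega>. e i \<omega> ^ 1))"
    by (rule expectation_prod_powers[OF indep int4]) simp_all
  then show ?thesis using False by (simp add: mean)
qed

lemma expectation_e_squares: "a \<noteq> b \<Longrightarrow> expectation (\<lambda>\<omega>. (e a \<omega>)\<^sup>2 * (e b \<omega>)\<^sup>2) = s2\<^sup>2"
proof -
  assume "a \<noteq> b"
  have "expectation (\<lambda>\<omega>. \<Prod>i\<in>{a, b}. e i \<omega> ^ 2) = (\<Prod>i\<in>{a, b}. expectation (\<lambda>\<omega>. e i \<omega> ^ 2))"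
    by (rule expectation_prod_powers[OF indep int4]) simp_all
  then show ?thesis using \<open>a \<noteq> b\<close> by (simp add: var power2_eq_square[of s2])
qed

text \<open>The value is the square of the mean of a single lagged product, so after centring the
  products at different times are orthogonal, even when an index of time t coincides with one of
  time s.\<close>

lemma expectation_lagged_four:
  assumes "t \<noteq> s"
  shows "expectation (\<lambda>\<omega>. e (t - m) \<omega> * e (t - m') \<omega> * e (s - m) \<omega> * e (s - m') \<omega>) = (s2 * of_bool (m = m'))\<^sup>2"
proof (cases "m = m'")
  case True
  then show ?thesis
    using expectation_e_squares[of "t - m" "s - m"] assms by (simp add: power2_eq_square mult_ac)
next
  case False
  text \<open>The largest of the four indices occurs only once.\<close>
  have four: "expectation (\<lambda>\<omega>. e a \<omega> * e b \<omega> * e c \<omega> * e d \<omega>) = 0" if "a \<noteq> b" "a \<noteq> c" "a \<noteq> d" for a b c d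
    by (rule expectation_prod_four[OF indep int4 mean]) (use that in auto)
  consider "t < s" "m < m'" | "t < s" "m' < m" | "s < t" "m < m'" | "s < t" "m' < m"
    using assms False by linarith
  then have "expectation (\<lambda>\<omega>. e (t - m) \<omega> * e (t - m') \<omega> * e (s - m) \<omega> * e (s - m') \<omega>) = 0"
  proof cases
    case 1
    then have "expectation (\<lambda>\<omega>. e (s - m) \<omega> * e (t - m) \<omega> * e (t - m') \<omega> * e (s - m') \<omega>) = 0"
      by (intro four) auto
    then show ?thesis by (simp only: mult_ac)
  next
    case 2
    then have "expectation (\<lambda>\<omega>. e (s - m') \<omega> * e (t - m) \<omega> * e (t - m') \<omega> * e (s - m) \<omega>) = 0"
      by (intro four) auto
    then show ?thesis by (simp only: mult_ac)
  next
    case 3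
    then show ?thesis by (intro four) auto
  next
    case 4
    then have "expectation (\<lambda>\<omega>. e (t - m') \<omega> * e (t - m) \<omega> * e (s - m) \<omega> * e (s - m') \<omega>) = 0"
      by (intro four) auto
    then show ?thesis by (simp only: mult_ac)
  qed
  then show ?thesis using False by simp
qed

definition noise_cov :: "nat \<Rightarrow> nat \<Rightarrow> nat \<Rightarrow> 'a \<Rightarrow> real" where
  "noise_cov n m m' \<omega> = (1 / real n) *
     (\<Sum>t=1..n. e (int t - int m) \<omega> * e (int t - int m') \<omega> - s2 * of_bool (m = m'))"

lemma noise_cov_measurable [measurable]: "noise_cov n m m' \<in> borel_measurable M"
  unfolding noise_cov_def by measurable

text \<open>Orthogonality over t gives the rate 1 / n. The constant is free of the lags, which is
  what later allows summation against absolutely summable filter coefficients.\<close>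

lemma expectation_noise_cov_square_le:
  assumes n: "0 < n"
  shows "integrable M (\<lambda>\<omega>. (noise_cov n m m' \<omega>)\<^sup>2)"
    and "expectation (\<lambda>\<omega>. (noise_cov n m m' \<omega>)\<^sup>2) \<le> (\<mu>4 + s2\<^sup>2) / real n"
proof -
  define c where "c = s2 * of_bool (m = m')"
  define V where "V = (\<lambda>t \<omega>. e (int t - int m) \<omega> * e (int t - int m') \<omega> - c)"
  have VV: "V t \<omega> * V s \<omega> =
     e (int t - int m) \<omega> * e (int t - int m') \<omega> * e (int s - int m) \<omega> * e (int s - int m') \<omega>
      - c * (e (int t - int m) \<omega> * e (int t - int m') \<omega>) - c * (e (int s - int m) \<omega> * e (int s - int m') \<omega>) + c\<^sup>2"
    for t s \<omega> by (simp add: V_def algebra_simps power2_eq_square)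
  have int: "integrable M (\<lambda>\<omega>. V t \<omega> * V s \<omega>)" for t s
    unfolding VV by (intro Bochner_Integration.integrable_add Bochner_Integration.integrable_diff
        Bochner_Integration.integrable_mult_right integrable_prod_four[OF indep int4] integrable_e_mult) simp
  have EV: "expectation (\<lambda>\<omega>. V t \<omega> * V s \<omega>) = expectation (\<lambda>\<omega>. e (int t - int m) \<omega> * e (int t - int m') \<omega> * e (int s - int m) \<omega> * e (int s - int m') \<omega>) - c\<^sup>2" for t s
    unfolding VV
    by (simp add: integrable_prod_four[OF indep int4] integrable_e_mult expectation_e_mult prob_space)
      (simp add: c_def power2_eq_square of_bool_def)
  have orth: "expectation (\<lambda>\<omega>. V t \<omega> * V s \<omega>) = 0" if "t \<noteq> s" for t s
    unfolding EV using expectation_lagged_four[of "int t" "int s" "int m" "int m'"] that by (simp add: c_def)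
  have C: "expectation (\<lambda>\<omega>. V t \<omega> * V t \<omega>) \<le> \<mu>4 + s2\<^sup>2" for t
  proof -
    let ?a = "int t - int m" and ?b = "int t - int m'"
    have "expectation (\<lambda>\<omega>. e ?a \<omega> * e ?b \<omega> * e ?a \<omega> * e ?b \<omega>) \<le> expectation (\<lambda>\<omega>. (e ?a \<omega> ^ 4 + e ?b \<omega> ^ 4) / 2)"
    proof (rule integral_mono)
      show "integrable M (\<lambda>\<omega>. (e ?a \<omega> ^ 4 + e ?b \<omega> ^ 4) / 2)" using int4 by simp
      have "x * y * x * y \<le> (x ^ 4 + y ^ 4) / 2" for x y :: real
        using sum_squares_bound[of "x\<^sup>2" "y\<^sup>2"] by (simp add: power2_eq_square power4_eq_xxxx mult_ac)
      then show "e ?a \<omega> * e ?b \<omega> * e ?a \<omega> * e ?b \<omega> \<le> (e ?a \<omega> ^ 4 + e ?b \<omega> ^ 4) / 2" for \<omega> .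
    qed (rule integrable_prod_four[OF indep int4])
    also have "\<dots> \<le> \<mu>4" using int4 fourth[of ?a] fourth[of ?b] by simp
    finally show ?thesis unfolding EV using zero_le_power2[of c] zero_le_power2[of s2] by linarith
  qed
  have eq: "(noise_cov n m m' \<omega>)\<^sup>2 = (1 / real n)\<^sup>2 * (\<Sum>t\<in>{1..n}. V t \<omega>)\<^sup>2" for \<omega>
    by (simp add: noise_cov_def V_def c_def power_mult_distrib[symmetric])
  have o: "integrable M (\<lambda>\<omega>. (\<Sum>t\<in>{1..n}. V t \<omega>)\<^sup>2)"
    "expectation (\<lambda>\<omega>. (\<Sum>t\<in>{1..n}. V t \<omega>)\<^sup>2) \<le> real (card {1..n}) * (\<mu>4 + s2\<^sup>2)"
    by (rule expectation_orthogonal_sum_square_le[OF _ int orth C]; simp)+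
  show "integrable M (\<lambda>\<omega>. (noise_cov n m m' \<omega>)\<^sup>2)" unfolding eq using o(1) by simp
  have "expectation (\<lambda>\<omega>. (noise_cov n m m' \<omega>)\<^sup>2) = (1 / real n)\<^sup>2 * expectation (\<lambda>\<omega>. (\<Sum>t\<in>{1..n}. V t \<omega>)\<^sup>2)"
    unfolding eq by simp
  also have "\<dots> \<le> (1 / real n)\<^sup>2 * (real (card {1..n}) * (\<mu>4 + s2\<^sup>2))"
    by (rule mult_left_mono[OF o(2)]) simp
  also have "\<dots> = (\<mu>4 + s2\<^sup>2) / real n" using n by (simp add: power2_eq_square)
  finally show "expectation (\<lambda>\<omega>. (noise_cov n m m' \<omega>)\<^sup>2) \<le> (\<mu>4 + s2\<^sup>2) / real n" .
qed

end

text \<open>The coefficient of e (t - m) in Y (t - j). It lets differently lagged copies of the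
  process share one noise index m.\<close>

definition lag :: "real fps \<Rightarrow> nat \<Rightarrow> nat \<Rightarrow> real" where
  "lag F m j = (if j \<le> m then fps_nth F (m - j) else 0)"

lemma sum_abs_lag_le: "l1_le F c \<Longrightarrow> (\<Sum>m<N. \<bar>lag F m j\<bar>) \<le> c"
proof -
  assume c: "l1_le F c"
  have "(\<Sum>m<N. \<bar>lag F m j\<bar>) \<le> (\<Sum>m<j + N. \<bar>lag F m j\<bar>)"
    by (rule sum_mono2) auto
  also have "\<dots> = (\<Sum>m<j. \<bar>lag F m j\<bar>) + (\<Sum>m<N. \<bar>lag F (m + j) j\<bar>)" by (rule sum_up_add)
  also have "\<dots> = (\<Sum>m<N. norm (fps_nth F m))" by (simp add: lag_def)
  also have "\<dots> \<le> c" by (rule l1_leD[OF c])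
  finally show ?thesis .
qed

lemma sums_lag:
  assumes "(\<lambda>m. fps_nth F m * g (m + j)) sums s"
  shows "(\<lambda>m. lag F m j * g m) sums s"
proof -
  have "(\<lambda>m. lag F (m + j) j * g (m + j)) sums s" using assms by (simp add: lag_def)
  then have "(\<lambda>m. lag F m j * g m) sums (s + (\<Sum>m<j. lag F m j * g m))"
    using sums_iff_shift'[of "\<lambda>m. lag F m j * g m" j "s + (\<Sum>m<j. lag F m j * g m)"] by simp
  then show ?thesis by (simp add: lag_def)
qed

lemma summable_lag_mult: 
  assumes "l1_le F c" shows "summable (\<lambda>m. lag F m j * lag F m k)"
proof -
  have "summable (\<lambda>m. \<bar>lag F m j\<bar>)"
    by (rule summableI_nonneg_bounded[where x=c]) (auto intro: sum_abs_lag_le[OF assms])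
  then have "summable (\<lambda>m. \<bar>lag F m j\<bar> * c)" by (rule summable_mult2)
  moreover have "norm (lag F m j * lag F m k) \<le> \<bar>lag F m j\<bar> * c" for m
    using l1_le_nth[OF assms, of "m - k"] l1_le_nonneg[OF assms]
    by (auto simp: lag_def[of F m k] abs_mult intro!: mult_left_mono)
  ultimately show ?thesis by (rule summable_comparison_test'[where N=0])
qed

section \<open>Mean-square rate for sample autocovariances, uniform in the lags\<close>

context white_noise
begin

text \<open>The covariance of Y (t - j) and Y (t - k) for the linear process with filter F, given by
  its series so that the truncated forms below converge to it directly.\<close>

definition acov :: "real fps \<Rightarrow> nat \<Rightarrow> nat \<Rightarrow> real" where
  "acov F j k = s2 * (\<Sum>m. lag F m j * lag F m k)"

text \<open>Truncating both lagged series at the same lag makes the truncated quadratic forms have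
  the partial sums of the autocovariance series as expectations.\<close>

lemma expectation_sample_acov_le:
  fixes Y :: "int \<Rightarrow> 'a \<Rightarrow> real" and j k :: nat
  assumes F: "l1_le F c" and n: "0 < n"
    and [measurable]: "\<And>t. Y t \<in> borel_measurable M"
    and Y: "\<And>t. AE \<omega> in M. (\<lambda>m. fps_nth F m * e (t - int m) \<omega>) sums Y t \<omega>"
  defines "D \<equiv> (\<lambda>\<omega>. (1 / real n) * (\<Sum>t=1..n. Y (int t - int j) \<omega> * Y (int t - int k) \<omega>) - acov F j k)"
  shows "integrable M (\<lambda>\<omega>. (D \<omega>)\<^sup>2)"
    and "expectation (\<lambda>\<omega>. (D \<omega>)\<^sup>2) \<le> c ^ 4 * ((\<mu>4 + s2\<^sup>2) / real n)"
proof -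
  \<comment> \<open>The truncation of \<open>D\<close>, bilinear in the noise. Its weights factor
    over the two lags, so their l1 norm is at most c * c; squaring this produces the
    \<open>c ^ 4\<close> of the bound.\<close>
  define S where "S = (\<lambda>N \<omega>. \<Sum>i\<in>{..<N}\<times>{..<N}. (lag F (fst i) j * lag F (snd i) k) * noise_cov n (fst i) (snd i) \<omega>)"
  define Z where "Z = (\<lambda>N (t::nat) j \<omega>. \<Sum>m<N. lag F m j * e (int t - int m) \<omega>)"
  have Seq: "S N \<omega> = (1 / real n) * (\<Sum>t=1..n. Z N t j \<omega> * Z N t k \<omega>) - s2 * (\<Sum>m<N. lag F m j * lag F m k)" for N \<omega>
  proof -
    have "S N \<omega> = (\<Sum>m<N. \<Sum>m'<N. lag F m j * lag F m' k * noise_cov n m m' \<omega>)"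
      by (simp add: S_def sum.cartesian_product split_beta)
    also have "\<dots> = (\<Sum>m<N. \<Sum>m'<N. (1 / real n) * (\<Sum>t=1..n. (lag F m j * e (int t - int m) \<omega>) * (lag F m' k * e (int t - int m') \<omega>)) - s2 * (if m = m' then lag F m j * lag F m' k else 0))"
      using n by (intro sum.cong) (auto simp: noise_cov_def sum_subtractf sum_distrib_left algebra_simps)
    also have "\<dots> = (1 / real n) * (\<Sum>m<N. \<Sum>m'<N. \<Sum>t=1..n. (lag F m j * e (int t - int m) \<omega>) * (lag F m' k * e (int t - int m') \<omega>)) - s2 * (\<Sum>m<N. \<Sum>m'<N. if m = m' then lag F m j * lag F m' k else 0)"
      by (simp only: sum_subtractf sum_distrib_left)
    also have "(\<Sum>m<N. \<Sum>m'<N. if m = m' then lag F m j * lag F m' k else 0) = (\<Sum>m<N. lag F m j * lag F m k)"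
      by (intro sum.cong) auto
    also have "(\<Sum>m<N. \<Sum>m'<N. \<Sum>t=1..n. (lag F m j * e (int t - int m) \<omega>) * (lag F m' k * e (int t - int m') \<omega>)) = (\<Sum>t=1..n. Z N t j \<omega> * Z N t k \<omega>)"
      unfolding Z_def sum_product
      by (subst (2) sum.swap, subst sum.swap) (rule refl)
    finally show ?thesis .
  qed
  have AEY: "AE \<omega> in M. \<forall>t. (\<lambda>m. fps_nth F m * e (t - int m) \<omega>) sums Y t \<omega>"
    using Y by (subst AE_all_countable) blast
  have lim: "AE \<omega> in M. (\<lambda>N. S N \<omega>) \<longlonglongrightarrow> D \<omega>"
    using AEY
  proof eventually_elim
    case (elim \<omega>)
    have Zlim: "(\<lambda>N. Z N t i \<omega>) \<longlonglongrightarrow> Y (int t - int i) \<omega>" for t i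
    proof -
      have "(\<lambda>m. fps_nth F m * e (int t - int (m + i)) \<omega>) sums Y (int t - int i) \<omega>"
        using elim[rule_format, of "int t - int i"] by (simp add: algebra_simps)
      then show ?thesis unfolding Z_def sums_def[symmetric] by (rule sums_lag)
    qed
    have G: "(\<lambda>N. \<Sum>m<N. lag F m j * lag F m k) \<longlonglongrightarrow> (\<Sum>m. lag F m j * lag F m k)"
      by (rule summable_LIMSEQ[OF summable_lag_mult[OF F]])
    show "(\<lambda>N. S N \<omega>) \<longlonglongrightarrow> D \<omega>"
      unfolding Seq D_def acov_def by (intro tendsto_intros Zlim G)
  qed
  have w: "(\<Sum>i\<in>{..<N}\<times>{..<N}. \<bar>lag F (fst i) j * lag F (snd i) k\<bar>)\<^sup>2 \<le> c ^ 4" for N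
  proof -
    have "(\<Sum>i\<in>{..<N}\<times>{..<N}. \<bar>lag F (fst i) j * lag F (snd i) k\<bar>) = (\<Sum>m<N. \<bar>lag F m j\<bar>) * (\<Sum>m<N. \<bar>lag F m k\<bar>)"
      by (simp add: sum_product sum.cartesian_product split_beta abs_mult)
    also have "\<dots> \<le> c * c"
      by (intro mult_mono sum_abs_lag_le[OF F] sum_nonneg l1_le_nonneg[OF F]) auto
    finally have "(\<Sum>i\<in>{..<N}\<times>{..<N}. \<bar>lag F (fst i) j * lag F (snd i) k\<bar>)\<^sup>2 \<le> (c * c)\<^sup>2"
      by (rule power_mono) (auto intro: sum_nonneg)
    then show ?thesis by (simp add: power2_eq_square power4_eq_xxxx mult_ac)
  qed
  have M0: "0 \<le> (\<mu>4 + s2\<^sup>2) / real n"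
    using order_trans[OF _ expectation_noise_cov_square_le(2)[OF n, of 0 0]] by simp
  have Sint: "integrable M (\<lambda>\<omega>. (S N \<omega>)\<^sup>2)" for N
    unfolding S_def
    by (rule expectation_weighted_sum_square_le(1)[OF _ _ expectation_noise_cov_square_le(1)[OF n] expectation_noise_cov_square_le(2)[OF n]]) auto
  have SC: "expectation (\<lambda>\<omega>. (S N \<omega>)\<^sup>2) \<le> c ^ 4 * ((\<mu>4 + s2\<^sup>2) / real n)" for N
  proof -
    have "expectation (\<lambda>\<omega>. (S N \<omega>)\<^sup>2) \<le> (\<Sum>i\<in>{..<N}\<times>{..<N}. \<bar>lag F (fst i) j * lag F (snd i) k\<bar>)\<^sup>2 * ((\<mu>4 + s2\<^sup>2) / real n)"
      unfolding S_def
      by (rule expectation_weighted_sum_square_le(2)[OF _ _ expectation_noise_cov_square_le(1)[OF n] expectation_noise_cov_square_le(2)[OF n]]) auto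
    also have "\<dots> \<le> c ^ 4 * ((\<mu>4 + s2\<^sup>2) / real n)" by (rule mult_right_mono[OF w M0])
    finally show ?thesis .
  qed
  have [measurable]: "\<And>N. S N \<in> borel_measurable M" unfolding S_def by measurable
  have [measurable]: "D \<in> borel_measurable M" unfolding D_def by measurable
  show "integrable M (\<lambda>\<omega>. (D \<omega>)\<^sup>2)"
    by (rule expectation_square_le_limit(1)[OF _ _ Sint SC lim]) measurable
  show "expectation (\<lambda>\<omega>. (D \<omega>)\<^sup>2) \<le> c ^ 4 * ((\<mu>4 + s2\<^sup>2) / real n)"
    by (rule expectation_square_le_limit(2)[OF _ _ Sint SC lim]) measurable
qed

end

section \<open>Convolutions and inverse filters\<close>

text \<open>Young's inequality for l1 * l2: Cauchy-Schwarz with weights |F_i| yields one factor c,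
  the triangle-in-square bound the other.\<close>

lemma summable_convolution_square:
  fixes a :: "nat \<Rightarrow> real" and F :: "real fps"
  assumes F: "l1_le F c" and a: "summable (\<lambda>k. (a k)\<^sup>2)"
  shows "summable (\<lambda>m. (\<Sum>i\<le>m. fps_nth F i * a (m - i))\<^sup>2)"
    and "(\<Sum>m. (\<Sum>i\<le>m. fps_nth F i * a (m - i))\<^sup>2) \<le> c\<^sup>2 * (\<Sum>k. (a k)\<^sup>2)"
proof -
  have c0: "0 \<le> c" by (rule l1_le_nonneg[OF F])
  have le: "(\<Sum>m<N. (\<Sum>i\<le>m. fps_nth F i * a (m - i))\<^sup>2) \<le> c\<^sup>2 * (\<Sum>k. (a k)\<^sup>2)" for N
  proof -
    have "(\<Sum>m<N. (\<Sum>i\<le>m. fps_nth F i * a (m - i))\<^sup>2) \<le> (\<Sum>m<N. c * (\<Sum>i\<le>m. \<bar>fps_nth F i\<bar> * (a (m - i))\<^sup>2))"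
    proof (intro sum_mono)
      fix m
      have "(\<Sum>i\<le>m. fps_nth F i * a (m - i))\<^sup>2 \<le> (\<Sum>i\<le>m. \<bar>fps_nth F i\<bar>) * (\<Sum>i\<le>m. \<bar>fps_nth F i\<bar> * (a (m - i))\<^sup>2)"
        by (rule weighted_sum_square_le) simp
      also have "(\<Sum>i\<le>m. \<bar>fps_nth F i\<bar>) \<le> c"
        using l1_leD[OF F, of "Suc m"] by (simp add: lessThan_Suc_atMost)
      finally show "(\<Sum>i\<le>m. fps_nth F i * a (m - i))\<^sup>2 \<le> c * (\<Sum>i\<le>m. \<bar>fps_nth F i\<bar> * (a (m - i))\<^sup>2)"
        by (simp add: mult_right_mono sum_nonneg)
    qed
    also have "\<dots> = c * (\<Sum>m<N. \<Sum>i\<le>m. \<bar>fps_nth F i\<bar> * (a (m - i))\<^sup>2)" by (simp add: sum_distrib_left)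
    also have "\<dots> \<le> c * ((\<Sum>i<N. \<bar>fps_nth F i\<bar>) * (\<Sum>i<N. (a i)\<^sup>2))"
      by (intro mult_left_mono sum_convolution_le c0) auto
    also have "\<dots> \<le> c * (c * (\<Sum>k. (a k)\<^sup>2))"
      using l1_leD[OF F, of N] by (intro mult_left_mono mult_mono sum_le_suminf a c0) (auto intro: sum_nonneg)
    finally show ?thesis by (simp add: power2_eq_square)
  qed
  show s: "summable (\<lambda>m. (\<Sum>i\<le>m. fps_nth F i * a (m - i))\<^sup>2)"
    by (rule summableI_nonneg_bounded[OF _ le]) simp
  show "(\<Sum>m. (\<Sum>i\<le>m. fps_nth F i * a (m - i))\<^sup>2) \<le> c\<^sup>2 * (\<Sum>k. (a k)\<^sup>2)"
    by (rule suminf_le_const[OF s le])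
qed

text \<open>Going through multiplication of \<open>fps\<close> gives associativity for free, and
  with it the inversion of a filter in \<open>conv_conv\<close>.\<close>

definition conv :: "real fps \<Rightarrow> (nat \<Rightarrow> real) \<Rightarrow> nat \<Rightarrow> real" where
  "conv F a m = fps_nth (F * Abs_fps a) m"

lemma conv_eq: "conv F a m = (\<Sum>i\<le>m. fps_nth F i * a (m - i))"
  by (simp add: conv_def fps_mult_nth atLeast0AtMost)

lemma conv_eq_lag: "conv F a m = (\<Sum>j\<le>m. a j * lag F m j)"
proof -
  have "conv F a m = fps_nth (Abs_fps a * F) m" by (simp add: conv_def mult.commute)
  also have "\<dots> = (\<Sum>j\<le>m. a j * lag F m j)"
    unfolding fps_mult_nth atLeast0AtMost by (intro sum.cong) (auto simp: lag_def)
  finally show ?thesis .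
qed

lemma conv_conv: "conv G (conv F a) = conv (G * F) a"
proof -
  have "Abs_fps (conv F a) = F * Abs_fps a" by (rule fps_ext) (simp add: conv_def)
  then show ?thesis by (intro ext) (simp add: conv_def mult.assoc)
qed

lemma conv_one: "conv 1 a = a"
  by (intro ext) (simp add: conv_def)

lemma conv_square:
  assumes F: "l1_le F c" and a: "summable (\<lambda>k. (a k)\<^sup>2)"
  shows summable_conv_square: "summable (\<lambda>m. (conv F a m)\<^sup>2)"
    and suminf_conv_square_le: "(\<Sum>m. (conv F a m)\<^sup>2) \<le> c\<^sup>2 * (\<Sum>k. (a k)\<^sup>2)"
  using summable_convolution_square[OF assms] by (simp_all add: conv_eq)

section \<open>Inverting the autoregressive filter\<close>

text \<open>The double series over \<open>(j, k)\<close> is absolutely convergent, so it may be summed along \<open>j + k = m\<close>,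
  where the coefficients are those of \<open>F * G = 1\<close>.\<close>

lemma inverse_filter_sums:
  fixes F G :: "real fps" and y :: "nat \<Rightarrow> real"
  assumes FG: "F * G = 1"
    and abs: "summable (\<lambda>j. \<bar>fps_nth F j\<bar> * (\<Sum>k. \<bar>fps_nth G k\<bar> * \<bar>y (j + k)\<bar>))"
      "\<And>j. summable (\<lambda>k. \<bar>fps_nth G k\<bar> * \<bar>y (j + k)\<bar>)"
    and e: "\<And>j. (\<lambda>k. fps_nth G k * y (j + k)) sums e j"
  shows "(\<lambda>j. fps_nth F j * e j) sums y 0"
proof -
  define f where "f = (\<lambda>(j, k). fps_nth F j * (fps_nth G k * y (j + k)))"
  have nf: "norm (f (j, k)) = \<bar>fps_nth F j\<bar> * (\<bar>fps_nth G k\<bar> * \<bar>y (j + k)\<bar>)" for j k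
    by (simp add: f_def abs_mult)
  have inner: "((\<lambda>k. norm (f (j, k))) has_sum \<bar>fps_nth F j\<bar> * (\<Sum>k. \<bar>fps_nth G k\<bar> * \<bar>y (j + k)\<bar>)) UNIV" for j
    unfolding nf using abs(2)[of j]
    by (intro has_sum_cmult_right sums_nonneg_imp_has_sum summable_sums) auto
  have "(\<lambda>x. norm (f x)) summable_on (UNIV \<times> UNIV)"
    by (rule summable_on_SigmaI[OF inner summable_nonneg_imp_summable_on[OF abs(1)]])
      (simp_all add: suminf_nonneg abs(2))
  then have "f summable_on (UNIV \<times> UNIV)" by (rule abs_summable_summable)
  then obtain S where S: "(f has_sum S) (UNIV \<times> UNIV)" by (auto simp: summable_on_def)
  have "((\<lambda>k. f (j, k)) has_sum fps_nth F j * e j) UNIV" for j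
  proof -
    have "((\<lambda>k. fps_nth G k * y (j + k)) has_sum e j) UNIV"
      by (rule norm_summable_imp_has_sum[OF _ e]) (simp add: abs_mult abs(2))
    then show ?thesis by (simp add: f_def has_sum_cmult_right)
  qed
  with S have "((\<lambda>j. fps_nth F j * e j) has_sum S) UNIV" by (rule has_sum_SigmaD)
  then have "(\<lambda>j. fps_nth F j * e j) sums S" by (rule has_sum_imp_sums)
  moreover have "S = y 0"
  proof -
    let ?h = "\<lambda>(m, j). (j, m - j)"
    have "bij_betw ?h (SIGMA m:UNIV. {..m}) (UNIV \<times> UNIV :: (nat \<times> nat) set)"
      by (rule bij_betwI[where g = "\<lambda>(j, k). (j + k, j)"]) auto
    from has_sum_reindex_bij_betw[OF this, of f S] S
    have S': "((\<lambda>x. f (?h x)) has_sum S) (SIGMA m:UNIV. {..m})" by simp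
    have "((\<lambda>j. f (?h (m, j))) has_sum (if m = 0 then y 0 else 0)) {..m}" for m
    proof -
      have "(\<Sum>j\<le>m. f (?h (m, j))) = (\<Sum>j\<le>m. fps_nth F j * fps_nth G (m - j)) * y m"
        unfolding sum_distrib_right by (intro sum.cong) (auto simp: f_def)
      also have "(\<Sum>j\<le>m. fps_nth F j * fps_nth G (m - j)) = fps_nth (F * G) m"
        by (simp add: fps_mult_nth atLeast0AtMost)
      also have "\<dots> * y m = (if m = 0 then y 0 else 0)" by (simp add: FG)
      finally show ?thesis by (intro has_sum_finiteI) auto
    qed
    from has_sum_SigmaD[OF S' this]
    have "(\<lambda>m. if m = 0 then y 0 else 0) sums S" by (rule has_sum_imp_sums)
    moreover have "(\<lambda>m. if m = 0 then y 0 else 0) sums y 0"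
      by (rule sums_single[where f = "\<lambda>_. y 0"])
    ultimately show ?thesis by (rule sums_unique2)
  qed
  ultimately show ?thesis by simp
qed

text \<open>This turns the autoregression into a linear process. By Tonelli the absolute double
  series has expectation at most c * d * (1 + C), as E|Y| \<le> 1 + E Y^2; so it converges on almost
  every path, where the deterministic inversion applies.\<close>

lemma (in prob_space) AE_inverse_filter_sums:
  fixes F G :: "real fps" and Y e :: "int \<Rightarrow> 'a \<Rightarrow> real"
  assumes FG: "F * G = 1" and F: "l1_le F c" and G: "l1_le G d"
    and [measurable]: "\<And>t. Y t \<in> borel_measurable M"
    and Y2: "\<And>t. integrable M (\<lambda>\<omega>. (Y t \<omega>)\<^sup>2)" "\<And>t. expectation (\<lambda>\<omega>. (Y t \<omega>)\<^sup>2) \<le> C"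
    and e: "\<And>t. AE \<omega> in M. (\<lambda>k. fps_nth G k * Y (t - int k) \<omega>) sums e t \<omega>"
  shows "AE \<omega> in M. (\<lambda>j. fps_nth F j * e (t - int j) \<omega>) sums Y t \<omega>"
proof -
  have Y1: "(\<integral>\<^sup>+\<omega>. ennreal \<bar>Y s \<omega>\<bar> \<partial>M) \<le> ennreal (1 + C)" for s
  proof -
    have "(\<integral>\<^sup>+\<omega>. ennreal \<bar>Y s \<omega>\<bar> \<partial>M) \<le> (\<integral>\<^sup>+\<omega>. ennreal (1 + (Y s \<omega>)\<^sup>2) \<partial>M)"
    proof (intro nn_integral_mono ennreal_leI)
      fix \<omega> show "\<bar>Y s \<omega>\<bar> \<le> 1 + (Y s \<omega>)\<^sup>2"
        using sum_squares_bound[of 1 "\<bar>Y s \<omega>\<bar>"] by simp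
    qed
    also have "\<dots> = ennreal (1 + expectation (\<lambda>\<omega>. (Y s \<omega>)\<^sup>2))"
      using Y2(1)[of s] by (subst nn_integral_eq_integral) (auto simp: prob_space)
    also have "\<dots> \<le> ennreal (1 + C)" using Y2(2)[of s] by (intro ennreal_leI) simp
    finally show ?thesis .
  qed
  have C0: "0 \<le> C" using order_trans[OF _ Y2(2)] by simp
  define q where "q = (\<lambda>j \<omega>. \<Sum>k. ennreal (\<bar>fps_nth G k\<bar> * \<bar>Y (t - int (j + k)) \<omega>\<bar>))"
  have q_meas [measurable]: "q j \<in> borel_measurable M" for j unfolding q_def by measurable
  have l1: "(\<Sum>k. ennreal \<bar>fps_nth F k\<bar>) \<le> ennreal c" if "l1_le F c" for F :: "real fps" and c
  proof -
    have "(\<Sum>k<N. ennreal \<bar>fps_nth F k\<bar>) \<le> ennreal c" for N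
      using l1_leD[OF that, of N] by (simp add: ennreal_leI)
    then show ?thesis by (intro suminf_le_const) auto
  qed
  have q: "(\<integral>\<^sup>+\<omega>. q j \<omega> \<partial>M) \<le> ennreal (d * (1 + C))" for j
  proof -
    have "(\<integral>\<^sup>+\<omega>. q j \<omega> \<partial>M) = (\<Sum>k. ennreal \<bar>fps_nth G k\<bar> * (\<integral>\<^sup>+\<omega>. ennreal \<bar>Y (t - int (j + k)) \<omega>\<bar> \<partial>M))"
      unfolding q_def by (subst nn_integral_suminf) (auto simp: ennreal_mult nn_integral_cmult)
    also have "\<dots> \<le> (\<Sum>k. ennreal \<bar>fps_nth G k\<bar> * ennreal (1 + C))"
      by (intro suminf_le mult_left_mono Y1) auto
    also have "\<dots> = (\<Sum>k. ennreal \<bar>fps_nth G k\<bar>) * ennreal (1 + C)" by simp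
    also have "\<dots> \<le> ennreal d * ennreal (1 + C)" by (intro mult_right_mono l1[OF G]) simp
    also have "\<dots> = ennreal (d * (1 + C))" using l1_le_nonneg[OF G] C0 by (simp add: ennreal_mult)
    finally show ?thesis .
  qed
  have "(\<integral>\<^sup>+\<omega>. (\<Sum>j. ennreal \<bar>fps_nth F j\<bar> * q j \<omega>) \<partial>M) = (\<Sum>j. ennreal \<bar>fps_nth F j\<bar> * (\<integral>\<^sup>+\<omega>. q j \<omega> \<partial>M))"
    by (subst nn_integral_suminf) (auto simp: nn_integral_cmult)
  also have "\<dots> \<le> (\<Sum>j. ennreal \<bar>fps_nth F j\<bar> * ennreal (d * (1 + C)))"
    by (intro suminf_le mult_left_mono q) auto
  also have "\<dots> = (\<Sum>j. ennreal \<bar>fps_nth F j\<bar>) * ennreal (d * (1 + C))" by simp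
  also have "\<dots> \<le> ennreal c * ennreal (d * (1 + C))" by (intro mult_right_mono l1[OF F]) simp
  also have "\<dots> < \<infinity>" by (simp add: ennreal_mult_less_top)
  finally have A: "AE \<omega> in M. (\<Sum>j. ennreal \<bar>fps_nth F j\<bar> * q j \<omega>) \<noteq> \<infinity>"
    by (intro nn_integral_PInf_AE) auto
  have B: "AE \<omega> in M. \<forall>j. q j \<omega> \<noteq> \<infinity>"
    unfolding AE_all_countable
  proof
    fix j
    have "(\<integral>\<^sup>+\<omega>. q j \<omega> \<partial>M) \<noteq> \<infinity>"
      using le_less_trans[OF q[of j] ennreal_less_top] by simp
    then show "AE \<omega> in M. q j \<omega> \<noteq> \<infinity>" by (intro nn_integral_PInf_AE) auto
  qed
  have E: "AE \<omega> in M. \<forall>t. (\<lambda>k. fps_nth G k * Y (t - int k) \<omega>) sums e t \<omega>"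
    unfolding AE_all_countable using e by blast
  show ?thesis using A B E
  proof eventually_elim
    case (elim \<omega>)
    have s2: "summable (\<lambda>k. \<bar>fps_nth G k\<bar> * \<bar>Y (t - int (j + k)) \<omega>\<bar>)" for j
      using elim(2)[rule_format, of j] unfolding q_def by (intro summable_suminf_not_top) auto
    have qe: "q j \<omega> = ennreal (\<Sum>k. \<bar>fps_nth G k\<bar> * \<bar>Y (t - int (j + k)) \<omega>\<bar>)" for j
      unfolding q_def by (rule suminf_ennreal2[OF _ s2]) simp
    have n0: "0 \<le> (\<Sum>k. \<bar>fps_nth G k\<bar> * \<bar>Y (t - int (j + k)) \<omega>\<bar>)" for j
      by (rule suminf_nonneg[OF s2]) simp
    have s1: "summable (\<lambda>j. \<bar>fps_nth F j\<bar> * (\<Sum>k. \<bar>fps_nth G k\<bar> * \<bar>Y (t - int (j + k)) \<omega>\<bar>))"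
    proof (rule summable_suminf_not_top)
      show "(\<Sum>j. ennreal (\<bar>fps_nth F j\<bar> * (\<Sum>k. \<bar>fps_nth G k\<bar> * \<bar>Y (t - int (j + k)) \<omega>\<bar>))) \<noteq> top"
        using elim(1) unfolding qe infinity_ennreal_def by (simp only: ennreal_mult[OF abs_ge_zero n0] not_False_eq_True)
    qed (intro mult_nonneg_nonneg abs_ge_zero n0)
    have "(\<lambda>j. fps_nth F j * e (t - int j) \<omega>) sums Y (t - int 0) \<omega>"
    proof (rule inverse_filter_sums[OF FG s1 s2])
      fix j show "(\<lambda>k. fps_nth G k * Y (t - int (j + k)) \<omega>) sums e (t - int j) \<omega>"
        using elim(3)[rule_format, of "t - int j"] by (simp add: algebra_simps)
    qed
    then show ?case by simp
  qed
qed

section \<open>Existence and measurability of the penalised minimiser\<close>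

lemma EK_iff: "b \<in> EK lam K \<longleftrightarrow> (\<forall>k. k = 0 \<or> K < k \<longrightarrow> b k = 0)"
proof -
  have "inE lam b" if "\<forall>k. k = 0 \<or> K < k \<longrightarrow> b k = 0"
    unfolding inE_def using that by (intro summable_finite[of "{..<K}"]) auto
  then show ?thesis by (auto simp: EK_def)
qed

lemma Enorm_square: "inE lam b \<Longrightarrow> (Enorm lam b)\<^sup>2 = (\<Sum>k. (lam (Suc k) * b (Suc k))\<^sup>2)"
  unfolding Enorm_def inE_def by (simp add: suminf_nonneg)

lemma Enorm_nonneg: "inE lam b \<Longrightarrow> 0 \<le> Enorm lam b"
  unfolding Enorm_def inE_def by (simp add: suminf_nonneg)

lemma sum_atLeast1_Suc: "(\<Sum>k=1..K. f k) = (\<Sum>k<K. f (Suc k))" for f :: "nat \<Rightarrow> 'a::comm_monoid_add"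
  using sum.shift_bounds_cl_Suc_ivl[of f 0 "K - 1"]
  by (cases K) (simp_all add: lessThan_Suc_atMost atLeast0AtMost del: sum.atMost_Suc sum.cl_ivl_Suc)

lemma Enorm_square_EK: "b \<in> EK lam K \<Longrightarrow> (Enorm lam b)\<^sup>2 = (\<Sum>k=1..K. (lam k * b k)\<^sup>2)"
proof -
  assume b: "b \<in> EK lam K"
  then have "(Enorm lam b)\<^sup>2 = (\<Sum>k. (lam (Suc k) * b (Suc k))\<^sup>2)" by (intro Enorm_square) (simp add: EK_def)
  also have "\<dots> = (\<Sum>k<K. (lam (Suc k) * b (Suc k))\<^sup>2)"
    by (rule suminf_finite) (use b in \<open>auto simp: EK_iff\<close>)
  finally show ?thesis by (simp only: sum_atLeast1_Suc)
qed

lemma pen_obj_EK: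
  assumes "b \<in> EK lam K"
  shows "pen_obj lam Y K n tau \<omega> b = (1 / real n) * (\<Sum>t=1..n. (Y (int t) \<omega> - Xt Y K b (int t) \<omega>)\<^sup>2)
    + tau * (\<Sum>k=1..K. (lam k * b k)\<^sup>2)"
  unfolding pen_obj_def Enorm_square_EK[OF assms] ..

lemma pen_obj_nonneg: "0 \<le> tau \<Longrightarrow> 0 \<le> pen_obj lam Y K n tau \<omega> b"
  unfolding pen_obj_def by (intro add_nonneg_nonneg mult_nonneg_nonneg sum_nonneg) auto

text \<open>Parallelogram law. The sample loss is merely convex; the penalty supplies the left side,
  a quantitative strict convexity under which near minimisers are close to one another.\<close>

lemma pen_obj_midpoint:
  assumes x: "x \<in> EK lam K" and y: "y \<in> EK lam K"
  defines "z \<equiv> (\<lambda>k. (x k + y k) / 2)"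
  shows "z \<in> EK lam K"
    and "tau * (\<Sum>k=1..K. (lam k * (x k - y k))\<^sup>2) \<le>
      2 * (pen_obj lam Y K n tau \<omega> x + pen_obj lam Y K n tau \<omega> y) - 4 * pen_obj lam Y K n tau \<omega> z"
proof -
  show z: "z \<in> EK lam K" using x y unfolding EK_iff z_def by simp
  define S where "S = (\<lambda>b. \<Sum>t=1..n. (Y (int t) \<omega> - Xt Y K b (int t) \<omega>)\<^sup>2)"
  have X: "Xt Y K z t \<omega> = (Xt Y K x t \<omega> + Xt Y K y t \<omega>) / 2" for t
    unfolding Xt_def z_def by (simp add: sum.distrib[symmetric] sum_divide_distrib algebra_simps)
  have "4 * S z \<le> 2 * (S x + S y)"
    unfolding S_def sum_distrib_left sum.distrib[symmetric]
  proof (rule sum_mono)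
    fix t
    have "4 * (a - (b + c) / 2)\<^sup>2 \<le> 2 * ((a - b)\<^sup>2 + (a - c)\<^sup>2)" for a b c :: real
      using zero_le_power2[of "b - c"] by (simp add: power2_eq_square algebra_simps)
    then show "4 * (Y (int t) \<omega> - Xt Y K z (int t) \<omega>)\<^sup>2 \<le> 2 * ((Y (int t) \<omega> - Xt Y K x (int t) \<omega>)\<^sup>2 + (Y (int t) \<omega> - Xt Y K y (int t) \<omega>)\<^sup>2)"
      unfolding X .
  qed
  then have "(1 / real n) * (4 * S z) \<le> (1 / real n) * (2 * (S x + S y))" by (rule mult_left_mono) simp
  moreover have "4 * (\<Sum>k=1..K. (lam k * z k)\<^sup>2) + (\<Sum>k=1..K. (lam k * (x k - y k))\<^sup>2)
      = 2 * ((\<Sum>k=1..K. (lam k * x k)\<^sup>2) + (\<Sum>k=1..K. (lam k * y k)\<^sup>2))"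
    unfolding z_def sum_distrib_left sum.distrib[symmetric]
    by (rule sum.cong) (simp_all add: power2_eq_square algebra_simps)
  then have "tau * (4 * (\<Sum>k=1..K. (lam k * z k)\<^sup>2)) + tau * (\<Sum>k=1..K. (lam k * (x k - y k))\<^sup>2)
      = tau * (2 * ((\<Sum>k=1..K. (lam k * x k)\<^sup>2) + (\<Sum>k=1..K. (lam k * y k)\<^sup>2)))"
    by (simp only: distrib_left[symmetric])
  moreover have "pen_obj lam Y K n tau \<omega> x = (1 / real n) * S x + tau * (\<Sum>k=1..K. (lam k * x k)\<^sup>2)"
    "pen_obj lam Y K n tau \<omega> y = (1 / real n) * S y + tau * (\<Sum>k=1..K. (lam k * y k)\<^sup>2)"
    "pen_obj lam Y K n tau \<omega> z = (1 / real n) * S z + tau * (\<Sum>k=1..K. (lam k * z k)\<^sup>2)"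
    unfolding S_def by (rule pen_obj_EK[OF x] pen_obj_EK[OF y] pen_obj_EK[OF z])+
  ultimately show "tau * (\<Sum>k=1..K. (lam k * (x k - y k))\<^sup>2) \<le>
      2 * (pen_obj lam Y K n tau \<omega> x + pen_obj lam Y K n tau \<omega> y) - 4 * pen_obj lam Y K n tau \<omega> z"
    by argo
qed

text \<open>A countable dense family in \<open>EK\<close>, decoded from lists of rationals. Entry 0
  of a list is a dummy, so that position k holds coefficient k. On lists that are too short
  \<open>!\<close> yields some unspecified rational, which does no harm: density uses lists of
  length K + 1 only.\<close>

definition rat_seq :: "nat \<Rightarrow> nat \<Rightarrow> nat \<Rightarrow> real" where
  "rat_seq K i k = (if 1 \<le> k \<and> k \<le> K then real_of_rat ((from_nat i :: rat list) ! k) else 0)"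

lemma rat_seq_EK: "rat_seq K i \<in> EK lam K"
  by (auto simp: EK_iff rat_seq_def)

lemma rat_seq_dense:
  assumes b: "b \<in> EK lam K"
  shows "\<exists>idx. \<forall>k. (\<lambda>j. rat_seq K (idx j) k) \<longlonglongrightarrow> b k"
proof -
  have "\<exists>q. \<bar>real_of_rat q - b k\<bar> < 1 / real (Suc j)" for j k
  proof -
    obtain q where "b k < real_of_rat q" "real_of_rat q < b k + 1 / real (Suc j)"
      using of_rat_dense[of "b k" "b k + 1 / real (Suc j)"] by auto
    then show ?thesis by (intro exI[of _ q]) auto
  qed
  then have "\<forall>j k. \<exists>q. \<bar>real_of_rat q - b k\<bar> < 1 / real (Suc j)" by blast
  then obtain q where q: "\<And>j k. \<bar>real_of_rat (q j k) - b k\<bar> < 1 / real (Suc j)"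
    unfolding choice_iff by blast
  define idx where "idx = (\<lambda>j. to_nat (map (q j) [0..<Suc K]))"
  have "(\<lambda>j. rat_seq K (idx j) k) \<longlonglongrightarrow> b k" for k
  proof (cases "1 \<le> k \<and> k \<le> K")
    case True
    have eq: "rat_seq K (idx j) k = real_of_rat (q j k)" for j
      using True by (simp add: rat_seq_def idx_def del: upt_Suc)
    have "(\<lambda>j. real_of_rat (q j k) - b k) \<longlonglongrightarrow> 0"
    proof (rule Lim_null_comparison)
      show "(\<lambda>j. 1 / real (Suc j)) \<longlonglongrightarrow> 0" by (rule lim_1_over_n[THEN LIMSEQ_Suc])
      have "norm (real_of_rat (q j k) - b k) \<le> 1 / real (Suc j)" for j
        using q[of j k] by (simp only: real_norm_def less_imp_le)
      then show "\<forall>\<^sub>F j in sequentially. norm (real_of_rat (q j k) - b k) \<le> 1 / real (Suc j)"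
        by (intro always_eventually allI)
    qed
    then show ?thesis unfolding eq by (simp add: LIM_zero_iff)
  next
    case False
    then have "k = 0 \<or> K < k" by auto
    then have "b k = 0" using b unfolding EK_iff by blast
    moreover have "rat_seq K (idx j) k = 0" for j using False by (auto simp: rat_seq_def)
    ultimately show ?thesis by simp
  qed
  then show ?thesis by blast
qed

lemma tendsto_pen_obj:
  assumes "\<And>j. c j \<in> EK lam K" "b \<in> EK lam K" "\<And>k. (\<lambda>j. c j k) \<longlonglongrightarrow> b k"
  shows "(\<lambda>j. pen_obj lam Y K n tau \<omega> (c j)) \<longlonglongrightarrow> pen_obj lam Y K n tau \<omega> b"
  unfolding pen_obj_EK[OF assms(1)] pen_obj_EK[OF assms(2)] Xt_def
  by (intro tendsto_intros assms(3))

text \<open>The minimiser is the limit of the first rational vectors whose objective is within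
  \<open>1 / (j + 1)\<close> of the infimum; this gives existence and measurability at once.\<close>

definition approx_index :: "(nat \<Rightarrow> real) \<Rightarrow> (int \<Rightarrow> 'a \<Rightarrow> real) \<Rightarrow> nat \<Rightarrow> nat \<Rightarrow> real \<Rightarrow> 'a \<Rightarrow> nat \<Rightarrow> nat" where
  "approx_index lam Y K n tau \<omega> j = (LEAST i. pen_obj lam Y K n tau \<omega> (rat_seq K i)
     < (INF i. pen_obj lam Y K n tau \<omega> (rat_seq K i)) + 1 / real (Suc j))"

lemma pen_est_properties:
  assumes tau: "0 < tau" and lam: "\<And>k. 1 \<le> k \<Longrightarrow> 0 < lam k"
  shows pen_est_EK: "pen_est lam Y K n tau \<omega> \<in> EK lam K"
    and pen_est_le: "\<And>b. b \<in> EK lam K \<Longrightarrow> pen_obj lam Y K n tau \<omega> (pen_est lam Y K n tau \<omega>) \<le> pen_obj lam Y K n tau \<omega> b"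
    and pen_est_limit: "(\<lambda>j. rat_seq K (approx_index lam Y K n tau \<omega> j) k) \<longlonglongrightarrow> pen_est lam Y K n tau \<omega> k"
proof -
  define f where "f = pen_obj lam Y K n tau \<omega>"
  define m where "m = (INF i. f (rat_seq K i))"
  define r where "r = (\<lambda>j. rat_seq K (approx_index lam Y K n tau \<omega> j))"
  have f0: "0 \<le> f b" for b unfolding f_def using tau by (intro pen_obj_nonneg) simp
  have bdd: "bdd_below (range (\<lambda>i. f (rat_seq K i)))" using f0 by (intro bdd_belowI[of _ 0]) auto
  have rEK: "r j \<in> EK lam K" for j unfolding r_def by (rule rat_seq_EK)
  have r_less: "f (r j) < m + 1 / real (Suc j)" for j
  proof -
    have "m < m + 1 / real (Suc j)" by simp
    then have "\<exists>i. f (rat_seq K i) < m + 1 / real (Suc j)"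
      unfolding m_def using cINF_less_iff[OF _ bdd] by blast
    then have "f (rat_seq K (LEAST i. f (rat_seq K i) < m + 1 / real (Suc j))) < m + 1 / real (Suc j)"
      by (rule LeastI_ex)
    then show ?thesis unfolding r_def approx_index_def f_def m_def .
  qed
  have m_le: "m \<le> f b" if bEK: "b \<in> EK lam K" for b
  proof -
    obtain idx where "\<forall>k. (\<lambda>j. rat_seq K (idx j) k) \<longlonglongrightarrow> b k" using rat_seq_dense[OF bEK] by blast
    then have "(\<lambda>j. f (rat_seq K (idx j))) \<longlonglongrightarrow> f b"
      unfolding f_def by (intro tendsto_pen_obj rat_seq_EK bEK) simp
    then show "m \<le> f b"
      by (rule LIMSEQ_le_const) (auto simp: m_def intro!: cINF_lower bdd)
  qed
  \<comment> \<open>Serves twice: with two members of the minimising sequence it gives the Cauchy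
    property, and with a second minimiser it gives uniqueness, so that the \<open>THE\<close> in
    \<open>pen_est\<close> denotes.\<close>
  have par: "tau * (lam k * (x k - y k))\<^sup>2 \<le> 2 * ((f x - m) + (f y - m))"
    if "x \<in> EK lam K" "y \<in> EK lam K" "1 \<le> k" "k \<le> K" for x y k
  proof -
    have "(lam k * (x k - y k))\<^sup>2 \<le> (\<Sum>k=1..K. (lam k * (x k - y k))\<^sup>2)"
      using that by (intro member_le_sum) auto
    then have "tau * (lam k * (x k - y k))\<^sup>2 \<le> tau * (\<Sum>k=1..K. (lam k * (x k - y k))\<^sup>2)"
      using tau by (intro mult_left_mono) auto
    also have "\<dots> \<le> 2 * (f x + f y) - 4 * f (\<lambda>k. (x k + y k) / 2)"
      unfolding f_def by (rule pen_obj_midpoint(2)[OF that(1,2)])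
    also have "\<dots> \<le> 2 * ((f x - m) + (f y - m))"
      using m_le[OF pen_obj_midpoint(1)[OF that(1,2)]] by simp
    finally show ?thesis .
  qed
  have "Cauchy (\<lambda>j. r j k)" for k
  proof (cases "1 \<le> k \<and> k \<le> K")
    case True
    define a where "a = tau * (lam k)\<^sup>2"
    have a: "0 < a" using True tau lam[of k] by (simp add: a_def)
    have d: "a * (r i k - r j k)\<^sup>2 \<le> 2 * (1 / real (Suc i) + 1 / real (Suc j))" for i j
      using par[OF rEK rEK, of k i j] True r_less[of i] r_less[of j]
      by (simp add: a_def power_mult_distrib mult.assoc)
    show ?thesis
    proof (rule metric_CauchyI)
      fix \<epsilon> :: real assume \<epsilon>: "0 < \<epsilon>"
      obtain N where N: "1 / real (Suc N) < a * \<epsilon>\<^sup>2 / 4"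
        using reals_Archimedean[of "a * \<epsilon>\<^sup>2 / 4"] a \<epsilon> by (auto simp: inverse_eq_divide)
      have "dist (r i k) (r j k) < \<epsilon>" if "N \<le> i" "N \<le> j" for i j
      proof -
        have *: "p < q" if "u \<le> w" "v \<le> w" "p \<le> 2 * (u + v)" "w < q / 4" for p q u v w :: real
          using that by argo
        have "1 / real (Suc i) \<le> 1 / real (Suc N)" "1 / real (Suc j) \<le> 1 / real (Suc N)"
          using that by (auto intro!: divide_left_mono)
        from *[OF this d N] have "a * (r i k - r j k)\<^sup>2 < a * \<epsilon>\<^sup>2" .
        then have "\<bar>r i k - r j k\<bar>\<^sup>2 < \<epsilon>\<^sup>2" using a by simp
        then show ?thesis using \<epsilon> by (simp add: dist_real_def power2_less_imp_less)
      qed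
      then show "\<exists>N. \<forall>i\<ge>N. \<forall>j\<ge>N. dist (r i k) (r j k) < \<epsilon>" by blast
    qed
  next
    case False
    then have "r j k = 0" for j by (auto simp: r_def rat_seq_def)
    then show ?thesis by (simp add: convergent_Cauchy convergent_const)
  qed
  then have "\<exists>l. (\<lambda>j. r j k) \<longlonglongrightarrow> l" for k by (auto simp: Cauchy_convergent_iff convergent_def)
  then obtain b where b: "\<And>k. (\<lambda>j. r j k) \<longlonglongrightarrow> b k" by metis
  have bEK: "b \<in> EK lam K"
    unfolding EK_iff
  proof (intro allI impI)
    fix k :: nat assume "k = 0 \<or> K < k"
    then have "r j k = 0" for j by (auto simp: r_def rat_seq_def)
    then have "(\<lambda>j. 0) \<longlonglongrightarrow> b k" using b[of k] by simp
    then show "b k = 0" by (simp add: LIMSEQ_const_iff)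
  qed
  have "(\<lambda>j. f (r j)) \<longlonglongrightarrow> f b" unfolding f_def by (rule tendsto_pen_obj[OF rEK bEK b])
  moreover have "(\<lambda>j. m + 1 / real (Suc j)) \<longlonglongrightarrow> m + 0"
    by (intro tendsto_add tendsto_const lim_1_over_n[THEN LIMSEQ_Suc])
  ultimately have "f b \<le> m + 0" by (rule LIMSEQ_le) (intro exI allI impI less_imp_le r_less)
  then have fb: "f b \<le> m" by simp
  have "pen_est lam Y K n tau \<omega> = b"
    unfolding pen_est_def f_def[symmetric]
  proof (rule the_equality)
    show "b \<in> EK lam K \<and> (\<forall>b'\<in>EK lam K. f b \<le> f b')"
      using bEK fb m_le by (auto intro: order_trans)
    fix c assume c: "c \<in> EK lam K \<and> (\<forall>b'\<in>EK lam K. f c \<le> f b')"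
    show "c = b"
    proof
      fix k show "c k = b k"
      proof (cases "1 \<le> k \<and> k \<le> K")
        case True
        have "f c \<le> m" using c bEK fb by (auto intro: order_trans)
        then have "tau * (lam k * (c k - b k))\<^sup>2 \<le> 0" using par[of c b k] c bEK True fb by simp
        then have "(lam k * (c k - b k))\<^sup>2 \<le> 0" using tau by (simp add: mult_le_0_iff)
        then show ?thesis using lam[of k] True by simp
      next
        case False
        then have "k = 0 \<or> K < k" by auto
        then have "c k = 0" "b k = 0" using c bEK unfolding EK_iff by blast+
        then show ?thesis by simp
      qed
    qed
  qed
  then show "pen_est lam Y K n tau \<omega> \<in> EK lam K"
    "\<And>b. b \<in> EK lam K \<Longrightarrow> pen_obj lam Y K n tau \<omega> (pen_est lam Y K n tau \<omega>) \<le> pen_obj lam Y K n tau \<omega> b"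
    "(\<lambda>j. rat_seq K (approx_index lam Y K n tau \<omega> j) k) \<longlonglongrightarrow> pen_est lam Y K n tau \<omega> k"
    using bEK fb m_le b unfolding f_def[symmetric] r_def by (auto intro: order_trans)
qed

text \<open>With countably many candidates the infimum and the least admissible index are measurable
  even for random \<open>tau\<close>. This matters because \<open>measure\<close> is 0 outside
  \<open>sets M\<close>, so that a non-measurable event could not get probability near 1.\<close>

lemma pen_est_measurable:
  fixes M :: "'a measure"
  assumes tau [measurable]: "tau \<in> borel_measurable M" and tau0: "\<And>\<omega>. \<omega> \<in> space M \<Longrightarrow> 0 < tau \<omega>"
    and lam: "\<And>k. 1 \<le> k \<Longrightarrow> 0 < lam k"
    and Y [measurable]: "\<And>t. Y t \<in> borel_measurable M"
  shows "(\<lambda>\<omega>. pen_est lam Y K n (tau \<omega>) \<omega> k) \<in> borel_measurable M"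
proof (rule borel_measurable_LIMSEQ_real)
  show "(\<lambda>j. rat_seq K (approx_index lam Y K n (tau \<omega>) \<omega> j) k) \<longlonglongrightarrow> pen_est lam Y K n (tau \<omega>) \<omega> k"
    if "\<omega> \<in> space M" for \<omega>
    by (rule pen_est_limit[OF tau0[OF that] lam])
  have [measurable]: "(\<lambda>\<omega>. pen_obj lam Y K n (tau \<omega>) \<omega> b) \<in> borel_measurable M" for b
    unfolding pen_obj_def Xt_def by measurable
  have [measurable]: "(\<lambda>\<omega>. INF i. pen_obj lam Y K n (tau \<omega>) \<omega> (rat_seq K i)) \<in> borel_measurable M"
    by (rule borel_measurable_cINF_real)
      (auto intro!: bdd_belowI[of _ 0] pen_obj_nonneg less_imp_le[OF tau0])
  have "(\<lambda>\<omega>. approx_index lam Y K n (tau \<omega>) \<omega> j) \<in> measurable M (count_space UNIV)" for j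
    unfolding approx_index_def by measurable
  then show "(\<lambda>\<omega>. rat_seq K (approx_index lam Y K n (tau \<omega>) \<omega> j) k) \<in> borel_measurable M" for j
    by (rule measurable_compose[where g = "\<lambda>i. rat_seq K i k"]) simp
qed

section \<open>The weighted norm\<close>

text \<open>A quantitative Radon-Riesz argument. Coordinates below J are close, so u and v carry
  almost the same mass there; as u has hardly more total mass than v, its tail beyond J is at most
  that of v plus a small error. The tail of the difference is then at most twice the sum of both
  tails.\<close>

lemma l2_tail_bound:
  fixes u v l :: "nat \<Rightarrow> real"
  assumes u: "summable (\<lambda>k. (u k)\<^sup>2)" and v: "summable (\<lambda>k. (v k)\<^sup>2)"
    and l: "\<And>k. 0 \<le> l k" and close: "\<And>k. \<bar>u k - v k\<bar> \<le> l k * s"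
    and norm: "(\<Sum>k. (u k)\<^sup>2) \<le> (\<Sum>k. (v k)\<^sup>2) + \<rho>"
  shows "summable (\<lambda>k. (u k - v k)\<^sup>2)"
    and "(\<Sum>k. (u k - v k)\<^sup>2) \<le> s\<^sup>2 * (\<Sum>k<J. (l k)\<^sup>2) + 2 * \<rho> + 4 * s * (\<Sum>k<J. l k * \<bar>v k\<bar>) + 4 * (\<Sum>k. (v (k + J))\<^sup>2)"
proof -
  have le: "(u k - v k)\<^sup>2 \<le> 2 * (u k)\<^sup>2 + 2 * (v k)\<^sup>2" for k
    using zero_le_power2[of "u k + v k"] by (simp add: power2_eq_square algebra_simps)
  have s2: "summable (\<lambda>k. 2 * (u k)\<^sup>2 + 2 * (v k)\<^sup>2)" by (intro summable_add summable_mult u v)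
  show s: "summable (\<lambda>k. (u k - v k)\<^sup>2)"
    by (rule summable_comparison_test'[OF s2, of 0]) (simp add: le)
  have split: "(\<Sum>k. f k) = (\<Sum>k. f (k + J)) + (\<Sum>k<J. f k)" if "summable f" for f :: "nat \<Rightarrow> real"
    by (rule suminf_split_initial_segment[OF that])
  have "(\<Sum>k. (u (k + J) - v (k + J))\<^sup>2) \<le> (\<Sum>k. 2 * (u (k + J))\<^sup>2 + 2 * (v (k + J))\<^sup>2)"
    by (rule suminf_le[OF le summable_ignore_initial_segment[OF s] summable_ignore_initial_segment[OF s2]])
  also have "\<dots> = 2 * (\<Sum>k. (u (k + J))\<^sup>2) + 2 * (\<Sum>k. (v (k + J))\<^sup>2)"
    using summable_ignore_initial_segment[OF u, of J] summable_ignore_initial_segment[OF v, of J]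
    by (simp add: suminf_add[symmetric] suminf_mult summable_mult)
  finally have t: "(\<Sum>k. (u (k + J) - v (k + J))\<^sup>2) \<le> 2 * (\<Sum>k. (u (k + J))\<^sup>2) + 2 * (\<Sum>k. (v (k + J))\<^sup>2)" .
  have h: "(\<Sum>k<J. (u k - v k)\<^sup>2) \<le> s\<^sup>2 * (\<Sum>k<J. (l k)\<^sup>2)"
    unfolding sum_distrib_left
  proof (rule sum_mono)
    fix k show "(u k - v k)\<^sup>2 \<le> s\<^sup>2 * (l k)\<^sup>2"
      using power_mono[OF close[of k] abs_ge_zero, of 2] by (simp add: power_mult_distrib mult.commute)
  qed
  \<comment> \<open>Only this direction is required: mass that u misses in the head is mass it could
    carry in the tail.\<close>
  have "(\<Sum>k<J. (v k)\<^sup>2 - (u k)\<^sup>2) \<le> (\<Sum>k<J. 2 * s * (l k * \<bar>v k\<bar>))"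
  proof (rule sum_mono)
    fix k
    have "(v k)\<^sup>2 - (u k)\<^sup>2 = 2 * (v k * (v k - u k)) - (v k - u k)\<^sup>2"
      by (simp add: power2_eq_square algebra_simps)
    also have "\<dots> \<le> 2 * (\<bar>v k\<bar> * \<bar>u k - v k\<bar>)"
    proof -
      have "v k * (v k - u k) \<le> \<bar>v k\<bar> * \<bar>u k - v k\<bar>"
        using abs_ge_self[of "v k * (v k - u k)"] by (simp only: abs_mult abs_minus_commute)
      then show ?thesis using zero_le_power2[of "v k - u k"] by argo
    qed
    also have "\<dots> \<le> 2 * (\<bar>v k\<bar> * (l k * s))" by (intro mult_left_mono close) auto
    finally show "(v k)\<^sup>2 - (u k)\<^sup>2 \<le> 2 * s * (l k * \<bar>v k\<bar>)" by (simp add: mult_ac)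
  qed
  then have d: "(\<Sum>k<J. (v k)\<^sup>2) - (\<Sum>k<J. (u k)\<^sup>2) \<le> 2 * s * (\<Sum>k<J. l k * \<bar>v k\<bar>)"
    by (simp only: sum_subtractf sum_distrib_left)
  show "(\<Sum>k. (u k - v k)\<^sup>2) \<le> s\<^sup>2 * (\<Sum>k<J. (l k)\<^sup>2) + 2 * \<rho> + 4 * s * (\<Sum>k<J. l k * \<bar>v k\<bar>) + 4 * (\<Sum>k. (v (k + J))\<^sup>2)"
    using t h d norm split[OF s] split[OF u] split[OF v] by argo
qed

text \<open>The weights are unbounded, so coordinatewise closeness is useful on a finite head only.
  J is fixed first, from the tail of phi alone, and \<rho> afterwards; thus one \<rho> works for all
  b.\<close>

lemma Enorm_close:
  fixes phi lam :: "nat \<Rightarrow> real"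
  assumes phi: "inE lam phi" and lam: "\<And>k. 1 \<le> k \<Longrightarrow> 0 < lam k" and e: "0 < e"
  shows "\<exists>\<rho>>0. \<forall>b. inE lam b \<longrightarrow> (Enorm lam b)\<^sup>2 \<le> (Enorm lam phi)\<^sup>2 + \<rho> \<longrightarrow>
    (\<forall>k\<ge>1. (b k - phi k)\<^sup>2 \<le> \<rho>) \<longrightarrow> Enorm lam (\<lambda>k. b k - phi k) \<le> e"
proof -
  define v where "v = (\<lambda>k. lam (Suc k) * phi (Suc k))"
  define l where "l = (\<lambda>k. lam (Suc k))"
  have v: "summable (\<lambda>k. (v k)\<^sup>2)" using phi by (simp add: v_def inE_def)
  obtain J where J: "\<And>m. m \<ge> J \<Longrightarrow> norm (\<Sum>k. (v (k + m))\<^sup>2) < e\<^sup>2 / 8"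
    using suminf_exist_split[OF _ v, of "e\<^sup>2 / 8"] e by auto
  define g where "g = (\<lambda>\<rho>. (sqrt \<rho>)\<^sup>2 * (\<Sum>k<J. (l k)\<^sup>2) + 2 * \<rho> + 4 * sqrt \<rho> * (\<Sum>k<J. l k * \<bar>v k\<bar>))"
  have "(g \<longlongrightarrow> (sqrt 0)\<^sup>2 * (\<Sum>k<J. (l k)\<^sup>2) + 2 * 0 + 4 * sqrt 0 * (\<Sum>k<J. l k * \<bar>v k\<bar>)) (at_right 0)"
    unfolding g_def by (intro tendsto_intros)
  then have "(g \<longlongrightarrow> 0) (at_right 0)" by simp
  then have "\<forall>\<^sub>F \<rho> in at_right 0. g \<rho> < e\<^sup>2 / 2" by (rule order_tendstoD) (use e in simp)
  then have "\<forall>\<^sub>F \<rho> in at_right 0. g \<rho> < e\<^sup>2 / 2 \<and> 0 < \<rho>"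
    by (intro eventually_conj eventually_at_right_less)
  then obtain \<rho> where \<rho>: "g \<rho> < e\<^sup>2 / 2" "0 < \<rho>"
    using eventually_happens'[OF trivial_limit_at_right_real] by blast
  show ?thesis
  proof (intro exI[of _ \<rho>] conjI allI impI)
    fix b assume b: "inE lam b" "(Enorm lam b)\<^sup>2 \<le> (Enorm lam phi)\<^sup>2 + \<rho>" "\<forall>k\<ge>1. (b k - phi k)\<^sup>2 \<le> \<rho>"
    define u where "u = (\<lambda>k. lam (Suc k) * b (Suc k))"
    have u: "summable (\<lambda>k. (u k)\<^sup>2)" using b(1) by (simp add: u_def inE_def)
    have l: "0 \<le> l k" for k using lam[of "Suc k"] by (simp add: l_def)
    have uv: "u k - v k = lam (Suc k) * (b (Suc k) - phi (Suc k))" for k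
      by (simp add: u_def v_def right_diff_distrib)
    have close: "\<bar>u k - v k\<bar> \<le> l k * sqrt \<rho>" for k
    proof -
      have "\<bar>b (Suc k) - phi (Suc k)\<bar> \<le> sqrt \<rho>" using b(3) by (intro real_le_rsqrt) simp
      then show ?thesis unfolding uv l_def[symmetric] using l[of k]
        by (simp add: abs_mult mult_left_mono l_def)
    qed
    have norm: "(\<Sum>k. (u k)\<^sup>2) \<le> (\<Sum>k. (v k)\<^sup>2) + \<rho>"
      using b(2) unfolding Enorm_square[OF b(1)] Enorm_square[OF phi] u_def v_def .
    have "(\<Sum>k. (u k - v k)\<^sup>2) \<le> g \<rho> + 4 * (\<Sum>k. (v (k + J))\<^sup>2)"
      unfolding g_def using l2_tail_bound(2)[OF u v l close norm, of J] by simp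
    also have "\<dots> \<le> e\<^sup>2"
      using \<rho>(1) order_le_less_trans[OF abs_ge_self J[OF order_refl, unfolded real_norm_def]] by argo
    finally have "(\<Sum>k. (u k - v k)\<^sup>2) \<le> e\<^sup>2" .
    then have "sqrt (\<Sum>k. (u k - v k)\<^sup>2) \<le> e" using e by (intro real_le_lsqrt) auto
    then show "Enorm lam (\<lambda>k. b k - phi k) \<le> e" unfolding Enorm_def uv .
  qed (rule \<rho>(2))
qed

text \<open>Counterpart of \<open>suminf_conv_square_le\<close>: filtering by G undoes filtering by
  F. Together they make the excess loss equivalent to the squared l2 distance from phi.\<close>

lemma l2_le_conv:
  assumes FG: "F * G = 1" and F: "l1_le F c" and G: "l1_le G g" and d: "summable (\<lambda>k. (d k)\<^sup>2)"
  shows "(\<Sum>k. (d k)\<^sup>2) \<le> g\<^sup>2 * (\<Sum>m. (conv F d m)\<^sup>2)"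
proof -
  have "d = conv G (conv F d)" using FG by (simp add: conv_conv conv_one mult.commute)
  then show ?thesis using suminf_conv_square_le[OF G summable_conv_square[OF F d]] by simp
qed

text \<open>\<open>phi 0\<close> is an arbitrary value of the encoding; setting entry 0 to 0 keeps
  it out of the l2 norms and the convolutions.\<close>

definition coef_diff :: "(nat \<Rightarrow> real) \<Rightarrow> (nat \<Rightarrow> real) \<Rightarrow> nat \<Rightarrow> real" where
  "coef_diff phi b k = (if k = 0 then 0 else b k - phi k)"

section \<open>Power weights and approximation of phi within \<open>EK\<close>\<close>

locale power_weights =
  fixes lam :: "nat \<Rightarrow> real" and lamexp c1 c2 :: real
  assumes lamexp: "1 / 2 < lamexp" and c1: "0 < c1"
    and lam_bounds: "\<And>k. 1 \<le> k \<Longrightarrow> c1 * real k powr lamexp \<le> lam k \<and> lam k \<le> c2 * real k powr lamexp"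
begin

lemma lam_ge_c1: "1 \<le> k \<Longrightarrow> c1 \<le> lam k"
proof -
  assume k: "1 \<le> k"
  have "c1 * 1 \<le> c1 * real k powr lamexp"
    using k c1 lamexp by (intro mult_left_mono ge_one_powr_ge_zero) auto
  then show ?thesis using lam_bounds[OF k] by simp
qed

lemma lam_pos: "1 \<le> k \<Longrightarrow> 0 < lam k"
  using lam_ge_c1 c1 by force

text \<open>This is where 2 * lamexp > 1 is decisive.\<close>

lemma summable_inverse_lam_square: "summable (\<lambda>k. (1 / lam (Suc k))\<^sup>2)"
proof (rule summable_comparison_test'[where N = 0])
  have "summable (\<lambda>k. real (Suc k) powr (- (2 * lamexp)))"
    using lamexp summable_real_powr_iff[of "- (2 * lamexp)"] by (subst summable_Suc_iff) simp
  then show "summable (\<lambda>k. (1 / c1)\<^sup>2 * real (Suc k) powr (- (2 * lamexp)))" by (rule summable_mult)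
  fix k
  have "(1 / lam (Suc k))\<^sup>2 \<le> (1 / (c1 * real (Suc k) powr lamexp))\<^sup>2"
    using lam_bounds[of "Suc k"] c1 lam_pos[of "Suc k"]
    by (intro power_mono divide_left_mono mult_pos_pos) auto
  also have "\<dots> = (1 / c1)\<^sup>2 * (real (Suc k) powr (- lamexp))\<^sup>2"
    by (simp only: powr_minus_divide power_mult_distrib[symmetric]) simp
  also have "(real (Suc k) powr (- lamexp))\<^sup>2 = real (Suc k) powr (- (2 * lamexp))"
    by (simp add: power2_eq_square powr_add[symmetric])
  finally show "norm ((1 / lam (Suc k))\<^sup>2) \<le> (1 / c1)\<^sup>2 * real (Suc k) powr (- (2 * lamexp))" by simp
qed

text \<open>Split b_k as (lam_k b_k) * (1 / lam_k), two square summable factors. This provides the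
  l1 input of Wiener's lemma.\<close>

lemma inE_summable_abs: "inE lam b \<Longrightarrow> summable (\<lambda>k. \<bar>b (Suc k)\<bar>)"
proof (rule summable_comparison_test'[where N = 0])
  assume "inE lam b"
  then show "summable (\<lambda>k. (lam (Suc k) * b (Suc k))\<^sup>2 + (1 / lam (Suc k))\<^sup>2)"
    unfolding inE_def by (intro summable_add summable_inverse_lam_square)
  fix k
  have "\<bar>b (Suc k)\<bar> = \<bar>lam (Suc k) * b (Suc k)\<bar> * \<bar>1 / lam (Suc k)\<bar>"
    using lam_pos[of "Suc k"] by (simp add: abs_mult)
  also have "\<dots> \<le> (lam (Suc k) * b (Suc k))\<^sup>2 + (1 / lam (Suc k))\<^sup>2"
    using sum_squares_bound[of "\<bar>lam (Suc k) * b (Suc k)\<bar>" "\<bar>1 / lam (Suc k)\<bar>"]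
      mult_nonneg_nonneg[OF abs_ge_zero abs_ge_zero, of "lam (Suc k) * b (Suc k)" "1 / lam (Suc k)"]
    unfolding power2_abs by argo
  finally show "norm \<bar>b (Suc k)\<bar> \<le> (lam (Suc k) * b (Suc k))\<^sup>2 + (1 / lam (Suc k))\<^sup>2" by simp
qed

lemma inE_diff: "inE lam b \<Longrightarrow> inE lam b' \<Longrightarrow> inE lam (\<lambda>k. b k - b' k)"
proof -
  assume b: "inE lam b" "inE lam b'"
  have "(lam k * (b k - b' k))\<^sup>2 \<le> 2 * (lam k * b k)\<^sup>2 + 2 * (lam k * b' k)\<^sup>2" for k
    using zero_le_power2[of "lam k * b k + lam k * b' k"] by (simp add: power2_eq_square algebra_simps)
  then show ?thesis unfolding inE_def
    by (intro summable_comparison_test'[OF summable_add[OF summable_mult[OF b(1)[unfolded inE_def], of 2] summable_mult[OF b(2)[unfolded inE_def], of 2]], of 0]) simp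
qed

lemma l2_le_Enorm:
  assumes "inE lam b" "b 0 = 0"
  shows "summable (\<lambda>k. (b k)\<^sup>2)" and "(\<Sum>k. (b k)\<^sup>2) \<le> (Enorm lam b)\<^sup>2 / c1\<^sup>2"
proof -
  have s: "summable (\<lambda>k. (lam (Suc k) * b (Suc k))\<^sup>2 / c1\<^sup>2)"
    using assms(1) unfolding inE_def by (rule summable_divide)
  have le: "(b (Suc k))\<^sup>2 \<le> (lam (Suc k) * b (Suc k))\<^sup>2 / c1\<^sup>2" for k
  proof -
    have "c1\<^sup>2 * (b (Suc k))\<^sup>2 \<le> (lam (Suc k))\<^sup>2 * (b (Suc k))\<^sup>2"
      using lam_ge_c1[of "Suc k"] c1 by (intro mult_right_mono power_mono) auto
    then show ?thesis using c1 by (simp add: pos_le_divide_eq power_mult_distrib mult.commute)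
  qed
  have s': "summable (\<lambda>k. (b (Suc k))\<^sup>2)" by (rule summable_comparison_test'[OF s, of 0]) (use le in simp)
  then show sb: "summable (\<lambda>k. (b k)\<^sup>2)" by (subst summable_Suc_iff[symmetric])
  have "(\<Sum>k. (b k)\<^sup>2) = (\<Sum>k. (b (Suc k))\<^sup>2)"
    using suminf_split_head[OF sb] assms(2) by simp
  also have "\<dots> \<le> (\<Sum>k. (lam (Suc k) * b (Suc k))\<^sup>2 / c1\<^sup>2)" by (rule suminf_le[OF le s' s])
  also have "\<dots> = (Enorm lam b)\<^sup>2 / c1\<^sup>2"
    unfolding Enorm_square[OF assms(1)] by (rule suminf_divide) (use assms(1) in \<open>simp add: inE_def\<close>)
  finally show "(\<Sum>k. (b k)\<^sup>2) \<le> (Enorm lam b)\<^sup>2 / c1\<^sup>2" .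
qed

lemma inE_coef_diff: "inE lam phi \<Longrightarrow> inE lam b \<Longrightarrow> inE lam (coef_diff phi b)"
  using inE_diff[of b phi] by (simp add: inE_def coef_diff_def)

lemma Enorm_coef_diff: "Enorm lam (coef_diff phi b) = Enorm lam (\<lambda>k. b k - phi k)"
  by (simp add: Enorm_def coef_diff_def)

definition tail :: "(nat \<Rightarrow> real) \<Rightarrow> nat \<Rightarrow> real" where
  "tail phi K = (\<Sum>k. (lam (Suc (k + K)) * phi (Suc (k + K)))\<^sup>2)"

text \<open>Since a near minimiser differs from \<open>phi\<close> by \<open>o(K powr - lamexp)\<close> in \<open>l2\<close>, and
  \<open>lam k \<le> c2 * K powr lamexp\<close> on its support, it is close to \<open>phi\<close> in the strong norm.\<close>

lemma near_minimiser_bound: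
  assumes FG: "F * G = 1" and F: "l1_le F c" and G: "l1_le G g"
    and phi: "inE lam phi" and K: "1 \<le> K" and b: "b \<in> EK lam K"
    and min: "\<And>b'. b' \<in> EK lam K \<Longrightarrow>
      (\<Sum>m. (conv F (coef_diff phi b) m)\<^sup>2) \<le> (\<Sum>m. (conv F (coef_diff phi b') m)\<^sup>2) + \<eta>"
  shows "(Enorm lam (\<lambda>k. b k - phi k))\<^sup>2 \<le>
    c2\<^sup>2 * g\<^sup>2 * (c\<^sup>2 / c1\<^sup>2 * tail phi K + real K powr (2 * lamexp) * \<eta>) + tail phi K"
proof -
  define P where "P = real K powr lamexp"
  have P0: "0 < P" using K by (simp add: P_def)
  have PP: "real K powr (2 * lamexp) = P\<^sup>2" by (simp add: P_def power2_eq_square powr_add[symmetric])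
  have bE: "inE lam b" using b by (simp add: EK_def)
  \<comment> \<open>The competitor is the truncation of phi. Beyond K the weights are at least c1 *
    P, so its squared l2 distance from phi is at most \<open>tail phi K\<close> divided by
    \<open>(c1 * P)\<^sup>2\<close>.\<close>
  define p where "p = (\<lambda>k. if 1 \<le> k \<and> k \<le> K then phi k else 0)"
  have p: "p \<in> EK lam K" by (auto simp: EK_iff p_def)
  then have pE: "inE lam p" by (simp add: EK_def)
  define d where "d = coef_diff phi b"
  define d' where "d' = coef_diff phi p"
  have dE: "inE lam d" "d 0 = 0" unfolding d_def by (simp_all add: inE_coef_diff phi bE) (simp add: coef_diff_def)
  have d'E: "inE lam d'" "d' 0 = 0" unfolding d'_def by (simp_all add: inE_coef_diff phi pE) (simp add: coef_diff_def)
  note dS = l2_le_Enorm(1)[OF dE] and d'S = l2_le_Enorm(1)[OF d'E]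
  have sphi: "summable (\<lambda>k. (lam (Suc (k + K)) * phi (Suc (k + K)))\<^sup>2)"
    using summable_ignore_initial_segment[OF phi[unfolded inE_def], of K] by simp
  have d'_le: "(\<Sum>k. (d' k)\<^sup>2) \<le> tail phi K / (c1 * P)\<^sup>2"
  proof -
    have "(\<Sum>k. (d' k)\<^sup>2) = (\<Sum>k. (d' (k + Suc K))\<^sup>2) + (\<Sum>k<Suc K. (d' k)\<^sup>2)"
      by (rule suminf_split_initial_segment[OF d'S])
    also have "(\<Sum>k<Suc K. (d' k)\<^sup>2) = 0"
      by (intro sum.neutral) (auto simp: d'_def coef_diff_def p_def)
    also have "(\<Sum>k. (d' (k + Suc K))\<^sup>2) \<le> (\<Sum>k. (lam (Suc (k + K)) * phi (Suc (k + K)))\<^sup>2 / (c1 * P)\<^sup>2)"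
    proof (rule suminf_le[OF _ summable_ignore_initial_segment[OF d'S] summable_divide[OF sphi]])
      fix k
      have "c1 * P \<le> c1 * real (Suc (k + K)) powr lamexp"
        unfolding P_def using c1 lamexp by (intro mult_left_mono powr_mono2) auto
      also have "\<dots> \<le> lam (Suc (k + K))" using lam_bounds[of "Suc (k + K)"] by simp
      finally have "(c1 * P)\<^sup>2 * (phi (Suc (k + K)))\<^sup>2 \<le> (lam (Suc (k + K)))\<^sup>2 * (phi (Suc (k + K)))\<^sup>2"
        using c1 P0 by (intro mult_right_mono power_mono) auto
      moreover have "(d' (k + Suc K))\<^sup>2 = (phi (Suc (k + K)))\<^sup>2"
        by (simp add: d'_def coef_diff_def p_def)
      ultimately show "(d' (k + Suc K))\<^sup>2 \<le> (lam (Suc (k + K)) * phi (Suc (k + K)))\<^sup>2 / (c1 * P)\<^sup>2"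
        using c1 P0 by (simp add: pos_le_divide_eq power_mult_distrib mult.commute)
    qed
    also have "\<dots> = tail phi K / (c1 * P)\<^sup>2" unfolding tail_def by (rule suminf_divide[OF sphi])
    finally show ?thesis by simp
  qed
  have "(\<Sum>k. (d k)\<^sup>2) \<le> g\<^sup>2 * (\<Sum>m. (conv F d m)\<^sup>2)" by (rule l2_le_conv[OF FG F G dS])
  also have "\<dots> \<le> g\<^sup>2 * ((\<Sum>m. (conv F d' m)\<^sup>2) + \<eta>)"
    unfolding d_def d'_def by (intro mult_left_mono min p) simp
  also have "\<dots> \<le> g\<^sup>2 * (c\<^sup>2 * (tail phi K / (c1 * P)\<^sup>2) + \<eta>)"
    using order_trans[OF suminf_conv_square_le[OF F d'S] mult_left_mono[OF d'_le, of "c\<^sup>2"]]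
    by (intro mult_left_mono add_right_mono) auto
  finally have dl2: "(\<Sum>k. (d k)\<^sup>2) \<le> g\<^sup>2 * (c\<^sup>2 * (tail phi K / (c1 * P)\<^sup>2) + \<eta>)" .
  have "(Enorm lam (\<lambda>k. b k - phi k))\<^sup>2 = (\<Sum>k. (lam (Suc k) * d (Suc k))\<^sup>2)"
    using Enorm_square[OF dE(1)] unfolding d_def Enorm_coef_diff .
  also have "\<dots> = (\<Sum>k. (lam (Suc (k + K)) * d (Suc (k + K)))\<^sup>2) + (\<Sum>k<K. (lam (Suc k) * d (Suc k))\<^sup>2)"
    by (rule suminf_split_initial_segment) (use dE(1) in \<open>simp add: inE_def\<close>)
  also have "(\<Sum>k. (lam (Suc (k + K)) * d (Suc (k + K)))\<^sup>2) = tail phi K"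
    unfolding tail_def using b by (intro suminf_cong) (simp add: d_def coef_diff_def EK_iff)
  also have "(\<Sum>k<K. (lam (Suc k) * d (Suc k))\<^sup>2) \<le> (\<Sum>k<K. (c2 * P)\<^sup>2 * (d (Suc k))\<^sup>2)"
    unfolding power_mult_distrib[of "lam _"]
  proof (intro sum_mono mult_right_mono power_mono)
    fix k assume "k \<in> {..<K}"
    have "0 \<le> c2"
      using lam_bounds[of 1] lam_pos[of 1] by simp
    then have "c2 * real (Suc k) powr lamexp \<le> c2 * P"
      unfolding P_def using \<open>k \<in> _\<close> lamexp by (intro mult_left_mono powr_mono2) auto
    then show "lam (Suc k) \<le> c2 * P" using lam_bounds[of "Suc k"] by simp
    show "0 \<le> lam (Suc k)" using lam_pos[of "Suc k"] by simp
  qed simp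
  also have "\<dots> = (c2 * P)\<^sup>2 * (\<Sum>k<K. (d (Suc k))\<^sup>2)" by (simp only: sum_distrib_left)
  also have "(\<Sum>k<K. (d (Suc k))\<^sup>2) \<le> (\<Sum>k. (d (Suc k))\<^sup>2)"
    using summable_ignore_initial_segment[OF dS, of 1] by (intro sum_le_suminf) auto
  also have "(\<Sum>k. (d (Suc k))\<^sup>2) = (\<Sum>k. (d k)\<^sup>2)" using suminf_split_head[OF dS] dE(2) by simp
  also note dl2
  \<comment> \<open>The square of P lost to the weights on the support cancels against the one
    gained by the truncation; only \<eta> keeps a power of K.\<close>
  also have "(c2 * P)\<^sup>2 * (g\<^sup>2 * (c\<^sup>2 * (tail phi K / (c1 * P)\<^sup>2) + \<eta>))
      = c2\<^sup>2 * g\<^sup>2 * (c\<^sup>2 / c1\<^sup>2 * tail phi K + P\<^sup>2 * \<eta>)"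
    using P0 c1 by (simp add: power_mult_distrib field_simps)
  finally show ?thesis unfolding PP by (simp add: mult_left_mono add.commute)
qed

end

section \<open>Empirical and population loss\<close>

text \<open>Cauchy-Schwarz over pairs (j, k) after rescaling x by w; the last factor is the
  Hilbert-Schmidt norm of the rescaled matrix. For the loss difference this separates the dependence
  on b from the randomness, so one random factor serves all b.\<close>

lemma quadratic_form_le:
  fixes A :: "nat \<Rightarrow> nat \<Rightarrow> real" and x w :: "nat \<Rightarrow> real"
  assumes w: "\<And>j. j \<le> K \<Longrightarrow> w j \<noteq> 0"
  shows "\<bar>\<Sum>j\<le>K. \<Sum>k\<le>K. x j * x k * A j k\<bar> \<le>
    (\<Sum>j\<le>K. (x j / w j)\<^sup>2) * sqrt (\<Sum>j\<le>K. \<Sum>k\<le>K. (w j * w k * A j k)\<^sup>2)"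
proof -
  define a where "a = (\<lambda>p. (x (fst p) / w (fst p)) * (x (snd p) / w (snd p)))"
  define b where "b = (\<lambda>p. w (fst p) * w (snd p) * A (fst p) (snd p))"
  let ?I = "{..K} \<times> {..K}"
  have "(\<Sum>j\<le>K. \<Sum>k\<le>K. x j * x k * A j k) = (\<Sum>p\<in>?I. a p * b p)"
    unfolding sum.cartesian_product a_def b_def
    by (intro sum.cong) (auto simp: w)
  moreover have "(\<Sum>p\<in>?I. a p * b p)\<^sup>2 \<le> (\<Sum>p\<in>?I. (a p)\<^sup>2) * (\<Sum>p\<in>?I. (b p)\<^sup>2)"
    by (rule Cauchy_Schwarz_ineq_sum)
  moreover have "(\<Sum>p\<in>?I. (a p)\<^sup>2) = (\<Sum>j\<le>K. (x j / w j)\<^sup>2)\<^sup>2"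
    unfolding a_def power_mult_distrib
    by (simp only: power2_eq_square[of "\<Sum>j\<le>K. (x j / w j)\<^sup>2"] sum_product sum.cartesian_product case_prod_unfold)
  moreover have "(\<Sum>p\<in>?I. (b p)\<^sup>2) = (\<Sum>j\<le>K. \<Sum>k\<le>K. (w j * w k * A j k)\<^sup>2)"
    unfolding b_def sum.cartesian_product by (simp only: case_prod_unfold)
  ultimately have "(\<Sum>j\<le>K. \<Sum>k\<le>K. x j * x k * A j k)\<^sup>2 \<le>
    (\<Sum>j\<le>K. (x j / w j)\<^sup>2)\<^sup>2 * (\<Sum>j\<le>K. \<Sum>k\<le>K. (w j * w k * A j k)\<^sup>2)" by simp
  then have "sqrt ((\<Sum>j\<le>K. \<Sum>k\<le>K. x j * x k * A j k)\<^sup>2) \<le>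
    sqrt ((\<Sum>j\<le>K. (x j / w j)\<^sup>2)\<^sup>2 * (\<Sum>j\<le>K. \<Sum>k\<le>K. (w j * w k * A j k)\<^sup>2))"
    by (rule real_sqrt_le_mono)
  then show ?thesis by (simp add: real_sqrt_mult sum_nonneg)
qed

lemma sum_atMost_head: "(\<Sum>j\<le>K. f j) = f 0 + (\<Sum>j=1..K. f j)" for f :: "nat \<Rightarrow> 'a::comm_monoid_add"
  by (simp only: sum_atLeast1_Suc sum.lessThan_Suc_shift lessThan_Suc_atMost[symmetric])

text \<open>The filter 1 - b, with entry 0 standing for Y t itself; residuals become linear forms,
  and the loss a homogeneous quadratic form in the autocovariances.\<close>

definition ar_coef :: "(nat \<Rightarrow> real) \<Rightarrow> nat \<Rightarrow> real" where
  "ar_coef b j = (if j = 0 then 1 else - b j)"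

lemma residual_eq: "Y t \<omega> - Xt Y K b t \<omega> = (\<Sum>j\<le>K. ar_coef b j * Y (t - int j) \<omega>)"
  unfolding sum_atMost_head Xt_def by (simp add: ar_coef_def sum_negf)

lemma sample_loss_eq:
  "(1 / real n) * (\<Sum>t=1..n. (Y (int t) \<omega> - Xt Y K b (int t) \<omega>)\<^sup>2) =
    (\<Sum>j\<le>K. \<Sum>k\<le>K. ar_coef b j * ar_coef b k * ((1 / real n) * (\<Sum>t=1..n. Y (int t - int j) \<omega> * Y (int t - int k) \<omega>)))"
proof -
  have "(\<Sum>t=1..n. (Y (int t) \<omega> - Xt Y K b (int t) \<omega>)\<^sup>2) =
    (\<Sum>t=1..n. \<Sum>j\<le>K. \<Sum>k\<le>K. ar_coef b j * ar_coef b k * (Y (int t - int j) \<omega> * Y (int t - int k) \<omega>))"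
    unfolding residual_eq power2_eq_square sum_product by (intro sum.cong refl) (simp only: mult_ac)
  also have "\<dots> = (\<Sum>j\<le>K. \<Sum>k\<le>K. ar_coef b j * ar_coef b k * (\<Sum>t=1..n. Y (int t - int j) \<omega> * Y (int t - int k) \<omega>))"
    unfolding sum_distrib_left by (subst sum.swap, rule sum.cong[OF refl], rule sum.swap)
  finally show ?thesis
    by (simp only: sum_distrib_left[of "1 / real n"]) (intro sum.cong refl, simp only: mult_ac sum_distrib_left)
qed

text \<open>\<open>x2\<close> and \<open>A2\<close> are the squared weighted norms of the estimator
  and of the comparison sequence, \<open>Nb\<close> and \<open>N\<beta>\<close> their excess losses.
  For the first bound, near minimality lets the excess losses cancel; all that remains carries a
  factor \<tau>, which is divided out. For the second, the penalty of the estimator is dropped and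
  \<tau> \<le> \<rho> makes the rest small.\<close>

lemma penalised_minimiser_bounds:
  fixes \<tau> \<rho> x2 A2 D \<eta> Nb N\<beta> s2 :: real
  assumes \<tau>: "0 < \<tau>" "\<tau> \<le> \<rho>" and \<rho>: "\<rho> < 1" and D: "0 \<le> D" "D \<le> \<rho> * \<tau>"
    and x2: "0 \<le> x2" and A2: "0 \<le> A2" and s2: "0 \<le> s2"
    and N: "N\<beta> \<le> Nb + \<eta>" and \<eta>: "s2 * \<eta> \<le> \<rho> * \<tau>"
    and basic: "\<tau> * x2 + s2 * (1 + Nb) - D * (1 + x2) \<le> \<tau> * A2 + s2 * (1 + N\<beta>) + D * (1 + A2)"
  shows "x2 * (1 - \<rho>) \<le> A2 * (1 + \<rho>) + 3 * \<rho>"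
    and "s2 * Nb \<le> s2 * N\<beta> + \<rho> * (2 + x2 + A2) + \<rho> * A2"
proof -
  have *: "D * (2 + x2 + A2) \<le> \<rho> * \<tau> * (2 + x2 + A2)" using D x2 A2 by (intro mult_right_mono) auto
  have "s2 * N\<beta> \<le> s2 * Nb + \<rho> * \<tau>" using mult_left_mono[OF N s2] \<eta> by (simp add: distrib_left)
  then have "\<tau> * x2 \<le> \<tau> * A2 + \<rho> * \<tau> * (2 + x2 + A2) + \<rho> * \<tau>"
    using basic * by (simp add: algebra_simps)
  then have "\<tau> * x2 \<le> \<tau> * (A2 + \<rho> * (2 + x2 + A2) + \<rho>)" by (simp add: algebra_simps)
  then have "x2 \<le> A2 + \<rho> * (2 + x2 + A2) + \<rho>" using \<tau> by simp
  then show "x2 * (1 - \<rho>) \<le> A2 * (1 + \<rho>) + 3 * \<rho>" by (simp add: algebra_simps)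
  have "\<rho> * \<tau> * (2 + x2 + A2) \<le> \<rho> * 1 * (2 + x2 + A2)"
    using \<tau> \<rho> x2 A2 by (intro mult_right_mono mult_left_mono) auto
  moreover have "\<tau> * A2 \<le> \<rho> * A2" using \<tau> A2 by (intro mult_right_mono)
  moreover have "0 \<le> \<tau> * x2" using \<tau> x2 by simp
  ultimately show "s2 * Nb \<le> s2 * N\<beta> + \<rho> * (2 + x2 + A2) + \<rho> * A2"
    using basic * by (simp add: algebra_simps)
qed

section \<open>Population loss and its uniform approximation for the autoregression\<close>

locale ar_setting = white_noise M e s2 \<mu>4 + power_weights lam lamexp c1 c2
  for M :: "'a measure" and e :: "int \<Rightarrow> 'a \<Rightarrow> real" and s2 \<mu>4 :: real
    and lam :: "nat \<Rightarrow> real" and lamexp c1 c2 :: real +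
  fixes Y :: "int \<Rightarrow> 'a \<Rightarrow> real" and phi :: "nat \<Rightarrow> real" and F G :: "real fps" and c g :: real
  assumes s2_pos: "0 < s2" and phi: "inE lam phi"
    and G_def: "G = Abs_fps (ar_coef phi)"
    and FG: "F * G = 1" and F: "l1_le F c" and G: "l1_le G g"
    and Y_measurable [measurable]: "\<And>t. Y t \<in> borel_measurable M"
    and Y_sums: "\<And>t. AE \<omega> in M. (\<lambda>j. fps_nth F j * e (t - int j) \<omega>) sums Y t \<omega>"
begin

text \<open>The population loss at b is s2 * (1 + excess b); the 1 is the share of the innovation,
  which no b can remove.\<close>

definition excess :: "(nat \<Rightarrow> real) \<Rightarrow> real" where
  "excess b = (\<Sum>m. (conv F (coef_diff phi b) m)\<^sup>2)"

lemma summable_coef_diff: "b \<in> EK lam K \<Longrightarrow> summable (\<lambda>k. (coef_diff phi b k)\<^sup>2)"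
  by (rule l2_le_Enorm(1)[OF inE_coef_diff[OF phi]]) (simp_all add: EK_def coef_diff_def)

lemma excess_nonneg: "b \<in> EK lam K \<Longrightarrow> 0 \<le> excess b"
  unfolding excess_def by (intro suminf_nonneg summable_conv_square[OF F] summable_coef_diff) simp_all

text \<open>With d = b - phi the filter of the residual is F * (G - d) = 1 - F * d. As d has no
  constant term, neither has F * d, so squaring the coefficients produces no cross term.\<close>

lemma acov_form_eq:
  assumes b: "b \<in> EK lam K"
  shows "(\<Sum>j\<le>K. \<Sum>k\<le>K. ar_coef b j * ar_coef b k * acov F j k) = s2 * (1 + excess b)"
proof -
  define x where "x = ar_coef b"
  define d where "d = coef_diff phi b"
  have Sx: "(\<Sum>j\<le>K. x j * lag F m j) = conv F x m" for m
  proof -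
    have "(\<Sum>j\<le>K. x j * lag F m j) = (\<Sum>j\<in>{..K} \<inter> {..m}. x j * lag F m j)"
      by (rule sum.mono_neutral_right) (auto simp: lag_def)
    also have "\<dots> = (\<Sum>j\<le>m. x j * lag F m j)"
      by (rule sum.mono_neutral_left) (use b in \<open>auto simp: x_def ar_coef_def EK_iff\<close>)
    finally show ?thesis by (simp only: conv_eq_lag)
  qed
  have x: "Abs_fps x = G - Abs_fps d"
    by (rule fps_ext) (auto simp: x_def d_def G_def ar_coef_def coef_diff_def)
  have cx: "(conv F x m)\<^sup>2 = (if m = 0 then 1 else 0) + (conv F d m)\<^sup>2" for m
  proof -
    have "conv F x m = fps_nth (F * G) m - conv F d m" by (simp add: conv_def x right_diff_distrib)
    then have "conv F x m = (if m = 0 then 1 else 0) - conv F d m" by (simp add: FG)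
    moreover have "conv F d 0 = 0" by (simp add: conv_eq d_def coef_diff_def)
    ultimately show ?thesis by auto
  qed
  have sd: "summable (\<lambda>m. (conv F d m)\<^sup>2)" unfolding d_def by (intro summable_conv_square[OF F] summable_coef_diff[OF b])
  have "(\<Sum>j\<le>K. \<Sum>k\<le>K. x j * x k * acov F j k) = s2 * (\<Sum>j\<le>K. \<Sum>k\<le>K. \<Sum>m. x j * x k * (lag F m j * lag F m k))"
  proof -
    have "x j * x k * acov F j k = s2 * (\<Sum>m. x j * x k * (lag F m j * lag F m k))" for j k
      unfolding acov_def by (subst suminf_mult[OF summable_lag_mult[OF F]]) (simp only: mult_ac)
    then show ?thesis by (simp only: sum_distrib_left)
  qed
  also have "(\<Sum>j\<le>K. \<Sum>k\<le>K. \<Sum>m. x j * x k * (lag F m j * lag F m k)) = (\<Sum>m. \<Sum>j\<le>K. \<Sum>k\<le>K. x j * x k * (lag F m j * lag F m k))"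
    by (simp only: suminf_sum[symmetric] summable_sum summable_mult summable_lag_mult[OF F])
  also have "\<dots> = (\<Sum>m. (conv F x m)\<^sup>2)"
    unfolding Sx[symmetric] power2_eq_square sum_product by (intro suminf_cong sum.cong refl) (simp only: mult_ac)
  also have "\<dots> = (\<Sum>m. (if m = 0 then 1 else 0)) + (\<Sum>m. (conv F d m)\<^sup>2)"
    unfolding cx by (rule suminf_add[symmetric]) (auto intro: sd summable_single)
  also have "(\<Sum>m::nat. (if m = 0 then 1 else 0 :: real)) = 1"
    using sums_single[of 0 "\<lambda>_. 1::real"] by (rule sums_unique[symmetric])
  finally show ?thesis by (simp add: x_def d_def excess_def)
qed

text \<open>Reciprocal norm weights, completed by 1 at index 0, where \<open>ar_coef\<close> is 1:
  rescaling \<open>ar_coef b\<close> by them gives squared length 1 + |b|^2.\<close>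

definition wt :: "nat \<Rightarrow> real" where "wt j = (if j = 0 then 1 else 1 / lam j)"

definition dev :: "nat \<Rightarrow> nat \<Rightarrow> nat \<Rightarrow> 'a \<Rightarrow> real" where
  "dev n j k \<omega> = (1 / real n) * (\<Sum>t=1..n. Y (int t - int j) \<omega> * Y (int t - int k) \<omega>) - acov F j k"

definition dev_square :: "nat \<Rightarrow> nat \<Rightarrow> 'a \<Rightarrow> real" where
  "dev_square n K \<omega> = (\<Sum>j\<le>K. \<Sum>k\<le>K. (wt j * wt k * dev n j k \<omega>)\<^sup>2)"

lemma dev_square_nonneg: "0 \<le> dev_square n K \<omega>"
  unfolding dev_square_def by (intro sum_nonneg) simp

lemma dev_square_measurable [measurable]: "dev_square n K \<in> borel_measurable M"
  unfolding dev_square_def dev_def by measurable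

lemma wt_pos: "0 < wt j"
  using lam_pos[of j] by (simp add: wt_def)

lemma sum_wt_square_le: "(\<Sum>j\<le>K. (wt j)\<^sup>2) \<le> 1 + (\<Sum>k. (1 / lam (Suc k))\<^sup>2)"
  unfolding sum_atMost_head sum_atLeast1_Suc
  using sum_le_suminf[OF summable_inverse_lam_square, of "{..<K}"] by (simp add: wt_def)

text \<open>The weights are square summable, so the sum over all pairs of lags keeps the rate 1 / n
  of a single pair, with a constant that does not depend on K.\<close>

lemma expectation_dev_square_le:
  "\<exists>C\<ge>0. \<forall>n>0. \<forall>K. integrable M (dev_square n K) \<and> expectation (dev_square n K) \<le> C / real n"
proof (intro exI conjI allI impI)
  define W where "W = 1 + (\<Sum>k. (1 / lam (Suc k))\<^sup>2)"
  define C where "C = c ^ 4 * (\<mu>4 + s2\<^sup>2)"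
  have "0 \<le> expectation (\<lambda>\<omega>. e 0 \<omega> ^ 4)" by (rule integral_nonneg_AE) simp
  then have "0 \<le> \<mu>4 + s2\<^sup>2" using fourth[of 0] zero_le_power2[of s2] by argo
  then have C0: "0 \<le> C" using l1_le_nonneg[OF F] by (simp add: C_def)
  then show "0 \<le> W\<^sup>2 * C" by simp
  fix n K :: nat assume n: "0 < n"
  have E: "integrable M (\<lambda>\<omega>. (dev n j k \<omega>)\<^sup>2)" "expectation (\<lambda>\<omega>. (dev n j k \<omega>)\<^sup>2) \<le> C / real n" for j k
    using expectation_sample_acov_le[OF F n Y_measurable Y_sums, of j k]
    unfolding dev_def C_def by simp_all
  have eq: "dev_square n K = (\<lambda>\<omega>. \<Sum>j\<le>K. \<Sum>k\<le>K. (wt j * wt k)\<^sup>2 * (dev n j k \<omega>)\<^sup>2)"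
    by (simp add: dev_square_def fun_eq_iff power_mult_distrib)
  show "integrable M (dev_square n K)"
    unfolding eq by (intro Bochner_Integration.integrable_sum Bochner_Integration.integrable_mult_right E)
  have "expectation (dev_square n K) = (\<Sum>j\<le>K. \<Sum>k\<le>K. (wt j * wt k)\<^sup>2 * expectation (\<lambda>\<omega>. (dev n j k \<omega>)\<^sup>2))"
    unfolding eq by (simp add: Bochner_Integration.integral_sum E(1))
  also have "\<dots> \<le> (\<Sum>j\<le>K. \<Sum>k\<le>K. (wt j * wt k)\<^sup>2 * (C / real n))"
    by (intro sum_mono mult_left_mono E) simp
  also have "\<dots> = (\<Sum>j\<le>K. (wt j)\<^sup>2)\<^sup>2 * (C / real n)"
  proof -
    have "(\<Sum>j\<le>K. (wt j)\<^sup>2)\<^sup>2 = (\<Sum>j\<le>K. \<Sum>k\<le>K. (wt j * wt k)\<^sup>2)"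
      by (simp only: power2_eq_square[of "\<Sum>j\<le>K. (wt j)\<^sup>2"] sum_product power_mult_distrib)
    then show ?thesis by (simp only: sum_distrib_right)
  qed
  also have "\<dots> \<le> W\<^sup>2 * (C / real n)"
    unfolding W_def using C0 by (intro mult_right_mono power_mono sum_wt_square_le sum_nonneg) auto
  finally show "expectation (dev_square n K) \<le> W\<^sup>2 * C / real n" by simp
qed

lemma sample_loss_close:
  assumes b: "b \<in> EK lam K"
  shows "\<bar>(1 / real n) * (\<Sum>t=1..n. (Y (int t) \<omega> - Xt Y K b (int t) \<omega>)\<^sup>2) - s2 * (1 + excess b)\<bar>
    \<le> (1 + (Enorm lam b)\<^sup>2) * sqrt (dev_square n K \<omega>)"
proof -
  have "(1 / real n) * (\<Sum>t=1..n. (Y (int t) \<omega> - Xt Y K b (int t) \<omega>)\<^sup>2) - s2 * (1 + excess b)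
    = (\<Sum>j\<le>K. \<Sum>k\<le>K. ar_coef b j * ar_coef b k * dev n j k \<omega>)"
    unfolding acov_form_eq[OF b, symmetric] sample_loss_eq dev_def
    by (simp only: right_diff_distrib sum_subtractf)
  moreover have "(\<Sum>j\<le>K. (ar_coef b j / wt j)\<^sup>2) = 1 + (Enorm lam b)\<^sup>2"
    unfolding sum_atMost_head Enorm_square_EK[OF b]
    by (simp add: ar_coef_def wt_def mult.commute)
  moreover have "wt j \<noteq> 0" for j using wt_pos[of j] by simp
  ultimately show ?thesis
    using quadratic_form_le[of K wt "ar_coef b" "\<lambda>j k. dev n j k \<omega>"] by (simp add: dev_square_def)
qed

section \<open>Near minimisers of the population loss\<close>

lemma near_minimiser_exists:
  assumes "0 < \<eta>"
  shows "\<exists>b\<in>EK lam K. \<forall>b'\<in>EK lam K. excess b \<le> excess b' + \<eta>"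
proof -
  have bdd: "bdd_below (excess ` EK lam K)" using excess_nonneg by (intro bdd_belowI2[of _ 0]) auto
  have ne: "EK lam K \<noteq> {}" using rat_seq_EK by blast
  have "Inf (excess ` EK lam K) < Inf (excess ` EK lam K) + \<eta>" using assms by simp
  then obtain b where "b \<in> EK lam K" "excess b < Inf (excess ` EK lam K) + \<eta>"
    using cInf_less_iff[OF _ bdd] ne by blast
  moreover have "Inf (excess ` EK lam K) \<le> excess b'" if "b' \<in> EK lam K" for b'
    by (rule cINF_lower[OF bdd that])
  ultimately show ?thesis by force
qed

lemma near_minimiser_sequence:
  assumes K: "filterlim K at_top sequentially"
  shows "\<exists>\<beta>. (\<forall>n. \<beta> n \<in> EK lam (K n)) \<and>
    (\<forall>n. \<forall>b\<in>EK lam (K n). excess (\<beta> n) \<le> excess b + 1 / real (Suc n)) \<and>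
    (\<lambda>n. (Enorm lam (\<lambda>k. \<beta> n k - phi k))\<^sup>2) \<longlonglongrightarrow> 0"
proof -
  \<comment> \<open>The slack meets two demands: multiplied by K^(2 lamexp) it still tends to 0, for
    convergence in the weighted norm, and it is at most 1 / (n + 1), hence o(tau). The
    \<open>max\<close> covers K n = 0.\<close>
  define \<eta> where "\<eta> = (\<lambda>n. 1 / real (Suc n) / real (max 1 (K n)) powr (2 * lamexp))"
  have \<eta>: "0 < \<eta> n" for n by (simp add: \<eta>_def)
  have \<eta>_le: "\<eta> n \<le> 1 / real (Suc n)" for n
  proof -
    have "1 \<le> real (max 1 (K n)) powr (2 * lamexp)" using lamexp by (intro ge_one_powr_ge_zero) auto
    then have "1 / real (Suc n) / real (max 1 (K n)) powr (2 * lamexp) \<le> 1 / real (Suc n) / 1"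
      by (intro divide_left_mono) auto
    then show ?thesis by (simp add: \<eta>_def)
  qed
  have "\<forall>n. \<exists>b. b \<in> EK lam (K n) \<and> (\<forall>b'\<in>EK lam (K n). excess b \<le> excess b' + \<eta> n)"
    using near_minimiser_exists[OF \<eta>] by blast
  then obtain \<beta> where \<beta>: "\<And>n. \<beta> n \<in> EK lam (K n)"
    "\<And>n b'. b' \<in> EK lam (K n) \<Longrightarrow> excess (\<beta> n) \<le> excess b' + \<eta> n"
    unfolding choice_iff by blast
  define h where "h = (\<lambda>n. c2\<^sup>2 * g\<^sup>2 * (c\<^sup>2 / c1\<^sup>2 * tail phi (K n) + 1 / real (Suc n)) + tail phi (K n))"
  have "(\<lambda>m. tail phi m) \<longlonglongrightarrow> 0"
    using suminf_exist_split[OF _ phi[unfolded inE_def]] unfolding LIMSEQ_iff tail_def by simp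
  then have T: "(\<lambda>n. tail phi (K n)) \<longlonglongrightarrow> 0" by (rule filterlim_compose[OF _ K])
  have "h \<longlonglongrightarrow> c2\<^sup>2 * g\<^sup>2 * (c\<^sup>2 / c1\<^sup>2 * 0 + 0) + 0"
    unfolding h_def by (intro tendsto_intros T lim_1_over_n[THEN LIMSEQ_Suc])
  then have h: "h \<longlonglongrightarrow> 0" by simp
  have "eventually (\<lambda>n. 1 \<le> K n) sequentially" using K by (simp add: filterlim_at_top)
  then have "eventually (\<lambda>n. norm ((Enorm lam (\<lambda>k. \<beta> n k - phi k))\<^sup>2) \<le> h n) sequentially"
  proof eventually_elim
    case (elim n)
    have "(Enorm lam (\<lambda>k. \<beta> n k - phi k))\<^sup>2 \<le>
      c2\<^sup>2 * g\<^sup>2 * (c\<^sup>2 / c1\<^sup>2 * tail phi (K n) + real (K n) powr (2 * lamexp) * \<eta> n) + tail phi (K n)"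
      by (rule near_minimiser_bound[OF FG F G phi elim \<beta>(1)]) (rule \<beta>(2)[unfolded excess_def])
    also have "real (K n) powr (2 * lamexp) * \<eta> n = 1 / real (Suc n)" using elim by (simp add: \<eta>_def max_def)
    finally show ?case by (simp add: h_def)
  qed
  then have "(\<lambda>n. (Enorm lam (\<lambda>k. \<beta> n k - phi k))\<^sup>2) \<longlonglongrightarrow> 0" by (rule Lim_null_comparison) (rule h)
  moreover have "excess (\<beta> n) \<le> excess b + 1 / real (Suc n)" if "b \<in> EK lam (K n)" for n b
    using \<beta>(2)[OF that] \<eta>_le[of n] by linarith
  ultimately show ?thesis using \<beta>(1) by blast
qed

lemma excess_le_Enorm:
  assumes b: "b \<in> EK lam K"
  shows "excess b \<le> c\<^sup>2 / c1\<^sup>2 * (Enorm lam (\<lambda>k. b k - phi k))\<^sup>2"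
proof -
  have "excess b \<le> c\<^sup>2 * (\<Sum>k. (coef_diff phi b k)\<^sup>2)"
    unfolding excess_def by (rule suminf_conv_square_le[OF F summable_coef_diff[OF b]])
  also have "\<dots> \<le> c\<^sup>2 * ((Enorm lam (coef_diff phi b))\<^sup>2 / c1\<^sup>2)"
    using b by (intro mult_left_mono l2_le_Enorm(2) inE_coef_diff phi) (simp_all add: EK_def coef_diff_def)
  finally show ?thesis by (simp add: Enorm_coef_diff)
qed

lemma coef_square_le_excess:
  assumes b: "b \<in> EK lam K" and k: "1 \<le> k"
  shows "(b k - phi k)\<^sup>2 \<le> g\<^sup>2 * excess b"
proof -
  have "(b k - phi k)\<^sup>2 = (\<Sum>i\<in>{k}. (coef_diff phi b i)\<^sup>2)" using k by (simp add: coef_diff_def)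
  also have "\<dots> \<le> (\<Sum>i. (coef_diff phi b i)\<^sup>2)" by (rule sum_le_suminf[OF summable_coef_diff[OF b]]) auto
  also have "\<dots> \<le> g\<^sup>2 * excess b" unfolding excess_def by (rule l2_le_conv[OF FG F G summable_coef_diff[OF b]])
  finally show ?thesis .
qed

text \<open>Young's inequality with parameter \<rho>. The factor of |phi|^2 must tend to 1: the
  cruder factor 2 would lose the sharp bound limsup |b| \<le> |phi|.\<close>

lemma Enorm_square_le_perturbed:
  assumes b: "b \<in> EK lam K" and \<rho>: "0 < \<rho>"
  shows "(Enorm lam b)\<^sup>2 \<le> (1 + \<rho>) * (Enorm lam phi)\<^sup>2 + (1 + 1 / \<rho>) * (Enorm lam (\<lambda>k. b k - phi k))\<^sup>2"
proof -
  have bE: "inE lam b" using b by (simp add: EK_def)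
  have dE: "inE lam (\<lambda>k. b k - phi k)" by (rule inE_diff[OF bE phi])
  note [simp] = Enorm_square[OF bE] Enorm_square[OF dE] Enorm_square[OF phi]
  note sb = bE[unfolded inE_def] and sd = dE[unfolded inE_def] and sp = phi[unfolded inE_def]
  have "(\<Sum>k. (lam (Suc k) * b (Suc k))\<^sup>2) \<le>
    (\<Sum>k. (1 + \<rho>) * (lam (Suc k) * phi (Suc k))\<^sup>2 + (1 + 1 / \<rho>) * (lam (Suc k) * (b (Suc k) - phi (Suc k)))\<^sup>2)"
  proof (rule suminf_le[OF _ sb])
    show "summable (\<lambda>k. (1 + \<rho>) * (lam (Suc k) * phi (Suc k))\<^sup>2 + (1 + 1 / \<rho>) * (lam (Suc k) * (b (Suc k) - phi (Suc k)))\<^sup>2)"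
      by (intro summable_add summable_mult sp sd)
    fix k
    have "(v + w)\<^sup>2 \<le> (1 + \<rho>) * v\<^sup>2 + (1 + 1 / \<rho>) * w\<^sup>2" for v w :: real
    proof -
      have "(1 + \<rho>) * v\<^sup>2 + (1 + 1 / \<rho>) * w\<^sup>2 - (v + w)\<^sup>2 = (\<rho> * v - w)\<^sup>2 / \<rho>"
        using \<rho> by (simp add: field_simps power2_eq_square)
      also have "\<dots> \<ge> 0" using \<rho> by simp
      finally show ?thesis by simp
    qed
    from this[of "lam (Suc k) * phi (Suc k)" "lam (Suc k) * (b (Suc k) - phi (Suc k))"]
    show "(lam (Suc k) * b (Suc k))\<^sup>2 \<le> (1 + \<rho>) * (lam (Suc k) * phi (Suc k))\<^sup>2 + (1 + 1 / \<rho>) * (lam (Suc k) * (b (Suc k) - phi (Suc k)))\<^sup>2"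
      by (simp only: distrib_left[symmetric] add_diff_inverse diff_add_eq_diff_diff_swap add_diff_cancel_left' add_diff_eq)
  qed
  also have "\<dots> = (1 + \<rho>) * (\<Sum>k. (lam (Suc k) * phi (Suc k))\<^sup>2) + (1 + 1 / \<rho>) * (\<Sum>k. (lam (Suc k) * (b (Suc k) - phi (Suc k)))\<^sup>2)"
    by (simp only: suminf_add[symmetric] suminf_mult summable_mult sp sd)
  finally show ?thesis by simp
qed

text \<open>The deterministic core: for large n the conclusion holds for every \<omega> and every
  \<tau> satisfying the stated inequalities, so a random \<open>tau\<close> can be inserted path by
  path.\<close>

lemma estimator_close:
  assumes K: "filterlim K at_top sequentially" and r: "0 < r"
  shows "\<exists>\<rho>>0. \<forall>\<^sub>F n in sequentially. \<forall>\<omega> \<tau>. 0 < \<tau> \<longrightarrow> \<tau> \<le> \<rho> \<longrightarrow> 1 < \<tau> * sqrt (real n) \<longrightarrow>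
    sqrt (dev_square n (K n) \<omega>) \<le> \<rho> * \<tau> \<longrightarrow>
    (Enorm lam (pen_est lam Y (K n) n \<tau> \<omega>))\<^sup>2 \<le> (Enorm lam phi)\<^sup>2 + r \<and>
    (\<forall>k\<ge>1. (pen_est lam Y (K n) n \<tau> \<omega> k - phi k)\<^sup>2 \<le> r)"
proof -
  define P where "P = (Enorm lam phi)\<^sup>2"
  \<comment> \<open>Bounds in terms of \<rho>: \<open>h0\<close> for the squared norm of the near
    minimiser, \<open>h1\<close> for that of the estimator, \<open>h2\<close> for the squared l2
    error. As \<rho> tends to 0 they tend to P, P and 0.\<close>
  define h0 where "h0 = (\<lambda>\<rho>. (1 + \<rho>) * P + \<rho>)"
  define h1 where "h1 = (\<lambda>\<rho>. (h0 \<rho> * (1 + \<rho>) + 3 * \<rho>) / (1 - \<rho>))"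
  define h2 where "h2 = (\<lambda>\<rho>. g\<^sup>2 * ((\<rho> + \<rho> * (2 + h1 \<rho> + h0 \<rho>) + \<rho> * h0 \<rho>) / s2))"
  have l0: "(h0 \<longlongrightarrow> (1 + 0) * P + 0) (at_right 0)" unfolding h0_def by (intro tendsto_intros)
  have l1: "(h1 \<longlongrightarrow> (((1 + 0) * P + 0) * (1 + 0) + 3 * 0) / (1 - 0)) (at_right 0)"
    unfolding h1_def by (intro tendsto_intros l0) simp
  have l2: "(h2 \<longlongrightarrow> g\<^sup>2 * ((0 + 0 * (2 + (((1 + 0) * P + 0) * (1 + 0) + 3 * 0) / (1 - 0) + ((1 + 0) * P + 0)) + 0 * ((1 + 0) * P + 0)) / s2)) (at_right 0)"
    unfolding h2_def by (intro tendsto_intros l0 l1) (use s2_pos in simp)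
  have "\<forall>\<^sub>F \<rho> in at_right 0. h1 \<rho> < P + r" using l1 by (rule order_tendstoD) (use r in simp)
  moreover have "\<forall>\<^sub>F \<rho> in at_right 0. h2 \<rho> < r" using l2 by (rule order_tendstoD) (use r in simp)
  moreover have "\<forall>\<^sub>F \<rho> in at_right (0::real). \<rho> < 1"
    using tendsto_ident_at by (rule order_tendstoD) simp
  ultimately have "\<forall>\<^sub>F \<rho> in at_right 0. (h1 \<rho> < P + r \<and> h2 \<rho> < r \<and> \<rho> < 1) \<and> 0 < \<rho>"
    by (intro eventually_conj eventually_at_right_less)
  then obtain \<rho> where \<rho>: "h1 \<rho> < P + r" "h2 \<rho> < r" "\<rho> < 1" "0 < \<rho>"
    using eventually_happens'[OF trivial_limit_at_right_real] by blast
  from near_minimiser_sequence[OF K] obtain \<beta> where \<beta>': "\<forall>n. \<beta> n \<in> EK lam (K n)"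
    "\<forall>n. \<forall>b\<in>EK lam (K n). excess (\<beta> n) \<le> excess b + 1 / real (Suc n)"
    "(\<lambda>n. (Enorm lam (\<lambda>k. \<beta> n k - phi k))\<^sup>2) \<longlonglongrightarrow> 0"
    by (elim exE conjE)
  note \<beta> = \<beta>'(1)[rule_format] \<beta>'(2)[rule_format] \<beta>'(3)
  define a where "a = (\<lambda>n. (Enorm lam (\<lambda>k. \<beta> n k - phi k))\<^sup>2)"
  have a0: "a \<longlonglongrightarrow> 0" using \<beta>(3) by (simp add: a_def)
  have "(\<lambda>n. (1 + 1 / \<rho>) * a n) \<longlonglongrightarrow> (1 + 1 / \<rho>) * 0" by (intro tendsto_intros a0)
  then have "\<forall>\<^sub>F n in sequentially. (1 + 1 / \<rho>) * a n < \<rho>" by (rule order_tendstoD) (use \<rho> in simp)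
  moreover have "(\<lambda>n. s2 * (c\<^sup>2 / c1\<^sup>2 * a n)) \<longlonglongrightarrow> s2 * (c\<^sup>2 / c1\<^sup>2 * 0)" by (intro tendsto_intros a0)
  then have "\<forall>\<^sub>F n in sequentially. s2 * (c\<^sup>2 / c1\<^sup>2 * a n) < \<rho>" by (rule order_tendstoD) (use \<rho> in simp)
  moreover have "(\<lambda>n. s2 / sqrt (real n)) \<longlonglongrightarrow> 0" by real_asymp
  then have "\<forall>\<^sub>F n in sequentially. s2 / sqrt (real n) < \<rho>" by (rule order_tendstoD) (use \<rho> in simp)
  ultimately have "\<forall>\<^sub>F n in sequentially. \<forall>\<omega> \<tau>. 0 < \<tau> \<longrightarrow> \<tau> \<le> \<rho> \<longrightarrow> 1 < \<tau> * sqrt (real n) \<longrightarrow>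
    sqrt (dev_square n (K n) \<omega>) \<le> \<rho> * \<tau> \<longrightarrow>
    (Enorm lam (pen_est lam Y (K n) n \<tau> \<omega>))\<^sup>2 \<le> (Enorm lam phi)\<^sup>2 + r \<and>
    (\<forall>k\<ge>1. (pen_est lam Y (K n) n \<tau> \<omega> k - phi k)\<^sup>2 \<le> r)"
  proof eventually_elim
    case (elim n)
    show ?case
    proof (intro allI impI)
      fix \<omega> \<tau> assume \<tau>: "0 < \<tau>" "\<tau> \<le> \<rho>" "1 < \<tau> * sqrt (real n)"
        and D: "sqrt (dev_square n (K n) \<omega>) \<le> \<rho> * \<tau>"
      define b where "b = pen_est lam Y (K n) n \<tau> \<omega>"
      define D' where "D' = sqrt (dev_square n (K n) \<omega>)"
      define L where "L = (\<lambda>b. (1 / real n) * (\<Sum>t=1..n. (Y (int t) \<omega> - Xt Y (K n) b (int t) \<omega>)\<^sup>2))"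
      have bK: "b \<in> EK lam (K n)" unfolding b_def by (rule pen_est_EK[OF \<tau>(1) lam_pos])
      have "pen_obj lam Y (K n) n \<tau> \<omega> b \<le> pen_obj lam Y (K n) n \<tau> \<omega> (\<beta> n)"
        unfolding b_def by (rule pen_est_le[OF \<tau>(1) lam_pos \<beta>(1)])
      then have obj: "L b + \<tau> * (Enorm lam b)\<^sup>2 \<le> L (\<beta> n) + \<tau> * (Enorm lam (\<beta> n))\<^sup>2"
        unfolding pen_obj_def L_def .
      have close: "\<bar>L b - s2 * (1 + excess b)\<bar> \<le> (1 + (Enorm lam b)\<^sup>2) * D'" if "b \<in> EK lam (K n)" for b
        unfolding L_def D'_def by (rule sample_loss_close[OF that])
      have basic: "\<tau> * (Enorm lam b)\<^sup>2 + s2 * (1 + excess b) - D' * (1 + (Enorm lam b)\<^sup>2)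
          \<le> \<tau> * (Enorm lam (\<beta> n))\<^sup>2 + s2 * (1 + excess (\<beta> n)) + D' * (1 + (Enorm lam (\<beta> n))\<^sup>2)"
        using obj close[OF bK] close[OF \<beta>(1)[of n]]
        unfolding mult.commute[of D'] abs_le_iff by argo
      have n: "0 < n" using \<tau> by (cases n) auto
      \<comment> \<open>One factor 1 / sqrt n is made small by taking n large, the other is below
        \<tau>; this is how the slack becomes o(\<tau>).\<close>
      have "s2 * (1 / real (Suc n)) \<le> s2 / sqrt (real n) / sqrt (real n)"
        using n s2_pos by (simp add: divide_left_mono)
      also have "\<dots> \<le> \<rho> / sqrt (real n)" using elim(3) n by (intro divide_right_mono) auto
      also have "\<dots> \<le> \<rho> * \<tau>" using \<tau>(3) n \<rho>(4) by (simp add: pos_divide_le_eq mult.assoc)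
      finally have \<eta>: "s2 * (1 / real (Suc n)) \<le> \<rho> * \<tau>" .
      have D'0: "0 \<le> D'" by (simp add: D'_def dev_square_nonneg)
      have D'1: "D' \<le> \<rho> * \<tau>" using D by (simp add: D'_def)
      note bounds = penalised_minimiser_bounds[OF \<tau>(1,2) \<rho>(3) D'0 D'1 zero_le_power2 zero_le_power2 less_imp_le[OF s2_pos] \<beta>(2)[OF bK] \<eta> basic]
      have A: "(Enorm lam (\<beta> n))\<^sup>2 \<le> h0 \<rho>"
        using Enorm_square_le_perturbed[OF \<beta>(1)[of n] \<rho>(4)] elim(1) unfolding h0_def P_def a_def by argo
      have "(Enorm lam b)\<^sup>2 * (1 - \<rho>) \<le> h0 \<rho> * (1 + \<rho>) + 3 * \<rho>"
        using order_trans[OF bounds(1) add_right_mono[OF mult_right_mono[OF A]]] \<rho>(4) by simp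
      then have x2: "(Enorm lam b)\<^sup>2 \<le> h1 \<rho>" using \<rho>(3) by (simp add: h1_def pos_le_divide_eq)
      have "s2 * excess (\<beta> n) \<le> s2 * (c\<^sup>2 / c1\<^sup>2 * a n)"
        unfolding a_def using s2_pos by (intro mult_left_mono excess_le_Enorm[OF \<beta>(1)]) simp
      then have N\<beta>: "s2 * excess (\<beta> n) \<le> \<rho>" using elim(2) by simp
      have X: "\<rho> * (2 + (Enorm lam b)\<^sup>2 + (Enorm lam (\<beta> n))\<^sup>2) \<le> \<rho> * (2 + h1 \<rho> + h0 \<rho>)"
        using x2 A \<rho>(4) by (intro mult_left_mono) auto
      have Z: "\<rho> * (Enorm lam (\<beta> n))\<^sup>2 \<le> \<rho> * h0 \<rho>" using A \<rho>(4) by simp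
      have "s2 * excess b \<le> \<rho> + \<rho> * (2 + h1 \<rho> + h0 \<rho>) + \<rho> * h0 \<rho>"
        by (rule order_trans[OF bounds(2) add_mono[OF add_mono[OF N\<beta> X] Z]])
      then have "excess b \<le> (\<rho> + \<rho> * (2 + h1 \<rho> + h0 \<rho>) + \<rho> * h0 \<rho>) / s2"
        using s2_pos by (simp add: pos_le_divide_eq mult.commute)
      then have "g\<^sup>2 * excess b \<le> h2 \<rho>" unfolding h2_def by (rule mult_left_mono) simp
      then have "\<forall>k\<ge>1. (b k - phi k)\<^sup>2 \<le> r" using coef_square_le_excess[OF bK] \<rho>(2) by force
      moreover have "(Enorm lam b)\<^sup>2 \<le> (Enorm lam phi)\<^sup>2 + r" using x2 \<rho>(1) by (simp add: P_def)
      ultimately show "(Enorm lam (pen_est lam Y (K n) n \<tau> \<omega>))\<^sup>2 \<le> (Enorm lam phi)\<^sup>2 + r \<and>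
        (\<forall>k\<ge>1. (pen_est lam Y (K n) n \<tau> \<omega> k - phi k)\<^sup>2 \<le> r)" by (simp add: b_def)
    qed
  qed
  with \<rho>(4) show ?thesis by blast
qed

text \<open>\<open>tau\<close> may depend on the sample, so the deviation is first compared with the
  deterministic level L / sqrt n by Markov's inequality; outside a small event \<open>tau\<close>
  exceeds that level.\<close>

lemma prob_good_event:
  fixes tau :: "nat \<Rightarrow> 'a \<Rightarrow> real"
  assumes [measurable]: "\<And>n. tau n \<in> borel_measurable M"
    and tau0: "\<And>\<epsilon>. 0 < \<epsilon> \<Longrightarrow> (\<lambda>n. prob {\<omega> \<in> space M. \<epsilon> < \<bar>tau n \<omega>\<bar>}) \<longlonglongrightarrow> 0"
    and tau_sqrt: "\<And>C. (\<lambda>n. prob {\<omega> \<in> space M. tau n \<omega> * sqrt (real n) \<le> C}) \<longlonglongrightarrow> 0"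
    and \<rho>: "0 < \<rho>" and \<epsilon>: "0 < \<epsilon>"
  shows "\<forall>\<^sub>F n in sequentially. prob {\<omega> \<in> space M. \<not> (tau n \<omega> \<le> \<rho> \<and> 1 < tau n \<omega> * sqrt (real n) \<and>
    sqrt (dev_square n (K n) \<omega>) \<le> \<rho> * tau n \<omega>)} < \<epsilon>"
proof -
  obtain C where C: "0 \<le> C" "\<And>n K. 0 < n \<Longrightarrow> integrable M (dev_square n K)"
    "\<And>n K. 0 < n \<Longrightarrow> expectation (dev_square n K) \<le> C / real n"
    using expectation_dev_square_le by blast
  \<comment> \<open>Large enough that Markov's inequality leaves less than \<epsilon> / 3. The
    summand 1 makes that strict and ensures L \<ge> 1, so that L is at most its square and the
    requirement 1 < tau * sqrt n is covered too.\<close>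
  define L where "L = 1 + 3 * C / (\<epsilon> * \<rho>\<^sup>2)"
  have L1: "1 \<le> L" using C(1) \<rho> \<epsilon> by (simp add: L_def)
  have CL: "C / (\<rho>\<^sup>2 * L\<^sup>2) < \<epsilon> / 3"
  proof -
    have "3 * C < \<epsilon> * \<rho>\<^sup>2 * L" using \<rho> \<epsilon> by (simp add: L_def distrib_left)
    also have "\<dots> \<le> \<epsilon> * \<rho>\<^sup>2 * L\<^sup>2"
      using L1 \<rho> \<epsilon> self_le_power[of L 2] by (intro mult_left_mono) auto
    finally show ?thesis using \<rho> L1 by (simp add: pos_divide_less_eq mult_ac)
  qed
  have "\<forall>\<^sub>F n in sequentially. prob {\<omega> \<in> space M. \<rho> < \<bar>tau n \<omega>\<bar>} < \<epsilon> / 3"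
    using tau0[OF \<rho>] by (rule order_tendstoD) (use \<epsilon> in simp)
  moreover have "\<forall>\<^sub>F n in sequentially. prob {\<omega> \<in> space M. tau n \<omega> * sqrt (real n) \<le> L} < \<epsilon> / 3"
    using tau_sqrt[of L] by (rule order_tendstoD) (use \<epsilon> in simp)
  moreover have "\<forall>\<^sub>F n in sequentially. 0 < n" by (rule eventually_gt_at_top)
  ultimately show ?thesis
  proof eventually_elim
    case (elim n)
    let ?A = "{\<omega> \<in> space M. \<rho> < \<bar>tau n \<omega>\<bar>}"
    let ?B = "{\<omega> \<in> space M. tau n \<omega> * sqrt (real n) \<le> L}"
    let ?C = "{\<omega> \<in> space M. \<rho>\<^sup>2 * L\<^sup>2 / real n \<le> dev_square n (K n) \<omega>}"
    have pos: "0 < \<rho>\<^sup>2 * L\<^sup>2 / real n" using \<rho> L1 elim(3) by simp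
    have "prob ?C \<le> expectation (dev_square n (K n)) / (\<rho>\<^sup>2 * L\<^sup>2 / real n)"
      using pos by (intro integral_Markov_inequality_measure[where A = "space M"] C(2) elim(3)) (auto simp: dev_square_nonneg)
    also have "\<dots> \<le> (C / real n) / (\<rho>\<^sup>2 * L\<^sup>2 / real n)"
      using pos by (intro divide_right_mono C(3) elim(3)) simp
    also have "\<dots> < \<epsilon> / 3" using CL elim(3) by simp
    finally have pC: "prob ?C < \<epsilon> / 3" .
    have "{\<omega> \<in> space M. \<not> (tau n \<omega> \<le> \<rho> \<and> 1 < tau n \<omega> * sqrt (real n) \<and> sqrt (dev_square n (K n) \<omega>) \<le> \<rho> * tau n \<omega>)} \<subseteq> ?A \<union> ?B \<union> ?C"
    proof (rule subsetI, rule ccontr)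
      fix \<omega> assume w: "\<omega> \<in> {\<omega> \<in> space M. \<not> (tau n \<omega> \<le> \<rho> \<and> 1 < tau n \<omega> * sqrt (real n) \<and> sqrt (dev_square n (K n) \<omega>) \<le> \<rho> * tau n \<omega>)}"
        and "\<omega> \<notin> ?A \<union> ?B \<union> ?C"
      then have *: "\<bar>tau n \<omega>\<bar> \<le> \<rho>" "L < tau n \<omega> * sqrt (real n)" "dev_square n (K n) \<omega> < \<rho>\<^sup>2 * L\<^sup>2 / real n"
        by auto
      have "sqrt (dev_square n (K n) \<omega>) \<le> sqrt (\<rho>\<^sup>2 * L\<^sup>2 / real n)" using *(3) by simp
      also have "\<dots> = \<rho> * (L / sqrt (real n))" using \<rho> L1 by (simp add: real_sqrt_divide real_sqrt_mult)
      also have "\<dots> \<le> \<rho> * tau n \<omega>" using *(2) \<rho> elim(3) by (intro mult_left_mono) (auto simp: pos_divide_le_eq)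
      finally show False using w * L1 by auto
    qed
    then have "prob {\<omega> \<in> space M. \<not> (tau n \<omega> \<le> \<rho> \<and> 1 < tau n \<omega> * sqrt (real n) \<and> sqrt (dev_square n (K n) \<omega>) \<le> \<rho> * tau n \<omega>)} \<le> prob (?A \<union> ?B \<union> ?C)"
      by (intro finite_measure_mono) measurable
    also have "\<dots> \<le> prob ?A + prob ?B + prob ?C"
      by (rule order_trans[OF measure_Un_le add_right_mono[OF measure_Un_le]]) measurable
    also have "\<dots> < \<epsilon>" using elim(1,2) pC by argo
    finally show ?case .
  qed
qed

end

section \<open>Consistency\<close>

lemma (in prob_space) prob_tendsto_1I:
  assumes A: "\<And>n. A n \<in> events"
    and small: "\<And>\<epsilon>. 0 < \<epsilon> \<Longrightarrow> \<forall>\<^sub>F n in sequentially. prob (B n) < \<epsilon>"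
    and B: "\<forall>\<^sub>F n in sequentially. B n \<in> events \<and> space M - A n \<subseteq> B n"
  shows "(\<lambda>n. prob (A n)) \<longlonglongrightarrow> 1"
proof (rule LIMSEQ_I)
  fix \<epsilon> :: real assume "0 < \<epsilon>"
  from small[OF this] B have "\<forall>\<^sub>F n in sequentially. norm (prob (A n) - 1) < \<epsilon>"
  proof eventually_elim
    case (elim n)
    have "1 - prob (A n) = prob (space M - A n)" using A[of n] by (simp add: prob_compl)
    also have "\<dots> \<le> prob (B n)" using elim(2) by (intro finite_measure_mono) auto
    finally show ?case using elim(1) prob_le_1[of "A n"] by simp
  qed
  then show "\<exists>N. \<forall>n\<ge>N. norm (prob (A n) - 1) < \<epsilon>" by (simp add: eventually_sequentially)
qed

lemma borel_measurable_past_sigma: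
  assumes "\<And>s. eps s \<in> borel_measurable M" and Y: "Y \<in> borel_measurable (past_sigma M eps t)"
  shows "Y \<in> borel_measurable M"
proof -
  let ?\<G> = "\<Union>s\<in>{..t}. {eps s -` A \<inter> space M |A. A \<in> sets borel}"
  have G: "?\<G> \<subseteq> sets M" using assms(1) by (auto intro: measurable_sets)
  have "?\<G> \<subseteq> Pow (space M)" by auto
  then have "space (past_sigma M eps t) = space M" "sets (past_sigma M eps t) = sigma_sets (space M) ?\<G>"
    unfolding past_sigma_def by (simp_all add: space_measure_of sets_measure_of)
  moreover have "sigma_sets (space M) ?\<G> \<subseteq> sets M" by (rule sets.sigma_sets_subset[OF G])
  ultimately show ?thesis using Y by (auto simp: measurable_def)
qed

theorem theorem1:
  fixes M :: "'a measure"
    and eps Y :: "int \<Rightarrow> 'a \<Rightarrow> real"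
    and sigma2 lamexp c1 c2 :: real
    and lam phi :: "nat \<Rightarrow> real"
    and K :: "nat \<Rightarrow> nat"
    and tau :: "nat \<Rightarrow> 'a \<Rightarrow> real"
  assumes P: "prob_space M"
    \<comment> \<open>i.i.d. innovations, mean 0, variance sigma2 in (0,oo), finite fourth moment\<close>
    and eps_indep: "prob_space.indep_vars M (\<lambda>_. borel) eps UNIV"
    and eps_ident: "\<And>t. distr M borel (eps t) = distr M borel (eps 0)"
    and eps_int: "\<And>t. integrable M (eps t)"
    and eps_mean: "\<And>t. integral\<^sup>L M (eps t) = 0"
    and eps_int2: "\<And>t. integrable M (\<lambda>\<omega>. (eps t \<omega>)^2)"
    and eps_var: "\<And>t. integral\<^sup>L M (\<lambda>\<omega>. (eps t \<omega>)^2) = sigma2"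
    and sigma2_pos: "0 < sigma2"
    and eps_int4: "\<And>t. integrable M (\<lambda>\<omega>. (eps t \<omega>)^4)"
    \<comment> \<open>weights lambda_k\<close>
    and lamexp: "1/2 < lamexp"
    and c1: "0 < c1" and c12: "c1 \<le> c2"
    and lam_bounds: "\<And>k. 1 \<le> k \<Longrightarrow>
        c1 * real k powr lamexp \<le> lam k \<and> lam k \<le> c2 * real k powr lamexp"
    \<comment> \<open>Condition 1\<close>
    and phi_E: "inE lam phi"
    and phi_root: "\<And>z::complex. cmod z \<le> 1 \<Longrightarrow>
        1 - (\<Sum>k. complex_of_real (phi (Suc k)) * z ^ Suc k) \<noteq> 0"
    and Y_causal: "\<And>t. Y t \<in> borel_measurable (past_sigma M eps t)"
    and Y_L2: "\<exists>C. \<forall>t. integrable M (\<lambda>\<omega>. (Y t \<omega>)^2) \<and> integral\<^sup>L M (\<lambda>\<omega>. (Y t \<omega>)^2) \<le> C"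
    and Y_AR: "\<And>t. AE \<omega> in M. (\<lambda>k. phi (Suc k) * Y (t - int (Suc k)) \<omega>) sums (Y t \<omega> - eps t \<omega>)"
    \<comment> \<open>asymptotic regime\<close>
    and K_lim: "filterlim K at_top sequentially"
    and tau_meas: "\<And>n. tau n \<in> borel_measurable M"
    and tau_pos: "\<And>n \<omega>. \<omega> \<in> space M \<Longrightarrow> 0 < tau n \<omega>"
    and tau_to_0: "\<And>e. 0 < e \<Longrightarrow>
        (\<lambda>n. measure M {\<omega> \<in> space M. e < \<bar>tau n \<omega>\<bar>}) \<longlonglongrightarrow> 0"
    and tau_sqrt_n: "\<And>C. (\<lambda>n. measure M {\<omega> \<in> space M. tau n \<omega> * sqrt (real n) \<le> C}) \<longlonglongrightarrow> 0"
  shows "\<exists>B. Enorm lam phi < B \<and>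
     (\<lambda>n. measure M {\<omega> \<in> space M. Enorm lam (pen_est lam Y (K n) n (tau n \<omega>) \<omega>) < B})
        \<longlonglongrightarrow> 1 \<and>
     (\<forall>e>0. (\<lambda>n. measure M {\<omega> \<in> space M.
        Enorm lam (\<lambda>k. pen_est lam Y (K n) n (tau n \<omega>) \<omega> k - phi k) \<le> e}) \<longlonglongrightarrow> 1)"
proof -
  interpret prob_space M by (rule P)
  have eps_meas [measurable]: "eps t \<in> borel_measurable M" for t
    using eps_indep by (auto simp: indep_vars_def)
  have Y_meas [measurable]: "Y t \<in> borel_measurable M" for t
    by (rule borel_measurable_past_sigma[OF eps_meas Y_causal])
  have fourth: "expectation (\<lambda>\<omega>. eps t \<omega> ^ 4) = expectation (\<lambda>\<omega>. eps 0 \<omega> ^ 4)" for t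
  proof -
    have "expectation (\<lambda>\<omega>. eps s \<omega> ^ 4) = integral\<^sup>L (distr M borel (eps s)) (\<lambda>x. x ^ 4)" for s
      by (rule integral_distr[symmetric]) simp_all
    then show ?thesis using eps_ident[of t] by simp
  qed
  interpret white_noise M eps sigma2 "expectation (\<lambda>\<omega>. eps 0 \<omega> ^ 4)"
    by unfold_locales (fact eps_indep eps_int4 eps_mean eps_var order_eq_refl[OF fourth])+
  interpret power_weights lam lamexp c1 c2
    by unfold_locales (fact lamexp c1 lam_bounds)+
  define G where "G = Abs_fps (ar_coef phi)"
  have G_nth: "fps_nth G 0 = 1" "fps_nth G (Suc k) = - phi (Suc k)" for k by (simp_all add: G_def ar_coef_def)
  have sG: "summable (\<lambda>k. norm (fps_nth G k))"
    using inE_summable_abs[OF phi_E] by (subst summable_Suc_iff[symmetric]) (simp add: G_nth)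
  have "(\<Sum>k. complex_of_real (fps_nth G k) * z ^ k) \<noteq> 0" if z: "cmod z \<le> 1" for z
  proof -
    have "summable (\<lambda>k. complex_of_real (fps_nth G k) * z ^ k)"
    proof (rule summable_norm_cancel, rule summable_comparison_test'[OF sG])
      show "norm (norm (complex_of_real (fps_nth G k) * z ^ k)) \<le> norm (fps_nth G k)" for k
        using z by (simp add: norm_mult norm_power mult_left_le power_le_one)
    qed
    from suminf_split_head[OF this]
    have s: "(\<Sum>k. complex_of_real (fps_nth G k) * z ^ k) = 1 + (\<Sum>k. - (complex_of_real (phi (Suc k)) * z ^ Suc k))"
      by (simp add: G_nth)
    have "summable (\<lambda>k. complex_of_real (phi (Suc k)) * z ^ Suc k)"
    proof (rule summable_norm_cancel, rule summable_comparison_test'[OF inE_summable_abs[OF phi_E]])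
      show "norm (norm (complex_of_real (phi (Suc k)) * z ^ Suc k)) \<le> \<bar>phi (Suc k)\<bar>" for k
        using z by (simp add: norm_mult norm_power mult_left_le power_le_one mult_le_one del: power_Suc)
    qed
    then show ?thesis using phi_root[OF z] unfolding s by (simp add: suminf_minus)
  qed
  from l1_le_inverse_real[OF sG this] obtain F c where F: "l1_le F c" "G * F = 1" by blast
  obtain g where g: "l1_le G g" using l1_le_suminf[OF sG] by blast
  obtain C where C: "\<And>t. integrable M (\<lambda>\<omega>. (Y t \<omega>)\<^sup>2)" "\<And>t. expectation (\<lambda>\<omega>. (Y t \<omega>)\<^sup>2) \<le> C"
    using Y_L2 by blast
  have FG: "F * G = 1" using F(2) by (simp add: mult.commute)
  \<comment> \<open>The autoregressive equation read as a filter identity: G applied to Y returns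
    the innovations.\<close>
  have filter: "AE \<omega> in M. (\<lambda>k. fps_nth G k * Y (t - int k) \<omega>) sums eps t \<omega>" for t
    using Y_AR[of t]
  proof eventually_elim
    case (elim \<omega>)
    have "(\<lambda>k. fps_nth G (Suc k) * Y (t - int (Suc k)) \<omega>) sums (eps t \<omega> - Y t \<omega>)"
      using sums_minus[OF elim] by (simp add: G_nth)
    from sums_Suc[of "\<lambda>k. fps_nth G k * Y (t - int k) \<omega>", OF this] show ?case by (simp add: G_nth)
  qed
  interpret ar_setting M eps sigma2 "expectation (\<lambda>\<omega>. eps 0 \<omega> ^ 4)" lam lamexp c1 c2 Y phi F G c g
    by unfold_locales (fact sigma2_pos phi_E G_def FG F(1) g Y_meas
      AE_inverse_filter_sums[OF FG F(1) g Y_meas C filter])+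
  define b where "b = (\<lambda>n \<omega>. pen_est lam Y (K n) n (tau n \<omega>) \<omega>)"
  have b_meas [measurable]: "(\<lambda>\<omega>. b n \<omega> k) \<in> borel_measurable M" for n k
    unfolding b_def by (rule pen_est_measurable[OF tau_meas tau_pos lam_pos Y_meas])
  have E_meas [measurable]: "(\<lambda>\<omega>. Enorm lam (b n \<omega>)) \<in> borel_measurable M"
    "(\<lambda>\<omega>. Enorm lam (\<lambda>k. b n \<omega> k - phi k)) \<in> borel_measurable M" for n
    unfolding Enorm_def by measurable
  \<comment> \<open>Both conclusions ask for an event implied by a norm bound and coordinatewise
    closeness with a common slack r; they differ only in the choice of r.\<close>
  have main: "(\<lambda>n. prob {\<omega> \<in> space M. Q n \<omega>}) \<longlonglongrightarrow> 1"
    if [measurable]: "\<And>n. Measurable.pred M (Q n)" and r: "0 < r"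
      and Q: "\<And>n \<omega>. \<omega> \<in> space M \<Longrightarrow> (Enorm lam (b n \<omega>))\<^sup>2 \<le> (Enorm lam phi)\<^sup>2 + r \<Longrightarrow>
        \<forall>k\<ge>1. (b n \<omega> k - phi k)\<^sup>2 \<le> r \<Longrightarrow> Q n \<omega>" for Q r
  proof -
    from estimator_close[OF K_lim r] obtain \<rho> where \<rho>: "0 < \<rho>"
      and close: "\<forall>\<^sub>F n in sequentially. \<forall>\<omega> \<tau>. 0 < \<tau> \<longrightarrow> \<tau> \<le> \<rho> \<longrightarrow> 1 < \<tau> * sqrt (real n) \<longrightarrow>
        sqrt (dev_square n (K n) \<omega>) \<le> \<rho> * \<tau> \<longrightarrow>
        (Enorm lam (pen_est lam Y (K n) n \<tau> \<omega>))\<^sup>2 \<le> (Enorm lam phi)\<^sup>2 + r \<and>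
        (\<forall>k\<ge>1. (pen_est lam Y (K n) n \<tau> \<omega> k - phi k)\<^sup>2 \<le> r)"
      by (elim exE conjE)
    show ?thesis
    proof (rule prob_tendsto_1I)
      show "{\<omega> \<in> space M. Q n \<omega>} \<in> events" for n by measurable
      show "\<forall>\<^sub>F n in sequentially. prob {\<omega> \<in> space M. \<not> (tau n \<omega> \<le> \<rho> \<and> 1 < tau n \<omega> * sqrt (real n) \<and>
        sqrt (dev_square n (K n) \<omega>) \<le> \<rho> * tau n \<omega>)} < \<epsilon>" if "0 < \<epsilon>" for \<epsilon>
        by (rule prob_good_event[OF tau_meas tau_to_0 tau_sqrt_n \<rho> that])
      from close show "\<forall>\<^sub>F n in sequentially.
        {\<omega> \<in> space M. \<not> (tau n \<omega> \<le> \<rho> \<and> 1 < tau n \<omega> * sqrt (real n) \<and>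
          sqrt (dev_square n (K n) \<omega>) \<le> \<rho> * tau n \<omega>)} \<in> events \<and>
        space M - {\<omega> \<in> space M. Q n \<omega>} \<subseteq> {\<omega> \<in> space M. \<not> (tau n \<omega> \<le> \<rho> \<and> 1 < tau n \<omega> * sqrt (real n) \<and>
          sqrt (dev_square n (K n) \<omega>) \<le> \<rho> * tau n \<omega>)}"
      proof eventually_elim
        case (elim n)
        have "Q n \<omega>" if "\<omega> \<in> space M" "tau n \<omega> \<le> \<rho>" "1 < tau n \<omega> * sqrt (real n)"
          "sqrt (dev_square n (K n) \<omega>) \<le> \<rho> * tau n \<omega>" for \<omega>
          using elim[rule_format, OF tau_pos[OF that(1)] that(2-4)] by (intro Q that(1)) (simp_all add: b_def)
        moreover have "{\<omega> \<in> space M. \<not> (tau n \<omega> \<le> \<rho> \<and> 1 < tau n \<omega> * sqrt (real n) \<and>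
          sqrt (dev_square n (K n) \<omega>) \<le> \<rho> * tau n \<omega>)} \<in> events" using tau_meas[of n] by measurable
        ultimately show ?case by blast
      qed
    qed
  qed
  have "(\<lambda>n. prob {\<omega> \<in> space M. Enorm lam (b n \<omega>) < Enorm lam phi + 1}) \<longlonglongrightarrow> 1"
  \<comment> \<open>Slack 1/2 suffices, since (|phi| + 1)^2 \<ge> |phi|^2 + 1; this gives the choice
    B = |phi| + 1.\<close>
  proof (rule main[OF _ half_gt_zero[OF zero_less_one]])
    fix n \<omega> assume "(Enorm lam (b n \<omega>))\<^sup>2 \<le> (Enorm lam phi)\<^sup>2 + 1 / 2"
    then have "(Enorm lam (b n \<omega>))\<^sup>2 < (Enorm lam phi + 1)\<^sup>2"
      using Enorm_nonneg[OF phi_E] by (simp add: power2_sum)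
    moreover have "0 \<le> Enorm lam phi + 1" using Enorm_nonneg[OF phi_E] by simp
    ultimately show "Enorm lam (b n \<omega>) < Enorm lam phi + 1" by (rule power2_less_imp_less)
  qed simp_all
  moreover have "(\<lambda>n. prob {\<omega> \<in> space M. Enorm lam (\<lambda>k. b n \<omega> k - phi k) \<le> \<epsilon>}) \<longlonglongrightarrow> 1" if \<epsilon>: "0 < \<epsilon>" for \<epsilon>
  proof -
    have "\<exists>r>0. \<forall>b. inE lam b \<longrightarrow> (Enorm lam b)\<^sup>2 \<le> (Enorm lam phi)\<^sup>2 + r \<longrightarrow>
        (\<forall>k\<ge>1. (b k - phi k)\<^sup>2 \<le> r) \<longrightarrow> Enorm lam (\<lambda>k. b k - phi k) \<le> \<epsilon>"
      by (rule Enorm_close[OF phi_E _ \<epsilon>]) (rule lam_pos)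
    then obtain r where r: "0 < r"
      "\<forall>b. inE lam b \<longrightarrow> (Enorm lam b)\<^sup>2 \<le> (Enorm lam phi)\<^sup>2 + r \<longrightarrow>
        (\<forall>k\<ge>1. (b k - phi k)\<^sup>2 \<le> r) \<longrightarrow> Enorm lam (\<lambda>k. b k - phi k) \<le> \<epsilon>"
      by (elim exE conjE)
    show ?thesis
    proof (rule main[OF _ r(1)])
      fix n \<omega> assume w: "\<omega> \<in> space M" "(Enorm lam (b n \<omega>))\<^sup>2 \<le> (Enorm lam phi)\<^sup>2 + r" "\<forall>k\<ge>1. (b n \<omega> k - phi k)\<^sup>2 \<le> r"
      have "b n \<omega> \<in> EK lam (K n)" unfolding b_def by (rule pen_est_EK[OF tau_pos[OF w(1)] lam_pos])
      then have "inE lam (b n \<omega>)" by (simp add: EK_def)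
      then show "Enorm lam (\<lambda>k. b n \<omega> k - phi k) \<le> \<epsilon>" using r(2)[rule_format, OF _ w(2)] w(3) by blast
    qed simp
  qed
  ultimately show ?thesis unfolding b_def by (intro exI[of _ "Enorm lam phi + 1"]) auto
qed

end
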